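(* Let $m, n, q\in\mathbb{N}$ be such that $q$ is a prime power and $m\geq 3$. Suppose that $$q^{\frac{m}{2}-1}>(n+2)\,W(q^m-1)^2\,W(x^m-1).$$ Then $(q,m)\in T_n$.
   Context: $\mathbb{F}_q$ is the finite field of order $q$ and $\mathbb{F}_{q^m}$ its extension of degree $m$. An element of $\mathbb{F}_{q^m}$ is primitive if it generates the cyclic group $\mathbb{F}_{q^m}^*$. For a rational function $f\in\mathbb{F}_{q^m}(x)$ and $\alpha\in\mathbb{F}_{q^m}$, $(\alpha,f(\alpha))$ is a primitive pair in $\mathbb{F}_{q^m}$ if both $\alpha$ and $f(\alpha)$ are primitive elements of $\mathbb{F}_{q^m}$. An element $\alpha\in\mathbb{F}_{q^m}$ is normal over $\mathbb{F}_q$ if $\{\alpha,\alpha^q,\dots,\alpha^{q^{m-1}}\}$ is a basis of $\mathbb{F}_{q^m}$ over $\mathbb{F}_q$. $\mathrm{Tr}_{\mathbb{F}_{q^m}/\mathbb{F}_q}(\alpha)=\alpha+\alpha^q+\cdots+\alpha^{q^{m-1}}$. Rational functions are written $f=f_1/f_2$ with $f_1,f_2\in\mathbb{F}_{q^m}[x]$ coprime nonzero polynomials and $f_2$ monic. A rational function $f\in\mathbb{F}_{q^m}(x)$ is exceptional if $f=cx^ig^d$ for some $c\in\mathbb{F}_{q^m}$, $i\in\mathbb{Z}$, $g\in\mathbb{F}_{q^m}(x)$ and some integer $d>1$ dividing $q^m-1$, or if $f(x)=x^i$ for some $i\in\mathbb{Z}$ with $\gcd(q^m-1,i)\neq 1$.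 For non-negative integers $n_1,n_2$, $S_{q,m}(n_1,n_2)$ is the set of non-exceptional rational functions $f=f_1/f_2\in\mathbb{F}_{q^m}(x)$ with $\deg f_1\leq n_1$ and $\deg f_2\leq n_2$. $T_{n_1,n_2}$ is the set of pairs $(q,m)\in\mathbb{N}\times\mathbb{N}$ ($q$ a prime power) such that for every $f\in S_{q,m}(n_1,n_2)$ and every $a\in\mathbb{F}_q$ there is an element $\alpha\in\mathbb{F}_{q^m}$, normal over $\mathbb{F}_q$, such that $(\alpha,f(\alpha))$ is a primitive pair in $\mathbb{F}_{q^m}$ and $\mathrm{Tr}_{\mathbb{F}_{q^m}/\mathbb{F}_q}(\alpha^{-1})=a$. $T_n=\bigcap_{n_1+n_2=n}T_{n_1,n_2}$. For a positive integer $k$, $W(k)=2^{\omega(k)}$ is the number of square-free divisors of $k$, where $\omega(k)$ is the number of distinct prime divisors of $k$. For a nonzero polynomial $g\in\mathbb{F}_q[x]$, $W(g)=2^{\Omega_q(g)}$ is the number of monic square-free divisors of $g$ in $\mathbb{F}_q[x]$, where $\Omega_q(g)$ is the number of distinct monic irreducible divisors of $g$ over $\mathbb{F}_q$; $W(x^m-1)$ refers to $x^m-1\in\mathbb{F}_q[x]$. *)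

theory Defs
  imports
    Complex_Main
    "HOL-Library.Cardinality"
    "HOL-Computational_Algebra.Computational_Algebra"
    "HOL-Number_Theory.Prime_Powers"
begin

text \<open>
  The extension of \<open>F_q\<close> of degree \<open>m\<close> is given by a type \<open>'k\<close> with \<open>q\<close> elements, a type \<open>'a\<close>
  with \<open>q ^ m\<close> elements, and a field homomorphism \<open>\<iota>\<close> from \<open>'k\<close> to \<open>'a\<close> (automatically injective);
  \<open>\<iota>\<close> is unique up to automorphisms of the fields.
\<close>

definition finite_field_ext ::
    "('k::{field,finite} \<Rightarrow> 'a::{field,finite}) \<Rightarrow> nat \<Rightarrow> nat \<Rightarrow> bool" where
  "finite_field_ext \<iota> q m \<longleftrightarrow>
     CARD('k) = q \<and> CARD('a) = q ^ m \<and>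
     \<iota> 1 = 1 \<and> (\<forall>x y. \<iota> (x + y) = \<iota> x + \<iota> y) \<and> (\<forall>x y. \<iota> (x * y) = \<iota> x * \<iota> y)"

definition primitive :: "'a::{field,finite} \<Rightarrow> bool" where
  "primitive \<alpha> \<longleftrightarrow> range (\<lambda>k::int. \<alpha> powi k) = UNIV - {0}"

definition normal_over ::
    "('k::{field,finite} \<Rightarrow> 'a::{field,finite}) \<Rightarrow> nat \<Rightarrow> nat \<Rightarrow> 'a \<Rightarrow> bool" where
  "normal_over \<iota> q m \<alpha> \<longleftrightarrow>
     (let B = (\<lambda>i. \<alpha> ^ (q ^ i)) ` {..<m}; scale = (\<lambda>c x. \<iota> c * x)
      in \<not> module.dependent scale B \<and> module.span scale B = UNIV)"

definition field_trace :: "nat \<Rightarrow> nat \<Rightarrow> 'a::field \<Rightarrow> 'a" where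
  "field_trace q m \<alpha> = (\<Sum>i<m. \<alpha> ^ (q ^ i))"

text \<open>Rational functions are elements of the fraction field \<open>'a poly fract\<close>.\<close>

definition rf_const :: "'a::field \<Rightarrow> 'a poly fract" where
  "rf_const c = Fract [:c:] 1"

definition rf_X :: "'a::field poly fract" where
  "rf_X = Fract [:0, 1:] 1"

definition reduced_form :: "'a::field poly fract \<Rightarrow> 'a poly \<Rightarrow> 'a poly \<Rightarrow> bool" where
  "reduced_form f f1 f2 \<longleftrightarrow>
     f = Fract f1 f2 \<and> coprime f1 f2 \<and> f1 \<noteq> 0 \<and> lead_coeff f2 = 1"

definition exceptional :: "'a::{field,finite} poly fract \<Rightarrow> bool" where
  "exceptional f \<longleftrightarrow>
     (\<exists>c i g d. d > 1 \<and> d dvd CARD('a) - 1 \<and> f = rf_const c * rf_X powi i * g ^ d) \<or>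
     (\<exists>i::int. gcd (int (CARD('a) - 1)) i \<noteq> 1 \<and> f = rf_X powi i)"

definition S_set :: "nat \<Rightarrow> nat \<Rightarrow> 'a::{field,finite} poly fract set" where
  "S_set n1 n2 =
     {f. \<not> exceptional f \<and> (\<exists>f1 f2. reduced_form f f1 f2 \<and> degree f1 \<le> n1 \<and> degree f2 \<le> n2)}"

text \<open>The reduced form is unique, and \<open>f\<close> has no value at the zeros of its denominator.\<close>

definition primitive_pair :: "'a::{field,finite} poly fract \<Rightarrow> 'a \<Rightarrow> bool" where
  "primitive_pair f \<alpha> \<longleftrightarrow>
     (\<exists>f1 f2. reduced_form f f1 f2 \<and> poly f2 \<alpha> \<noteq> 0 \<and>
        primitive \<alpha> \<and> primitive (poly f1 \<alpha> / poly f2 \<alpha>))"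

text \<open>
  A set of pairs cannot range over field types, so the sets \<open>T\<close> are relative to the extension
  \<open>\<iota>\<close>: they contain at most the pair \<open>(q, m)\<close> for which \<open>\<iota>\<close> presents the extension.
  Membership does not depend on the choice of \<open>\<iota>\<close> for that pair.
\<close>

definition T_pair ::
    "('k::{field,finite} \<Rightarrow> 'a::{field,finite}) \<Rightarrow> nat \<Rightarrow> nat \<Rightarrow> (nat \<times> nat) set" where
  "T_pair \<iota> n1 n2 =
     {(q, m). primepow q \<and> finite_field_ext \<iota> q m \<and>
        (\<forall>f \<in> S_set n1 n2. \<forall>a.
           \<exists>\<alpha>. normal_over \<iota> q m \<alpha> \<and> primitive_pair f \<alpha> \<and>
               field_trace q m (inverse \<alpha>) = \<iota> a)}"

definition T_set ::
    "('k::{field,finite} \<Rightarrow> 'a::{field,finite}) \<Rightarrow> nat \<Rightarrow> (nat \<times> nat) set" where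
  "T_set \<iota> n = (\<Inter>(n1, n2) \<in> {(n1, n2). n1 + n2 = n}. T_pair \<iota> n1 n2)"

definition W_nat :: "nat \<Rightarrow> nat" where
  "W_nat k = 2 ^ card {p. prime p \<and> p dvd k}"

definition W_poly :: "'k::field poly \<Rightarrow> nat" where
  "W_poly g = 2 ^ card {p. lead_coeff p = 1 \<and> irreducible p \<and> p dvd g}"

end

theory Submission
  imports
    "HOL-Algebra.Algebraic_Closure_Type"
    "HOL-Number_Theory.Residues"
    "HOL-Analysis.Kronecker_Approximation_Theorem"
    Defs
begin

text \<open>
  Write \<open>Q = q ^ m\<close>. The conditions on \<open>\<alpha>\<close> are detected by characters: an element fails to be
  primitive (or normal) exactly if, for some prime \<open>l\<close> dividing \<open>Q - 1\<close> (or some irreducible \<open>P\<close>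
  dividing \<open>x ^ m - 1\<close>), all multiplicative characters of order \<open>l\<close> (or all additive characters
  annihilated by \<open>P\<close>) are \<open>1\<close> at it, and the trace condition on \<open>\<alpha>\<close> is a sum over the \<open>q\<close> additive
  characters of the base field. Expanding the product of these conditions gives the main term plus
  at most \<open>q W(Q - 1)^2 W(x ^ m - 1) - 1\<close> averages of sums
  \<open>\<Sum> \<chi>\<^sub>1(x) \<chi>\<^sub>2(f(x)) \<psi>(\<beta>x + \<gamma>/x)\<close>, each bounded by \<open>(n + 2) \<surd>Q\<close> by Weil, because \<open>f\<close> is not
  exceptional.

  Weil's bound is obtained from a crude one. Stepanov's method, with auxiliary functions in the
  powers of a Kummer root and of an Artin-Schreier root, bounds the sums over all extensions of even
  degree \<open>2s\<close> by \<open>C Q ^ s\<close>. The \<open>L\<close>-function of the sum is a polynomial of degree at most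
  the number of roots plus one, so the sums over the extensions are the power sums of its reciprocal
  roots; by Dirichlet approximation the crude bound forces these roots to have absolute value at most
  \<open>\<surd>Q\<close>.
\<close>

section \<open>Power series expansions and roots\<close>

text \<open>Stepanov's method bounds point counts only from above. As the characters sum to zero
  over the at most \<open>d * P\<close> classes of values and the classes exhaust the points, upper
  bounds near the average give a two-sided bound for the sums; that \<open>f\<close> is not
  exceptional makes the multiplicative character nontrivial on the classes. Even degree matters
  because \<open>x -> x ^ M\<close> with \<open>M = Q ^ s\<close> is then an involution of the field
  of \<open>M * M\<close> elements: at its points the \<open>M\<close>-th power of the auxiliary
  polynomial is, up to nonzero factors, an expression of much smaller degree, and forcing this
  expression to be zero is a linear system in the \<open>M\<close>-th powers of the coefficients.
  The delicate point is that the auxiliary polynomial itself is nonzero. This rests on the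
  independence of the powers of the Kummer and Artin-Schreier roots over polynomials, proved inside
  power series at one point instead of a function field. With an additive part, the independence and
  the vanishing of high \<open>L\<close>-coefficients use a pole of
  \<open>\<beta>x + \<gamma>/x\<close> at infinity, so sums with \<open>\<beta> = 0\<close> and
  \<open>\<gamma> \<noteq> 0\<close> are moved there by \<open>x -> 1/x\<close>.\<close>

lemma (in vector_space) exists_nontrivial_relation:
  assumes "finite I" "finite S" "\<And>i. i \<in> I \<Longrightarrow> v i \<in> span S" "card S < card I"
  obtains c where "\<exists>i\<in>I. c i \<noteq> 0" "(\<Sum>i\<in>I. scale (c i) (v i)) = 0"
proof (cases "inj_on v I")
  case False
  then obtain i j where ij: "i \<in> I" "j \<in> I" "i \<noteq> j" "v i = v j"
    by (auto simp: inj_on_def)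
  define c where "c = (\<lambda>k. if k = i then 1 else if k = j then -1 else (0::'a))"
  have "(\<Sum>k\<in>I. scale (c k) (v k)) = (\<Sum>k\<in>{i,j}. scale (c k) (v k))"
    using ij assms(1) by (intro sum.mono_neutral_right) (auto simp: c_def)
  also have "\<dots> = 0"
    using ij by (simp add: c_def)
  finally show ?thesis
    using ij by (intro that[of c]) (auto simp: c_def)
next
  case True
  have "dependent (v ` I)"
  proof (rule ccontr)
    assume "independent (v ` I)"
    from independent_span_bound[OF assms(2) this] assms(3) have "card (v ` I) \<le> card S"
      by auto
    with card_image[OF True] assms(4) show False
      by simp
  qed
  then obtain u where u: "\<exists>w\<in>v ` I. u w \<noteq> 0" "(\<Sum>w\<in>v ` I. scale (u w) w) = 0"
    using dependent_finite[of "v ` I"] assms(1) by auto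
  show ?thesis
    using u True by (intro that[of "u \<circ> v"]) (auto simp: sum.reindex)
qed

lemma vector_space_poly: "vector_space (smult :: 'a::field \<Rightarrow> 'a poly \<Rightarrow> 'a poly)"
  by unfold_locales (auto simp: smult_add_left smult_add_right)

lemma vector_space_fps: "vector_space (\<lambda>(c::'a::field) f. fps_const c * f)"
  by unfold_locales (auto simp: algebra_simps simp flip: fps_const_add fps_const_mult)

section \<open>Taylor expansions and X-adic limits\<close>

definition taylor :: "'a::field \<Rightarrow> 'a poly \<Rightarrow> 'a fps" where
  "taylor x0 b = fps_of_poly (pcompose b [:x0, 1:])"

lemma taylor_0 [simp]: "taylor x0 0 = 0"
  and taylor_1 [simp]: "taylor x0 1 = 1"
  and taylor_const: "taylor x0 [:c:] = fps_const c"
  and taylor_add: "taylor x0 (a + b) = taylor x0 a + taylor x0 b"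
  and taylor_diff: "taylor x0 (a - b) = taylor x0 a - taylor x0 b"
  and taylor_uminus: "taylor x0 (- a) = - taylor x0 a"
  and taylor_mult: "taylor x0 (a * b) = taylor x0 a * taylor x0 b"
  and taylor_smult: "taylor x0 (smult c a) = fps_const c * taylor x0 a"
  and taylor_sum: "taylor x0 (sum f A) = (\<Sum>i\<in>A. taylor x0 (f i))"
  by (simp_all add: taylor_def fps_of_poly_add fps_of_poly_diff pcompose_add fps_of_poly_mult
      pcompose_diff pcompose_mult pcompose_smult fps_of_poly_smult fps_of_poly_const
      pcompose_sum fps_of_poly_sum pcompose_1 pcompose_uminus fps_of_poly_uminus)

lemma taylor_power: "taylor x0 (a ^ n) = taylor x0 a ^ n"
  by (induction n) (auto simp: taylor_mult)

lemma taylor_eq_0_iff [simp]: "taylor x0 b = 0 \<longleftrightarrow> b = 0"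
proof -
  have "taylor x0 b = 0 \<longleftrightarrow> pcompose b [:x0, 1:] = 0"
    unfolding taylor_def by (metis fps_of_poly_0 fps_of_poly_eq_iff)
  then show ?thesis
    by (simp add: pcompose_eq_0_iff)
qed

lemma taylor_nth_0 [simp]: "fps_nth (taylor x0 b) 0 = poly b x0"
  by (simp add: taylor_def flip: poly_0_coeff_0) (simp add: poly_pcompose)

lemma taylor_X: "taylor x0 [:-x0, 1:] = fps_X"
  by (simp add: taylor_def pcompose_pCons pcompose_1 flip: one_pCons)

lemma fps_X_power_dvd_iff: "fps_X ^ n dvd (f :: 'a::field fps) \<longleftrightarrow> (\<forall>i<n. fps_nth f i = 0)"
proof (cases "f = 0")
  case False
  then show ?thesis
    using subdegree_geI[of f n] by (auto simp: fps_dvd_iff intro: nth_less_subdegree_zero)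
qed auto

text \<open>Power series are \<open>X\<close>-adically complete: coefficient \<open>n\<close> no
  longer changes after the \<open>n\<close>-th approximation, so the diagonal is the limit.\<close>

lemma fps_cauchy_limit:
  fixes a :: "nat \<Rightarrow> 'a::field fps"
  assumes "\<And>s. fps_X ^ Suc s dvd a (Suc s) - a s"
  obtains b where "\<And>s. fps_X ^ Suc s dvd b - a s"
proof
  fix s
  have stable: "fps_nth (a t) i = fps_nth (a i) i" if "i \<le> t" for i t
    using that
  proof (induction rule: dec_induct)
    case (step t)
    have "fps_nth (a (Suc t) - a t) i = 0"
      using assms[of t] step(1) by (subst (asm) fps_X_power_dvd_iff) auto
    with step show ?case by simp
  qed auto
  show "fps_X ^ Suc s dvd Abs_fps (\<lambda>n. fps_nth (a n) n) - a s"
  proof (subst fps_X_power_dvd_iff, intro allI impI)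
    fix i assume "i < Suc s"
    then have "fps_nth (a s) i = fps_nth (a i) i"
      by (intro stable) auto
    then show "fps_nth (Abs_fps (\<lambda>n. fps_nth (a n) n) - a s) i = 0"
      by simp
  qed
qed

lemma fps_eq_0_if_all_X_power_dvd:
  assumes "\<And>s. fps_X ^ Suc s dvd (f :: 'a::field fps)"
  shows "f = 0"
proof (rule fps_ext)
  fix n show "fps_nth f n = fps_nth 0 n"
    using assms[of n] by (subst (asm) fps_X_power_dvd_iff) auto
qed

lemma fps_X_dvd_iff: "fps_X dvd (f :: 'a::field fps) \<longleftrightarrow> fps_nth f 0 = 0"
  using fps_X_power_dvd_iff[of 1 f] by simp

section \<open>Frobenius powers and roots of power series\<close>

lemma char_power_add:
  fixes x y :: "'a::comm_ring_1"
  assumes "prime CHAR('a)"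
  shows "(x + y) ^ (CHAR('a) ^ n) = x ^ (CHAR('a) ^ n) + y ^ (CHAR('a) ^ n)"
  using freshmans_dream'[of "CHAR('a) ^ n" n x y] assms by auto

lemma char_power_diff:
  fixes x y :: "'a::comm_ring_1"
  assumes "prime CHAR('a)"
  shows "(x - y) ^ (CHAR('a) ^ n) = x ^ (CHAR('a) ^ n) - y ^ (CHAR('a) ^ n)"
  using char_power_add[OF assms, of "x - y" y n] by simp

lemma char_power_sum:
  fixes f :: "'b \<Rightarrow> 'a::comm_ring_1"
  assumes "prime CHAR('a)"
  shows "(\<Sum>i\<in>A. f i) ^ (CHAR('a) ^ n) = (\<Sum>i\<in>A. f i ^ (CHAR('a) ^ n))"
  using freshmans_dream_sum'[of "CHAR('a) ^ n" n f A] assms by auto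

lemma char_power_inject:
  fixes x y :: "'a::field"
  assumes "prime CHAR('a)" "x ^ (CHAR('a) ^ n) = y ^ (CHAR('a) ^ n)"
  shows "x = y"
proof -
  have "(x - y) ^ (CHAR('a) ^ n) = 0"
    using char_power_diff[OF assms(1), of x y n] assms(2) by simp
  then show ?thesis
    by (simp split: if_splits)
qed

lemma diff_dvd_power_diff: "(a :: 'a::comm_ring_1) - b dvd a ^ n - b ^ n"
proof (induction n)
  case (Suc n)
  have "a ^ Suc n - b ^ Suc n = a * (a ^ n - b ^ n) + (a - b) * b ^ n"
    by (simp add: algebra_simps)
  then show ?case
    using Suc by (metis dvd_add dvd_mult dvd_triv_left)
qed auto

text \<open>Since \<open>Q \<equiv> 1\<close> modulo \<open>d\<close>, the partial roots \<open>g\<^bsup>-(Q^s-1)/d\<^esup>\<close> converge \<open>X\<close>-adically.\<close>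

lemma fps_kummer_root:
  fixes g :: "'a::field fps"
  assumes p: "prime CHAR('a)" and Q: "Q = CHAR('a) ^ \<kappa>" "\<kappa> > 0" and d: "d dvd Q - 1"
    and g: "fps_nth g 0 = 1"
  obtains y where "fps_nth y 0 = 1" "y ^ d = g"
proof -
  have p': "prime CHAR('a fps)"
    using p by simp
  obtain e where e: "Q - 1 = d * e"
    using d by (elim dvdE)
  have Q1: "Q > 1"
    using Q p by (metis one_less_power prime_gt_1_nat)
  \<comment> \<open>As \<open>d * e = Q - 1\<close>, the exponents add up to
    \<open>(Q ^ s - 1) / d\<close>. The limit is thus a \<open>d\<close>-th root of
    \<open>1 / g\<close>, to be inverted at the end.\<close>
  define w where "w = (\<lambda>s. \<Prod>t<s. g ^ (Q ^ t * e))"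
  have wd: "w s ^ d * g = g ^ (Q ^ s)" for s
  proof (induction s)
    case (Suc s)
    have "w (Suc s) ^ d * g = (g ^ (Q ^ s * e)) ^ d * (w s ^ d * g)"
      by (simp add: w_def power_mult_distrib mult_ac)
    also have "(g ^ (Q ^ s * e)) ^ d = g ^ (Q ^ s * e * d)"
      by (simp only: power_mult)
    also have "g ^ (Q ^ s * e * d) * (w s ^ d * g) = g ^ (Q ^ s * (e * d) + Q ^ s)"
      by (simp only: Suc power_add mult.assoc)
    also have "Q ^ s * (e * d) + Q ^ s = Q ^ s * (Q - 1 + 1)"
      using e by (simp add: algebra_simps)
    also have "\<dots> = Q ^ Suc s"
      using Q1 by simp
    finally show ?case .
  qed (simp add: w_def)
  have gQ: "fps_X ^ Suc s dvd g ^ (Q ^ s) - 1" for s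
  proof -
    have "(g - 1) ^ (Q ^ s) = g ^ (Q ^ s) - 1"
      using char_power_diff[OF p', of g 1 "\<kappa> * s"] by (simp add: Q power_mult)
    moreover have "fps_X ^ (Q ^ s) dvd (g - 1) ^ (Q ^ s)"
      using g by (intro dvd_power_same) (simp add: fps_X_dvd_iff)
    moreover have "fps_X ^ Suc s dvd (fps_X :: 'a fps) ^ (Q ^ s)"
    proof (rule le_imp_power_dvd)
      show "Suc s \<le> Q ^ s"
        using less_exp[of s] power_mono[of 2 Q s] Q1 by linarith
    qed
    ultimately show ?thesis
      using dvd_trans by fastforce
  qed
  have "fps_X ^ Suc s dvd w (Suc s) - w s" for s
  proof -
    have "w (Suc s) - w s = w s * ((g ^ (Q ^ s)) ^ e - 1 ^ e)"
      by (simp only: w_def power_mult prod.lessThan_Suc power_one right_diff_distrib mult_1_right)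
    moreover have "g ^ (Q ^ s) - 1 dvd (g ^ (Q ^ s)) ^ e - 1 ^ e"
      by (rule diff_dvd_power_diff)
    ultimately show ?thesis
      using dvd_mult[OF dvd_trans[OF gQ[of s]]] by simp
  qed
  then obtain b where b: "\<And>s. fps_X ^ Suc s dvd b - w s"
    using fps_cauchy_limit by blast
  have bd: "b ^ d * g - 1 = 0"
  proof (rule fps_eq_0_if_all_X_power_dvd)
    fix s
    have "b ^ d * g - 1 = (b ^ d - w s ^ d) * g + (g ^ (Q ^ s) - 1)"
      by (simp add: left_diff_distrib wd)
    moreover have "b - w s dvd b ^ d - w s ^ d"
      by (rule diff_dvd_power_diff)
    ultimately show "fps_X ^ Suc s dvd b ^ d * g - 1"
      using dvd_add[OF dvd_mult2[OF dvd_trans[OF b[of s]]] gQ[of s]] by (simp only:)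
  qed
  have "fps_nth (b - w 0) 0 = 0"
    using b[of 0] by (simp add: fps_X_dvd_iff)
  then have b0: "fps_nth b 0 = 1"
    by (simp add: w_def)
  have *: "inverse b * b = 1"
    using b0 by (intro inverse_mult_eq_1) auto
  show ?thesis
  proof
    show "fps_nth (inverse b) 0 = 1"
      using b0 by simp
    have "inverse b ^ d = inverse b ^ d * (b ^ d * g)"
      using bd by simp
    also have "\<dots> = (inverse b * b) ^ d * g"
      by (simp only: power_mult_distrib mult.assoc)
    also have "\<dots> = g"
      using * by simp
    finally show "inverse b ^ d = g" .
  qed
qed

text \<open>Formally \<open>z = - (h + h ^ p + h ^ (p ^ 2) + ...)\<close>, for which
  \<open>z ^ p - z\<close> telescopes to \<open>h\<close>; the constant term 0 of \<open>h\<close>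
  makes the series converge.\<close>

lemma fps_artin_schreier_root:
  fixes h :: "'a::field fps"
  assumes p: "prime CHAR('a)" and h: "fps_nth h 0 = 0"
  obtains z where "fps_nth z 0 = 0" "z ^ CHAR('a) - z = h"
proof -
  let ?p = "CHAR('a)"
  have p': "prime CHAR('a fps)"
    using p by simp
  define a where "a = (\<lambda>s. - (\<Sum>i<s. h ^ (?p ^ i)))"
  have hX: "fps_X ^ Suc s dvd h ^ (?p ^ s)" for s
  proof -
    have "fps_X ^ (?p ^ s) dvd h ^ (?p ^ s)"
      using h by (intro dvd_power_same) (simp add: fps_X_dvd_iff)
    moreover have "fps_X ^ Suc s dvd (fps_X :: 'a fps) ^ (?p ^ s)"
    proof (rule le_imp_power_dvd)
      show "Suc s \<le> ?p ^ s"
        using less_exp[of s] power_mono[of 2 ?p s] prime_ge_2_nat[OF p] by linarith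
    qed
    ultimately show ?thesis
      using dvd_trans by fastforce
  qed
  have "fps_X ^ Suc s dvd a (Suc s) - a s" for s
    using hX[of s] by (simp add: a_def)
  then obtain z where z: "\<And>s. fps_X ^ Suc s dvd z - a s"
    using fps_cauchy_limit by blast
  have as: "a s ^ ?p - a s = h - h ^ (?p ^ s)" for s
  proof -
    have "a s ^ ?p = - ((\<Sum>i<s. h ^ (?p ^ i)) ^ ?p)"
      unfolding a_def using minus_power_prime_CHAR[of ?p "\<Sum>i<s. h ^ (?p ^ i)"] p by simp
    also have "(\<Sum>i<s. h ^ (?p ^ i)) ^ ?p = (\<Sum>i<s. h ^ (?p ^ Suc i))"
      using char_power_sum[OF p', of "\<lambda>i. h ^ (?p ^ i)" "{..<s}" 1]
      by (simp add: power_mult mult.commute flip: power_mult)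
    finally have "a s ^ ?p - a s = (\<Sum>i<s. h ^ (?p ^ i) - h ^ (?p ^ Suc i))"
      by (simp add: a_def sum_subtractf)
    also have "\<dots> = h - h ^ (?p ^ s)"
      by (subst sum_lessThan_telescope') simp
    finally show ?thesis .
  qed
  have "z ^ ?p - z - h = 0"
  proof (rule fps_eq_0_if_all_X_power_dvd)
    fix s
    have "z ^ ?p - z - h = (z ^ ?p - a s ^ ?p) - (z - a s) + (a s ^ ?p - a s - h)"
      by simp
    also have "\<dots> = (z ^ ?p - a s ^ ?p) - (z - a s) - h ^ (?p ^ s)"
      by (simp add: as)
    finally have *: "z ^ ?p - z - h = (z ^ ?p - a s ^ ?p) - (z - a s) - h ^ (?p ^ s)" .
    have "z - a s dvd z ^ ?p - a s ^ ?p"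
      by (rule diff_dvd_power_diff)
    then show "fps_X ^ Suc s dvd z ^ ?p - z - h"
      unfolding * using dvd_diff[OF dvd_diff[OF dvd_trans[OF z[of s]] z[of s]] hX[of s]] by blast
  qed
  moreover have "fps_nth z 0 = 0"
    using z[of 0] by (simp add: fps_X_dvd_iff a_def)
  ultimately show ?thesis
    using that[of z] by (simp only: eq_iff_diff_eq_0[symmetric] diff_eq_eq add_0)
qed

section \<open>Independence of Kummer and Artin-Schreier roots\<close>

lemma dvd_add_eq_0:
  fixes a :: "'a::comm_ring_1"
  assumes "a dvd u" "u + v = 0"
  shows "a dvd v"
proof -
  have "v = - u"
    using assms(2) by (simp add: eq_neg_iff_add_eq_0 add.commute)
  with assms(1) show ?thesis
    by simp
qed

text \<open>\<open>y\<close> and \<open>z\<close> are the expansions at \<open>x0\<close> of a \<open>d\<close>-th root of \<open>c G\<close> and of an Artin-Schreier root of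
  \<open>hn / X\<close>. The assumption \<open>kummer\<close> says that \<open>d\<close> is the order of \<open>G\<close> modulo \<open>d\<close>-th powers.\<close>

locale fps_cover =
  fixes p Q \<kappa> d P :: nat and G hn :: "'c::field poly" and c x0 :: 'c and y z :: "'c fps"
  assumes p: "prime p" "p = CHAR('c)" and Q: "Q = p ^ \<kappa>" "\<kappa> > 0"
    and d: "d dvd Q - 1" "d > 0" and G: "G \<noteq> 0"
    and kummer: "\<And>i. (\<And>\<rho>. d dvd i * order \<rho> G) \<Longrightarrow> d dvd i"
    and y: "y ^ d = fps_const c * taylor x0 G" "c \<noteq> 0"
    and P: "P = 1 \<or> P = p \<and> degree hn = 2 \<and> taylor x0 [:0, 1:] * (z ^ p - z) = taylor x0 hn"
begin

lemma p1: "p > 1"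
  using p prime_gt_1_nat by blast

lemma Q1: "Q > 1"
  using p1 Q one_less_power[of p \<kappa>] by simp

lemma pfps: "prime CHAR('c fps)"
  using p by simp

lemma pow_p_diff: "((u :: 'c fps) - v) ^ (p ^ n) = u ^ (p ^ n) - v ^ (p ^ n)"
  using char_power_diff[OF pfps, of u v n] p by simp

lemma pow_p_sum: "(\<Sum>i\<in>A. f i :: 'c fps) ^ (p ^ n) = (\<Sum>i\<in>A. f i ^ (p ^ n))"
  using char_power_sum[OF pfps, of f A n] p by simp

lemma y_nz: "y \<noteq> 0"
  using y G d by (metis fps_const_eq_0_iff mult_eq_0_iff power_0_left neq0_conv taylor_eq_0_iff)

text \<open>The factor by which the \<open>Q\<close>-th power multiplies \<open>y\<close>: as
  \<open>d\<close> divides \<open>Q - 1\<close>, \<open>y ^ (Q - 1)\<close> is a polynomial.\<close>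

definition g where "g = smult (c ^ ((Q - 1) div d)) (G ^ ((Q - 1) div d))"

lemma g_nz: "g \<noteq> 0"
  using G y by (simp add: g_def)

lemma y_pow_Q: "y ^ Q = y * taylor x0 g"
proof -
  have "Q = Suc (d * ((Q - 1) div d))"
    using d Q1 by simp
  then have "y ^ Q = y * (y ^ d) ^ ((Q - 1) div d)"
    by (metis power_Suc power_mult)
  then show ?thesis
    by (simp add: y g_def taylor_smult taylor_power power_mult_distrib fps_const_power)
qed

text \<open>Numerator of \<open>z ^ (p ^ n) - z\<close>, which is the sum of the
  \<open>p ^ i\<close>-th powers of \<open>hn / X\<close> over \<open>i < n\<close>, for the common
  denominator \<open>X ^ (p ^ (n - 1))\<close>.\<close>

definition AS :: "nat \<Rightarrow> 'c poly" where
  "AS n = (\<Sum>i<n. hn ^ (p ^ i) * [:0, 1:] ^ (p ^ (n - 1) - p ^ i))"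

lemma taylor_AS:
  assumes "P \<noteq> 1"
  shows "taylor x0 [:0, 1:] ^ (p ^ (n - 1)) * (z ^ (p ^ n) - z) = taylor x0 (AS n)"
proof -
  have "z ^ (p ^ n) - z = (\<Sum>i<n. z ^ (p ^ Suc i) - z ^ (p ^ i))"
    by (subst sum_lessThan_telescope) simp
  also have "\<dots> = (\<Sum>i<n. (z ^ p - z) ^ (p ^ i))"
    by (simp add: pow_p_diff power_mult)
  finally have "taylor x0 [:0, 1:] ^ (p ^ (n - 1)) * (z ^ (p ^ n) - z) =
      (\<Sum>i<n. taylor x0 [:0, 1:] ^ (p ^ (n - 1)) * (z ^ p - z) ^ (p ^ i))"
    by (simp add: sum_distrib_left)
  also have "\<dots> = (\<Sum>i<n. taylor x0 (hn ^ (p ^ i) * [:0, 1:] ^ (p ^ (n - 1) - p ^ i)))"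
  proof (rule sum.cong)
    fix i assume i: "i \<in> {..<n}"
    have "p ^ i \<le> p ^ (n - 1)"
      using i p1 by (intro power_increasing) auto
    then have "p ^ (n - 1) = p ^ i + (p ^ (n - 1) - p ^ i)"
      by simp
    then have "taylor x0 [:0, 1:] ^ (p ^ (n - 1)) =
        taylor x0 [:0, 1:] ^ (p ^ i) * taylor x0 [:0, 1:] ^ (p ^ (n - 1) - p ^ i)"
      by (metis power_add)
    then have "taylor x0 [:0, 1:] ^ (p ^ (n - 1)) * (z ^ p - z) ^ (p ^ i) =
        (taylor x0 [:0, 1:] * (z ^ p - z)) ^ (p ^ i) * taylor x0 [:0, 1:] ^ (p ^ (n - 1) - p ^ i)"
      by (simp add: power_mult_distrib mult_ac)
    also have "taylor x0 [:0, 1:] * (z ^ p - z) = taylor x0 hn"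
      using P assms by auto
    finally show "taylor x0 [:0, 1:] ^ (p ^ (n - 1)) * (z ^ p - z) ^ (p ^ i) =
        taylor x0 (hn ^ (p ^ i) * [:0, 1:] ^ (p ^ (n - 1) - p ^ i))"
      by (simp add: taylor_mult taylor_power)
  qed auto
  finally show ?thesis
    by (simp add: AS_def taylor_sum)
qed

definition X1 :: "'c poly" where "X1 = [:0, 1:] ^ (p ^ (\<kappa> - 1))"

definition "Hn = AS \<kappa>"

lemma X1_nz: "X1 \<noteq> 0" and degree_X1: "degree X1 = p ^ (\<kappa> - 1)"
  by (simp_all add: X1_def degree_power_eq)

lemma Hn_eq: "P \<noteq> 1 \<Longrightarrow> taylor x0 X1 * (z ^ Q - z) = taylor x0 Hn"
  using taylor_AS[of \<kappa>] by (simp add: X1_def Hn_def taylor_power Q)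

lemma degree_Hn:
  assumes "P \<noteq> 1"
  shows "degree Hn = 2 * p ^ (\<kappa> - 1)"
proof -
  have hn: "degree hn = 2" "hn \<noteq> 0"
    using P assms by auto
  obtain k where k: "\<kappa> = Suc k"
    using Q by (cases \<kappa>) auto
  have deg: "degree (hn ^ n * [:0, 1:] ^ m) = 2 * n + m" for n m
    using hn by (simp add: degree_mult_eq degree_power_eq)
  have top: "degree (hn ^ (p ^ k)) = 2 * p ^ k"
    using deg[of "p ^ k" 0] by simp
  have lt: "degree (\<Sum>i<k. hn ^ (p ^ i) * [:0, 1:] ^ (p ^ k - p ^ i)) < 2 * p ^ k"
  proof (cases k)
    case (Suc k')
    have "degree (hn ^ (p ^ i) * [:0, 1:] ^ (p ^ k - p ^ i)) < 2 * p ^ k" if "i < k" for i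
      using that p1 power_strict_increasing[of i k p] unfolding deg by simp
    then show ?thesis
      using p1 by (intro degree_sum_less) auto
  qed (use p1 in auto)
  have "Hn = (\<Sum>i<k. hn ^ (p ^ i) * [:0, 1:] ^ (p ^ k - p ^ i)) + hn ^ (p ^ k)"
    unfolding Hn_def AS_def using k by simp
  with lt top show ?thesis
    by (simp add: degree_add_eq_right k)
qed

definition comb :: "nat \<Rightarrow> (nat \<Rightarrow> nat \<Rightarrow> 'c poly) \<Rightarrow> 'c fps" where
  "comb J b = (\<Sum>i<d. \<Sum>j\<le>J. taylor x0 (b i j) * y ^ i * z ^ j)"

text \<open>Coefficients of the \<open>Q\<close>-th power of a combination:
  \<open>z ^ Q = z + Hn / X1\<close> is expanded binomially, and \<open>X1 ^ J\<close> clears all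
  denominators.\<close>

definition frob_coeff where
  "frob_coeff J b i l = (\<Sum>j\<in>{l..J}. b i j ^ Q * g ^ i * of_nat (j choose l) * Hn ^ (j - l) * X1 ^ (J - (j - l)))"

lemma comb_frob:
  assumes "P \<noteq> 1 \<or> J = 0"
  shows "comb J (frob_coeff J b) = taylor x0 X1 ^ J * comb J b ^ Q"
proof -
  have z: "taylor x0 X1 ^ J * (z ^ Q) ^ j =
      (\<Sum>l\<le>j. taylor x0 (of_nat (j choose l) * Hn ^ (j - l) * X1 ^ (J - (j - l))) * z ^ l)"
    if "j \<le> J" for j
  proof (cases "J = 0")
    case False
    then have P1: "P \<noteq> 1"
      using assms by auto
    have of_nat: "taylor x0 (of_nat n) = of_nat n" for n
      by (induction n) (auto simp: taylor_add)
    have "taylor x0 X1 ^ J * (z ^ Q) ^ j = taylor x0 X1 ^ J * (z + (z ^ Q - z)) ^ j"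
      by simp
    also have "\<dots> = taylor x0 X1 ^ J * (\<Sum>l\<le>j. of_nat (j choose l) * z ^ l * (z ^ Q - z) ^ (j - l))"
      by (simp only: binomial_ring)
    also have "\<dots> = (\<Sum>l\<le>j. taylor x0 X1 ^ J * (of_nat (j choose l) * z ^ l * (z ^ Q - z) ^ (j - l)))"
      by (simp add: sum_distrib_left)
    also have "\<dots> = (\<Sum>l\<le>j. taylor x0 (of_nat (j choose l) * Hn ^ (j - l) * X1 ^ (J - (j - l))) * z ^ l)"
    proof (rule sum.cong)
      fix l assume "l \<in> {..j}"
      then have "J = (j - l) + (J - (j - l))"
        using that by auto
      then have "taylor x0 X1 ^ J = taylor x0 X1 ^ (j - l) * taylor x0 X1 ^ (J - (j - l))"
        by (metis power_add)
      then have "taylor x0 X1 ^ J * (of_nat (j choose l) * z ^ l * (z ^ Q - z) ^ (j - l)) =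
        of_nat (j choose l) * (taylor x0 X1 * (z ^ Q - z)) ^ (j - l) * taylor x0 X1 ^ (J - (j - l)) * z ^ l"
        by (simp add: power_mult_distrib mult_ac)
      then show "taylor x0 X1 ^ J * (of_nat (j choose l) * z ^ l * (z ^ Q - z) ^ (j - l)) =
        taylor x0 (of_nat (j choose l) * Hn ^ (j - l) * X1 ^ (J - (j - l))) * z ^ l"
        by (simp add: Hn_eq[OF P1] taylor_mult taylor_power of_nat)
    qed auto
    finally show ?thesis .
  qed (use that in simp)
  have yi: "(y ^ Q) ^ i = y ^ i * taylor x0 (g ^ i)" for i
    by (simp add: y_pow_Q power_mult_distrib taylor_power)
  have "comb J b ^ Q = (\<Sum>i<d. \<Sum>j\<le>J. taylor x0 (b i j ^ Q) * (y ^ Q) ^ i * (z ^ Q) ^ j)"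
    by (simp add: comb_def Q pow_p_sum power_mult_distrib taylor_power mult.commute
        flip: power_mult)
  then have "taylor x0 X1 ^ J * comb J b ^ Q =
      (\<Sum>i<d. \<Sum>j\<le>J. taylor x0 (b i j ^ Q) * (y ^ Q) ^ i * (taylor x0 X1 ^ J * (z ^ Q) ^ j))"
    by (simp add: sum_distrib_left mult_ac)
  also have "\<dots> = (\<Sum>i<d. \<Sum>j\<le>J. \<Sum>l\<le>j. taylor x0
      (b i j ^ Q * g ^ i * of_nat (j choose l) * Hn ^ (j - l) * X1 ^ (J - (j - l))) * y ^ i * z ^ l)"
  proof (intro sum.cong refl)
    fix i j assume "j \<in> {..J}"
    then have "taylor x0 (b i j ^ Q) * (y ^ Q) ^ i * (taylor x0 X1 ^ J * (z ^ Q) ^ j) =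
      (\<Sum>l\<le>j. taylor x0 (b i j ^ Q) * (y ^ i * taylor x0 (g ^ i)) *
        (taylor x0 (of_nat (j choose l) * Hn ^ (j - l) * X1 ^ (J - (j - l))) * z ^ l))"
      by (simp only: z atMost_iff yi sum_distrib_left)
    also have "\<dots> = (\<Sum>l\<le>j. taylor x0
      (b i j ^ Q * g ^ i * of_nat (j choose l) * Hn ^ (j - l) * X1 ^ (J - (j - l))) * y ^ i * z ^ l)"
      by (simp only: taylor_mult mult_ac)
    finally show "taylor x0 (b i j ^ Q) * (y ^ Q) ^ i * (taylor x0 X1 ^ J * (z ^ Q) ^ j) =
      (\<Sum>l\<le>j. taylor x0
      (b i j ^ Q * g ^ i * of_nat (j choose l) * Hn ^ (j - l) * X1 ^ (J - (j - l))) * y ^ i * z ^ l)" .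
  qed
  also have "\<dots> = (\<Sum>i<d. \<Sum>l\<le>J. \<Sum>j\<in>{l..J}. taylor x0
      (b i j ^ Q * g ^ i * of_nat (j choose l) * Hn ^ (j - l) * X1 ^ (J - (j - l))) * y ^ i * z ^ l)"
  proof (rule sum.cong)
    fix i
    show "(\<Sum>j\<le>J. \<Sum>l\<le>j. f j l) = (\<Sum>l\<le>J. \<Sum>j\<in>{l..J}. f j l)" for f :: "nat \<Rightarrow> nat \<Rightarrow> 'c fps"
    proof -
      have "(\<Sum>j\<le>J. \<Sum>l\<le>j. f j l) = (\<Sum>(j, l)\<in>Sigma {..J} (\<lambda>j. {..j}). f j l)"
        by (subst sum.Sigma) auto
      also have "\<dots> = (\<Sum>(l, j)\<in>Sigma {..J} (\<lambda>l. {l..J}). f j l)"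
        by (rule sum.reindex_bij_witness[of _ "\<lambda>(l, j). (j, l)" "\<lambda>(j, l). (l, j)"]) auto
      also have "\<dots> = (\<Sum>l\<le>J. \<Sum>j\<in>{l..J}. f j l)"
        by (subst sum.Sigma) auto
      finally show ?thesis .
    qed
  qed auto
  also have "\<dots> = comb J (frob_coeff J b)"
    by (simp add: comb_def frob_coeff_def taylor_sum sum_distrib_right)
  finally show ?thesis
    by simp
qed

text \<open>Compare orders at each root. The \<open>(Q - 1)\<close>-th powers contribute multiples
  of \<open>Q - 1\<close>, and division by \<open>(Q - 1) / d\<close> shows that \<open>d\<close>
  divides \<open>(i2 - i1) * order \<rho> G\<close> everywhere; \<open>kummer\<close> excludes this
  for \<open>0 < i2 - i1 < d\<close>.\<close>

lemma kummer_coeffs: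
  assumes b: "b1 \<noteq> 0" "b2 \<noteq> 0" and eq: "b1 ^ (Q - 1) * g ^ i1 = b2 ^ (Q - 1) * g ^ i2"
    and i: "i1 < i2" "i2 < d"
  shows False
proof -
  define e where "e = (Q - 1) div d"
  have e: "Q - 1 = d * e"
    using d by (simp add: e_def)
  have e0: "e > 0"
    using e Q1 by (cases e) auto
  have ord: "order \<rho> (b ^ n) = n * order \<rho> b" if "b \<noteq> 0" for \<rho> n and b :: "'c poly"
    using that by (induction n) (auto simp: order_mult)
  have ordg: "order \<rho> g = e * order \<rho> G" for \<rho>
    using y G by (simp add: g_def order_smult ord e_def)
  have "d dvd (i2 - i1) * order \<rho> G" for \<rho>
  proof -
    have "order \<rho> (b1 ^ (Q - 1) * g ^ i1) = order \<rho> (b2 ^ (Q - 1) * g ^ i2)"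
      using eq by simp
    then have "(Q - 1) * order \<rho> b1 + i1 * (e * order \<rho> G) = (Q - 1) * order \<rho> b2 + i2 * (e * order \<rho> G)"
      using b g_nz by (subst (asm) (1 2) order_mult) (auto simp: ord ordg)
    then have "e * (d * order \<rho> b1 + i1 * order \<rho> G) = e * (d * order \<rho> b2 + i2 * order \<rho> G)"
      unfolding e by (simp add: algebra_simps)
    then have *: "d * order \<rho> b1 + i1 * order \<rho> G = d * order \<rho> b2 + i2 * order \<rho> G"
      using e0 by simp
    then have "(i2 - i1) * order \<rho> G = d * order \<rho> b1 - d * order \<rho> b2"
      using i by (simp add: diff_mult_distrib)
    then show ?thesis
      by (simp flip: diff_mult_distrib2)
  qed
  then have "d dvd i2 - i1"
    by (rule kummer)
  with i show False
    by (auto dest: dvd_imp_le)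
qed

text \<open>With \<open>u = b' / b\<close> the equation reads
  \<open>u - u ^ Q = of_nat J * Hn / X1\<close>. The right side has a pole of order
  \<open>p ^ (\<kappa> - 1)\<close> at infinity, whereas the left side has none or one of order
  divisible by \<open>Q\<close>. The degree comparisons below say this without denominators.\<close>

lemma artin_schreier_coeffs:
  assumes P1: "P \<noteq> 1" and b: "b \<noteq> 0" and J: "0 < J" "J < p"
    and eq: "b ^ (Q - 1) * b' * X1 = b' ^ Q * X1 + of_nat J * b ^ Q * Hn"
  shows False
proof -
  define r where "r = p ^ (\<kappa> - 1)"
  have Qr: "Q = p * r" and r0: "r > 0"
    using Q p1 by (auto simp: r_def simp flip: power_Suc)
  have "of_nat J \<noteq> (0 :: 'c)"
    using J p by (auto simp: of_nat_eq_0_iff_char_dvd dest: dvd_imp_le)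
  then have J0: "of_nat J \<noteq> (0 :: 'c poly)" "degree (of_nat J :: 'c poly) = 0"
    by (simp_all add: of_nat_poly)
  have Hn0: "Hn \<noteq> 0"
    using degree_Hn[OF P1] r0 r_def by force
  have deg3: "degree (of_nat J * b ^ Q * Hn) = Q * degree b + 2 * r"
    using J0 b Hn0 degree_Hn[OF P1] by (simp add: degree_mult_eq degree_power_eq r_def)
  show False
  proof (cases "b' = 0")
    case True
    with eq J0 b Hn0 show False
      using Q1 by (auto simp: power_0_left)
  next
    case b': False
    have deg1: "degree (b ^ (Q - 1) * b' * X1) = (Q - 1) * degree b + degree b' + r"
      using b b' X1_nz degree_X1 by (simp add: degree_mult_eq degree_power_eq r_def)
    have deg2: "degree (b' ^ Q * X1) = Q * degree b' + r"
      using b' X1_nz degree_X1 by (simp add: degree_mult_eq degree_power_eq r_def)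
    have QQ: "Q * degree b = (Q - 1) * degree b + degree b" "Q * degree b' = (Q - 1) * degree b' + degree b'"
      using Q1 by (simp_all add: diff_mult_distrib)
    show False
    proof (cases "degree b' \<le> degree b")
      case True
      have "degree (b ^ (Q - 1) * b' * X1) < Q * degree b + 2 * r"
        unfolding deg1 using QQ True r0 by linarith
      moreover have "degree (b' ^ Q * X1) < Q * degree b + 2 * r"
        unfolding deg2 using True r0 by (simp add: add_le_less_mono)
      ultimately have "degree (b ^ (Q - 1) * b' * X1 - b' ^ Q * X1) < Q * degree b + 2 * r"
        by (intro degree_diff_less)
      moreover have "b ^ (Q - 1) * b' * X1 - b' ^ Q * X1 = of_nat J * b ^ Q * Hn"
        using eq by simp
      ultimately show False
        using deg3 by simp
    next
      case False
      have "(Q - 1) * degree b < (Q - 1) * degree b'"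
        using False Q1 by simp
      then have "degree (b ^ (Q - 1) * b' * X1) < Q * degree b' + r"
        unfolding deg1 using QQ by linarith
      moreover have "degree (of_nat J * b ^ Q * Hn) < Q * degree b' + r"
      proof -
        have "Q * Suc (degree b) \<le> Q * degree b'"
          using False by (intro mult_le_mono2) auto
        moreover have "2 * r \<le> Q"
          using p1 by (simp add: Qr)
        ultimately show ?thesis
          unfolding deg3 using r0 by simp
      qed
      ultimately have "degree (b ^ (Q - 1) * b' * X1 - of_nat J * b ^ Q * Hn) < Q * degree b' + r"
        by (intro degree_diff_less)
      moreover have "b ^ (Q - 1) * b' * X1 - of_nat J * b ^ Q * Hn = b' ^ Q * X1"
        using eq by simp
      ultimately show False
        using deg2 by simp
    qed
  qed
qed

lemma P_pos: "P > 0"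
  using P p1 by auto

text \<open>In a minimal relation the coefficients are compared with those of its
  \<open>Q\<close>-th power, which is again a relation between the \<open>y ^ i * z ^ j\<close>.
  Minimality makes the two proportional. If \<open>z\<close> does not occur, this contradicts
  \<open>kummer_coeffs\<close>; otherwise the coefficient one below the top power of
  \<open>z\<close> contradicts \<open>artin_schreier_coeffs\<close>.\<close>

theorem lin_indep:
  assumes "(\<Sum>i<d. \<Sum>j<P. taylor x0 (b i j) * y ^ i * z ^ j) = 0" "i < d" "j < P"
  shows "b i j = 0"
proof (rule ccontr)
  define rel where "rel = (\<lambda>b. (\<Sum>i<d. \<Sum>j<P. taylor x0 (b i j) * y ^ i * z ^ j) = 0 \<and>
    (\<exists>i<d. \<exists>j<P. b i j \<noteq> 0))"
  define top where "top = (\<lambda>b :: nat \<Rightarrow> nat \<Rightarrow> 'c poly. Max {j. j < P \<and> (\<exists>i<d. b i j \<noteq> 0)})"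
  define num where "num = (\<lambda>b :: nat \<Rightarrow> nat \<Rightarrow> 'c poly. card {i. i < d \<and> b i (top b) \<noteq> 0})"
  \<comment> \<open>The order is lexicographic, since \<open>num b\<close> never exceeds
    \<open>d\<close>.\<close>
  define meas where "meas = (\<lambda>b. top b * Suc d + num b)"
  assume "b i j \<noteq> 0"
  with assms have "rel b"
    by (auto simp: rel_def)
  then obtain b where b: "rel b" and min: "\<And>b'. rel b' \<Longrightarrow> meas b \<le> meas b'"
    using exists_least_iff[of "\<lambda>m. \<exists>b. rel b \<and> meas b = m"] by (metis not_less)
  define J where "J = top b"
  have top: "top b' < P \<and> (\<exists>i<d. b' i (top b') \<noteq> 0) \<and> (\<forall>i<d. \<forall>j<P. b' i j \<noteq> 0 \<longrightarrow> j \<le> top b')"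
    if "rel b'" for b'
  proof -
    have fin: "finite {j. j < P \<and> (\<exists>i<d. b' i j \<noteq> 0)}"
      by simp
    have "top b' \<in> {j. j < P \<and> (\<exists>i<d. b' i j \<noteq> 0)}"
      unfolding top_def using that by (intro Max_in[OF fin]) (auto simp: rel_def)
    moreover have "j \<le> top b'" if "i < d" "j < P" "b' i j \<noteq> 0" for i j
      unfolding top_def using that by (intro Max_ge[OF fin]) auto
    ultimately show ?thesis
      by blast
  qed
  obtain i0 where i0: "i0 < d" "b i0 J \<noteq> 0"
    using top[OF b] by (auto simp: J_def)
  have JP: "J < P" and bJ: "\<And>i j. i < d \<Longrightarrow> j < P \<Longrightarrow> J < j \<Longrightarrow> b i j = 0"
    using top[OF b] unfolding J_def by (blast, meson not_le)
  have sum_J: "(\<Sum>i<d. \<Sum>j<P. taylor x0 (b' i j) * y ^ i * z ^ j) = comb J b'"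
    if "\<And>i j. i < d \<Longrightarrow> j < P \<Longrightarrow> J < j \<Longrightarrow> b' i j = 0" for b'
    unfolding comb_def using that JP
    by (intro sum.cong refl sum.mono_neutral_right) auto
  have PJ: "P \<noteq> 1 \<or> J = 0"
    using JP by auto
  \<comment> \<open>Chosen so that \<open>T * b\<close> and the coefficients of the
    \<open>Q\<close>-th power agree at \<open>(i0, J)\<close>; the difference is a smaller relation
    and therefore zero.\<close>
  define T where "T = b i0 J ^ (Q - 1) * g ^ i0 * X1 ^ J"
  define b' where "b' = (\<lambda>i l. if l \<le> J then T * b i l - frob_coeff J b i l else 0)"
  have frobJ: "frob_coeff J b i J = b i J ^ Q * g ^ i * X1 ^ J" for i
    by (simp add: frob_coeff_def)
  have Qpow: "u ^ Q = u ^ (Q - 1) * u" for u :: "'c poly"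
    using Q1 by (simp flip: power_Suc2)
  have combb: "comb J b = 0"
    using sum_J[of b] bJ b by (auto simp: rel_def)
  have "comb J b' = taylor x0 T * comb J b - comb J (frob_coeff J b)"
    by (simp add: comb_def b'_def taylor_diff taylor_mult left_diff_distrib sum_subtractf
        sum_distrib_left mult.assoc)
  also have "\<dots> = 0"
    using combb Q1 by (simp add: comb_frob[OF PJ] power_0_left)
  finally have combb': "comb J b' = 0" .
  have b'_0: "b' i l = 0" if "i < d" "l \<le> J" for i l
  proof (rule ccontr)
    assume nz: "b' i l \<noteq> 0"
    have rel': "rel b'"
      unfolding rel_def using nz that JP combb' by (subst sum_J) (auto simp: b'_def)
    have "top b' \<le> J"
      using top[OF rel'] by (metis b'_def not_le_imp_less linorder_not_less)
    have numd: "num b' \<le> d"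
      using card_mono[of "{..<d}" "{i. i < d \<and> b' i (top b') \<noteq> 0}"] by (auto simp: num_def)
    have "meas b' < meas b"
    proof (cases "top b' = J")
      case True
      have *: "b' i0 J = 0" "\<And>i. b i J = 0 \<Longrightarrow> b' i J = 0"
        using Q1 by (auto simp: b'_def frobJ T_def Qpow mult_ac)
      have "num b' < num b"
        unfolding num_def True J_def[symmetric] using * i0 by (intro psubset_card_mono) auto
      then show ?thesis
        by (simp add: meas_def True J_def[symmetric])
    next
      case False
      then have "Suc (top b') \<le> J"
        using \<open>top b' \<le> J\<close> by simp
      then have "Suc (top b') * Suc d \<le> J * Suc d"
        by (rule mult_le_mono1)
      then show ?thesis
        using numd by (simp add: meas_def J_def[symmetric])
    qed
    with min[OF rel'] show False
      by simp
  qed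
  show False
  proof (cases "J = 0")
    case True
    have only: "b i 0 = 0" if i: "i < d" "i \<noteq> i0" for i
    proof (rule ccontr)
      assume nz: "b i 0 \<noteq> 0"
      have "b' i 0 = b i 0 * (b i0 0 ^ (Q - 1) * g ^ i0 - b i 0 ^ (Q - 1) * g ^ i)"
        using frobJ[of i] True by (simp add: b'_def T_def Qpow algebra_simps)
      with b'_0[of i 0] i nz have "b i0 0 ^ (Q - 1) * g ^ i0 = b i 0 ^ (Q - 1) * g ^ i"
        by simp
      then show False
        using kummer_coeffs[of "b i0 0" "b i 0" i0 i] kummer_coeffs[of "b i 0" "b i0 0" i i0] i i0 nz True
        by (metis linorder_neqE_nat)
    qed
    have "comb J b = taylor x0 (b i0 0) * y ^ i0"
    proof -
      have "comb J b = (\<Sum>i<d. if i = i0 then taylor x0 (b i0 0) * y ^ i0 else 0)"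
        unfolding comb_def True using only by (intro sum.cong) auto
      then show ?thesis
        using i0 by simp
    qed
    with combb i0 y_nz True show False
      by simp
  next
    case False
    then have P1: "P \<noteq> 1"
      using PJ by simp
    \<comment> \<open>One below the top only \<open>j = k\<close> and \<open>j = J\<close>
      contribute. The latter brings in \<open>Hn\<close> and gives an Artin-Schreier equation for
      \<open>b i0 k / b i0 J\<close>.\<close>
    obtain k where k: "J = Suc k"
      using False by (cases J) auto
    have set: "{k..J} = {k, J}"
      using k by auto
    have "frob_coeff J b i0 k = b i0 k ^ Q * g ^ i0 * X1 ^ J +
        b i0 J ^ Q * g ^ i0 * of_nat J * Hn * X1 ^ k"
      unfolding frob_coeff_def set using k by simp
    moreover have "T * b i0 k = frob_coeff J b i0 k"
      using b'_0[of i0 k] i0 k by (simp add: b'_def)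
    ultimately have "(g ^ i0 * X1 ^ k) * (b i0 J ^ (Q - 1) * b i0 k * X1) =
      (g ^ i0 * X1 ^ k) * (b i0 k ^ Q * X1 + of_nat J * b i0 J ^ Q * Hn)"
      by (simp add: T_def k algebra_simps)
    then have "b i0 J ^ (Q - 1) * b i0 k * X1 = b i0 k ^ Q * X1 + of_nat J * b i0 J ^ Q * Hn"
      using g_nz X1_nz by simp
    then show False
      using artin_schreier_coeffs[OF P1, of "b i0 J" J "b i0 k"] i0 False JP P P1 by auto
  qed
qed

section \<open>Zero estimate for combinations of the roots\<close>

sublocale fps_vs: vector_space "\<lambda>(c::'c) f. fps_const c * f"
  by (rule vector_space_fps)

definition frame :: "nat \<Rightarrow> 'c fps set" where
  "frame N = (\<lambda>(l, i, j). taylor x0 [:0, 1:] ^ l * y ^ i * z ^ j) ` ({..<N} \<times> {..<d} \<times> {..<P})"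

lemma finite_frame: "finite (frame N)" and card_frame: "card (frame N) \<le> d * P * N"
proof -
  show "finite (frame N)"
    by (simp add: frame_def)
  have "card (frame N) \<le> card ({..<N} \<times> {..<d} \<times> {..<P})"
    unfolding frame_def by (intro card_image_le) auto
  then show "card (frame N) \<le> d * P * N"
    by (simp add: mult_ac)
qed

lemma taylor_mult_in_span:
  assumes "degree b < N" "i < d" "j < P"
  shows "taylor x0 b * y ^ i * z ^ j \<in> fps_vs.span (frame N)"
proof -
  have "b = (\<Sum>l\<le>degree b. smult (coeff b l) ([:0, 1:] ^ l))"
    by (subst poly_as_sum_of_monoms[symmetric]) (simp add: monom_altdef)
  then have "taylor x0 b * y ^ i * z ^ j =
      taylor x0 (\<Sum>l\<le>degree b. smult (coeff b l) ([:0, 1:] ^ l)) * y ^ i * z ^ j"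
    by simp
  also have "\<dots> = (\<Sum>l\<le>degree b. fps_const (coeff b l) * (taylor x0 [:0, 1:] ^ l * y ^ i * z ^ j))"
    by (simp add: taylor_sum taylor_smult taylor_power sum_distrib_right mult.assoc)
  also have "\<dots> \<in> fps_vs.span (frame N)"
  proof (intro fps_vs.span_sum fps_vs.span_scale fps_vs.span_base)
    fix l assume "l \<in> {..degree b}"
    then show "taylor x0 [:0, 1:] ^ l * y ^ i * z ^ j \<in> frame N"
      unfolding frame_def using assms by (intro image_eqI[where x = "(l, i, j)"]) auto
  qed
  finally show ?thesis .
qed

lemma y_reduce:
  assumes "i < d" "i' < d"
  obtains u s where "y ^ (i + i') = taylor x0 u * y ^ s" "degree u \<le> degree G" "s < d"
proof (cases "i + i' < d")
  case True
  then show ?thesis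
    by (intro that[of 1 "i + i'"]) auto
next
  case False
  then have "y ^ (i + i') = y ^ d * y ^ (i + i' - d)"
    by (simp flip: power_add)
  then show ?thesis
    using assms by (intro that[of "smult c G" "i + i' - d"]) (auto simp: y taylor_smult)
qed

text \<open>The factor \<open>X\<close> clears the denominator in \<open>z ^ p = z + hn / X\<close>;
  a sum of two exponents below \<open>p\<close> needs this replacement only once.\<close>

lemma z_reduce:
  assumes "j < P" "j' < P"
  obtains h where "taylor x0 [:0, 1:] * z ^ (j + j') = (\<Sum>t<P. taylor x0 (h t) * z ^ t)"
    "\<And>t. degree (h t) \<le> 2"
proof (cases "j + j' < P")
  case True
  have "(\<Sum>t<P. taylor x0 (if t = j + j' then [:0, 1:] else 0) * z ^ t) =
      (\<Sum>t<P. if t = j + j' then taylor x0 [:0, 1:] * z ^ t else 0)"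
    by (intro sum.cong) auto
  also have "\<dots> = taylor x0 [:0, 1:] * z ^ (j + j')"
    using True by simp
  finally show ?thesis
    by (intro that[of "\<lambda>t. if t = j + j' then [:0, 1:] else 0"]) auto
next
  case False
  then have P1: "P \<noteq> 1"
    using assms by auto
  then have Pp: "P = p" and hn: "degree hn = 2" "taylor x0 [:0, 1:] * (z ^ p - z) = taylor x0 hn"
    using P by auto
  define t0 where "t0 = j + j' - p"
  have t0: "j + j' = p + t0" "Suc t0 < P"
    using False assms Pp by (auto simp: t0_def)
  have "taylor x0 [:0, 1:] * z ^ (j + j') = (taylor x0 [:0, 1:] * (z ^ p - z) + taylor x0 [:0, 1:] * z) * z ^ t0"
    unfolding t0 by (simp add: power_add algebra_simps)
  also have "\<dots> = taylor x0 hn * z ^ t0 + taylor x0 [:0, 1:] * z ^ Suc t0"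
    by (simp only: hn distrib_right power_Suc mult.assoc)
  finally have eq: "taylor x0 [:0, 1:] * z ^ (j + j') = taylor x0 hn * z ^ t0 + taylor x0 [:0, 1:] * z ^ Suc t0" .
  define h where "h = (\<lambda>t. if t = t0 then hn else if t = Suc t0 then [:0, 1:] else 0)"
  have "(\<Sum>t<P. taylor x0 (h t) * z ^ t) = (\<Sum>t\<in>{t0, Suc t0}. taylor x0 (h t) * z ^ t)"
    using t0 by (intro sum.mono_neutral_right) (auto simp: h_def)
  also have "\<dots> = taylor x0 [:0, 1:] * z ^ (j + j')"
    unfolding eq by (simp add: h_def)
  finally show ?thesis
    using hn by (intro that[of h]) (auto simp: h_def)
qed

text \<open>A substitute for taking the norm of the combination \<open>\<phi>\<close>. The
  \<open>d * P * M\<close> multiples \<open>\<phi> * X * X ^ l * y ^ i * z ^ j\<close> and the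
  \<open>M\<close> powers \<open>X ^ l\<close> lie in a space of smaller dimension, so some multiple
  of \<open>\<phi>\<close> is a polynomial \<open>r\<close> of degree below \<open>M\<close>. If
  \<open>\<phi>\<close> vanishes to order \<open>M\<close> at \<open>x0\<close>, so does
  \<open>r\<close>, which is then zero, and \<open>lin_indep\<close> makes the whole relation
  trivial.\<close>

theorem zero_estimate:
  assumes deg: "\<And>i j. i < d \<Longrightarrow> j < P \<Longrightarrow> degree (b i j) < A"
    and M: "d * P * (A + degree G + 2) < M"
    and dvd: "fps_X ^ M dvd (\<Sum>i<d. \<Sum>j<P. taylor x0 (b i j) * y ^ i * z ^ j)"
    and ij: "i < d" "j < P"
  shows "b i j = 0"
proof (rule ccontr)
  define \<phi> where "\<phi> = (\<Sum>i<d. \<Sum>j<P. taylor x0 (b i j) * y ^ i * z ^ j)"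
  assume "b i j \<noteq> 0"
  then have \<phi>: "\<phi> \<noteq> 0"
    using lin_indep[of b i j] ij by (auto simp: \<phi>_def)
  define N where "N = A + M + degree G + 2"
  define Xf where "Xf = taylor x0 [:0, 1:]"
  have Xf: "Xf \<noteq> 0"
    by (simp add: Xf_def)
  define Idx where "Idx = Sum_Type.Plus ({..<M} \<times> {..<d} \<times> {..<P}) {..<M}"
  define v where "v = case_sum (\<lambda>(l, i, j). \<phi> * Xf * Xf ^ l * y ^ i * z ^ j) (\<lambda>l. Xf ^ l)"
  have card_Idx: "card Idx = d * P * M + M"
    by (simp add: Idx_def card_Plus mult_ac)
  have span: "v k \<in> fps_vs.span (frame N)" if "k \<in> Idx" for k
  proof (cases k)
    case (Inr l)
    have "v k = taylor x0 ([:0, 1:] ^ l) * y ^ 0 * z ^ 0"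
      by (simp add: v_def Inr taylor_power Xf_def)
    also have "\<dots> \<in> fps_vs.span (frame N)"
      using that d P_pos by (intro taylor_mult_in_span) (auto simp: Inr Idx_def N_def degree_power_eq)
    finally show ?thesis .
  next
    case (Inl k')
    then obtain l i j where k: "k = Inl (l, i, j)"
      by (cases k') auto
    with that have lij: "l < M" "i < d" "j < P"
      by (auto simp: Idx_def)
    have *: "taylor x0 (b i' j') * Xf ^ l * y ^ (i + i') * (Xf * z ^ (j + j')) \<in> fps_vs.span (frame N)"
      if ij': "i' < d" "j' < P" for i' j'
    proof -
      obtain u s where u: "y ^ (i + i') = taylor x0 u * y ^ s" "degree u \<le> degree G" "s < d"
        using y_reduce lij ij' by metis
      obtain h where h: "Xf * z ^ (j + j') = (\<Sum>t<P. taylor x0 (h t) * z ^ t)" "\<And>t. degree (h t) \<le> 2"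
        using z_reduce lij ij' unfolding Xf_def by metis
      have deg: "degree (b i' j' * [:0, 1:] ^ l * u * h t) < N" for t
      proof -
        have "degree (b i' j' * [:0, 1:] ^ l * u * h t) \<le> degree (b i' j') + l + degree u + degree (h t)"
          by (rule order_trans[OF degree_mult_le] add_mono order_refl)+ (simp_all add: degree_power_eq)
        then show ?thesis
          using deg[OF ij'] lij u(2) h(2)[of t] by (simp add: N_def)
      qed
      have "taylor x0 (b i' j') * Xf ^ l * y ^ (i + i') * (Xf * z ^ (j + j')) =
          (\<Sum>t<P. taylor x0 (b i' j' * [:0, 1:] ^ l * u * h t) * y ^ s * z ^ t)"
        unfolding u h sum_distrib_left
        by (intro sum.cong refl) (simp add: taylor_mult taylor_power Xf_def mult_ac)
      also have "\<dots> \<in> fps_vs.span (frame N)"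
        using deg u by (intro fps_vs.span_sum taylor_mult_in_span) auto
      finally show ?thesis .
    qed
    have "v k = (\<Sum>i'<d. \<Sum>j'<P. taylor x0 (b i' j') * Xf ^ l * y ^ (i + i') * (Xf * z ^ (j + j')))"
      by (simp add: v_def k \<phi>_def sum_distrib_left sum_distrib_right power_add mult_ac)
    also have "\<dots> \<in> fps_vs.span (frame N)"
      by (intro fps_vs.span_sum *) auto
    finally show ?thesis .
  qed
  have less: "card (frame N) < card Idx"
  proof -
    have "d * P * N = d * P * M + d * P * (A + degree G + 2)"
      by (simp add: N_def algebra_simps)
    also have "\<dots> < card Idx"
      using M by (simp add: card_Idx)
    finally show ?thesis
      using card_frame[of N] by simp
  qed
  have fin: "finite Idx"
    by (simp add: Idx_def)
  obtain a where a: "\<exists>k\<in>Idx. a k \<noteq> 0" "(\<Sum>k\<in>Idx. fps_const (a k) * v k) = 0"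
    by (rule fps_vs.exists_nontrivial_relation[OF fin finite_frame span less])
  define r where "r = (\<Sum>l<M. monom (a (Inr l)) l)"
  define B where "B = (\<lambda>i j. \<Sum>l<M. monom (a (Inl (l, i, j))) l)"
  have tm: "taylor x0 (monom w l) = fps_const w * Xf ^ l" for w l
    by (simp add: monom_altdef taylor_smult taylor_power Xf_def)
  have "(\<Sum>k\<in>Idx. fps_const (a k) * v k) =
      (\<Sum>(l, i, j)\<in>{..<M} \<times> {..<d} \<times> {..<P}. fps_const (a (Inl (l, i, j))) * (\<phi> * Xf * Xf ^ l * y ^ i * z ^ j))
      + (\<Sum>l<M. fps_const (a (Inr l)) * Xf ^ l)"
    unfolding Idx_def by (subst sum.Plus) (auto simp: v_def case_prod_unfold)
  also have "(\<Sum>l<M. fps_const (a (Inr l)) * Xf ^ l) = taylor x0 r"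
    by (simp add: r_def taylor_sum tm)
  also have "(\<Sum>(l, i, j)\<in>{..<M} \<times> {..<d} \<times> {..<P}. fps_const (a (Inl (l, i, j))) * (\<phi> * Xf * Xf ^ l * y ^ i * z ^ j))
      = (\<Sum>l<M. \<Sum>i<d. \<Sum>j<P. fps_const (a (Inl (l, i, j))) * (\<phi> * Xf * Xf ^ l * y ^ i * z ^ j))"
    by (simp add: sum.cartesian_product case_prod_unfold)
  also have "\<dots> = (\<Sum>i<d. \<Sum>l<M. \<Sum>j<P. fps_const (a (Inl (l, i, j))) * (\<phi> * Xf * Xf ^ l * y ^ i * z ^ j))"
    by (rule sum.swap)
  also have "\<dots> = (\<Sum>i<d. \<Sum>j<P. \<Sum>l<M. fps_const (a (Inl (l, i, j))) * (\<phi> * Xf * Xf ^ l * y ^ i * z ^ j))"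
    by (intro sum.cong sum.swap refl)
  also have "\<dots> = \<phi> * Xf * (\<Sum>i<d. \<Sum>j<P. taylor x0 (B i j) * y ^ i * z ^ j)"
    by (simp add: B_def taylor_sum tm sum_distrib_left sum_distrib_right mult_ac)
  finally have eq: "\<phi> * Xf * (\<Sum>i<d. \<Sum>j<P. taylor x0 (B i j) * y ^ i * z ^ j) + taylor x0 r = 0"
    using a(2) by simp
  have "fps_X ^ M dvd \<phi> * Xf * (\<Sum>i<d. \<Sum>j<P. taylor x0 (B i j) * y ^ i * z ^ j)"
    using dvd unfolding \<phi>_def by (intro dvd_mult2)
  then have "fps_X ^ M dvd taylor x0 r"
    by (rule dvd_add_eq_0[OF _ eq])
  have "pcompose r [:x0, 1:] = 0"
  proof (rule poly_eqI)
    fix n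
    have "coeff r n = 0" if "n \<ge> M" for n
      using that by (simp add: r_def coeff_sum)
    from this[of "degree r"] have "r = 0 \<or> degree r < M"
      by (cases "M \<le> degree r") auto
    then have "degree r < M"
      using M by auto
    then have "degree (pcompose r [:x0, 1:]) < M"
      using degree_pcompose[of r "[:x0, 1:]"] by simp
    then show "coeff (pcompose r [:x0, 1:]) n = coeff 0 n"
      using \<open>fps_X ^ M dvd taylor x0 r\<close> unfolding fps_X_power_dvd_iff
      by (cases "n < M") (auto simp: taylor_def coeff_eq_0)
  qed
  then have r0: "r = 0"
    by (simp add: pcompose_eq_0_iff)
  have "(\<Sum>i<d. \<Sum>j<P. taylor x0 (B i j) * y ^ i * z ^ j) = 0"
    using eq \<phi> Xf r0 by simp
  then have B0: "B i j = 0" if "i < d" "j < P" for i j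
    using lin_indep that by blast
  have cB: "coeff (B i j) l = a (Inl (l, i, j))" if "l < M" for l i j
    using that by (simp add: B_def coeff_sum)
  have cr: "coeff r l = a (Inr l)" if "l < M" for l
    using that by (simp add: r_def coeff_sum)
  obtain k where k: "k \<in> Idx" "a k \<noteq> 0"
    using a by blast
  show False
  proof (cases k)
    case (Inr l)
    with k cr[of l] r0 show False
      by (auto simp: Idx_def)
  next
    case (Inl k')
    with k B0 cB show False
      by (cases k') (auto simp: Idx_def, metis coeff_0)
  qed
qed

end

section \<open>Stepanov's method\<close>

locale stepanov =
  fixes p Q \<kappa> d P s :: nat and G :: "'c::alg_closed_field poly" and \<beta> \<gamma> \<zeta> t :: 'c
  assumes p: "prime p" "p = CHAR('c)" and Q: "Q = p ^ \<kappa>" "\<kappa> > 0"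
    and d: "d dvd Q - 1" "d > 0" and G: "G \<noteq> 0" "poly G 0 = 0"
    and kummer: "\<And>i. (\<And>\<rho>. d dvd i * order \<rho> G) \<Longrightarrow> d dvd i"
    and P: "P = 1 \<or> P = p \<and> \<beta> \<noteq> 0"
    and large: "16 * (d * P) * (degree G + 4) \<le> Q ^ s"
begin

definition "M = Q ^ s"

text \<open>The points of the field with \<open>Q ^ (2 * s)\<close> elements at which the power
  residue class of \<open>G x\<close> and the absolute trace of \<open>\<beta>x + \<gamma>/x\<close>
  have the prescribed values \<open>\<zeta>\<close> and \<open>t\<close>.\<close>

definition B where
  "B = {x. x ^ (Q ^ (2 * s)) = x \<and> poly G x \<noteq> 0 \<and> poly G x ^ ((Q ^ (2 * s) - 1) div d) = \<zeta> \<and>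
     (P \<noteq> 1 \<longrightarrow> (\<Sum>i<2 * s * \<kappa>. (\<beta> * x + \<gamma> / x) ^ (p ^ i)) = t)}"

lemma p1: "p > 1"
  using p prime_gt_1_nat by blast

lemma Q1: "Q > 1"
  using p1 Q one_less_power[of p \<kappa>] by simp

lemma P_pos: "P > 0" and P_le: "P \<noteq> 1 \<Longrightarrow> P = p"
  using P p1 by auto

lemma M_p: "M = p ^ (s * \<kappa>)"
  unfolding M_def by (simp add: Q(1) mult.commute flip: power_mult)

lemma MM: "Q ^ (2 * s) = M * M"
  by (simp add: M_def power_add mult_2)

lemma M_large: "16 * (d * P) * (degree G + 4) \<le> M"
  using large by (simp add: M_def)

lemma dP_pos: "d * P > 0"
  using d P_pos by simp

lemma M_ge: "64 \<le> M" "16 * (degree G + 4) \<le> M"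
proof -
  have "1 * (16 * (degree G + 4)) \<le> (d * P) * (16 * (degree G + 4))"
    using dP_pos by (intro mult_le_mono1) auto
  also have "\<dots> = 16 * (d * P) * (degree G + 4)"
    by (simp only: mult_ac)
  finally show "16 * (degree G + 4) \<le> M"
    using M_large by simp
  then show "64 \<le> M"
    by simp
qed

lemma s_pos: "s > 0"
  using M_ge(1) unfolding M_def by (cases s) auto

lemma d_dvd_M: "d dvd M - 1"
proof -
  have "Q - 1 dvd Q ^ s - 1"
  proof (induction s)
    case (Suc s)
    have "Q ^ Suc s - 1 = Q * (Q ^ s - 1) + (Q - 1)"
      using Q1 by (simp add: diff_mult_distrib2)
    then show ?case
      using Suc by simp
  qed simp
  then show ?thesis
    using d(1) dvd_trans unfolding M_def by blast
qed

text \<open>A root of \<open>1 + X * G\<close> is neither 0 nor a root of \<open>G\<close>, so both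
  roots can be expanded there.\<close>

definition x0 where "x0 = (SOME x. poly ([:1:] + [:0, 1:] * G) x = 0)"

lemma x0: "x0 \<noteq> 0" "poly G x0 \<noteq> 0"
proof -
  have "degree ([:1:] + [:0, 1:] * G) > 0"
    using G by (subst degree_add_eq_right) (auto simp: degree_mult_eq)
  then have "\<exists>x. poly ([:1:] + [:0, 1:] * G) x = 0"
    by (rule alg_closed_imp_poly_has_root)
  then have "poly ([:1:] + [:0, 1:] * G) x0 = 0"
    unfolding x0_def by (rule someI_ex)
  then show "x0 \<noteq> 0" "poly G x0 \<noteq> 0"
    by auto
qed

text \<open>Polynomial versions: on \<open>B\<close>, \<open>Ut\<close> and \<open>XX j\<close> are \<open>x ^ r\<close> times \<open>\<Sum>i<s\<kappa>. (h x - h x0) ^ (p ^ i)\<close> and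
  \<open>x ^ (r (P - 1))\<close> times the \<open>j\<close>-th power of that sum, where \<open>h x = \<beta> x + \<gamma> / x\<close>.\<close>

definition "h0 = \<beta> * x0 + \<gamma> / x0"
definition hn where "hn = [:\<gamma>, - h0, \<beta>:]"
definition V where "V = G ^ ((M - 1) div d)"
definition r where "r = p ^ (s * \<kappa> - 1)"
definition Ut where "Ut = (\<Sum>i<s * \<kappa>. hn ^ (p ^ i) * [:0, 1:] ^ (r - p ^ i))"
definition XX where "XX j = Ut ^ j * [:0, 1:] ^ (r * (P - 1 - j))"
text \<open>With \<open>u\<close> the sum behind \<open>Ut\<close>, \<open>\<tau>\<close> is the
  value of \<open>u + u ^ M\<close> on \<open>B\<close>: the \<open>M\<close>-th power shifts the
  exponents \<open>p ^ i\<close> by \<open>s * \<kappa>\<close>, so \<open>u\<close> and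
  \<open>u ^ M\<close> are the two halves of the full sum over \<open>2 * s * \<kappa>\<close>
  exponents.\<close>

definition "\<tau> = t - (\<Sum>i<2 * s * \<kappa>. h0 ^ (p ^ i))"

text \<open>There are \<open>A d P K\<close> unknowns for about \<open>M (A + degree G)\<close> linear conditions, and \<open>A\<close> is small
  enough for \<open>zero_estimate\<close> to keep the auxiliary polynomial from vanishing.\<close>

definition "A = M div (2 * (d * P))"
definition "K = M div (d * P) + (4 * degree G + 21)"

lemma hn_x0: "poly hn x0 = 0"
  using x0 by (simp add: hn_def h0_def field_simps)

lemma M_rp: "M = r * p"
proof -
  have "s * \<kappa> = Suc (s * \<kappa> - 1)"
    using s_pos Q(2) by simp
  then show ?thesis
    unfolding M_p r_def by (metis power_Suc2)
qed

lemma rP: "r * (P - 1) \<le> M"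
  using P by (auto simp: M_rp)

lemma degree_Ut: "degree Ut \<le> 2 * r"
  unfolding Ut_def
proof (intro degree_sum_le)
  fix i assume i: "i \<in> {..<s * \<kappa>}"
  have "p ^ i \<le> r"
    unfolding r_def using i p1 by (intro power_increasing) auto
  have "degree (hn ^ p ^ i) \<le> degree hn * p ^ i"
    by (rule degree_power_le)
  also have "\<dots> \<le> 2 * p ^ i"
    by (simp add: hn_def)
  finally have "degree (hn ^ p ^ i * [:0, 1:] ^ (r - p ^ i)) \<le> 2 * p ^ i + (r - p ^ i)"
    by (intro order_trans[OF degree_mult_le] add_mono) (auto simp: degree_power_eq)
  then show "degree (hn ^ p ^ i * [:0, 1:] ^ (r - p ^ i)) \<le> 2 * r"
    using \<open>p ^ i \<le> r\<close> by simp
qed auto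

lemma degree_V: "(d - 1) * degree V \<le> degree G * M" "i < d \<Longrightarrow> degree (V ^ i) \<le> degree G * M"
proof -
  have *: "degree V = degree G * ((M - 1) div d)"
    by (simp add: V_def degree_power_eq G)
  have "(M - 1) div d * d = M - 1"
    using d_dvd_M by simp
  then have dV: "degree V * d = degree G * (M - 1)"
    unfolding * by (simp add: mult.assoc)
  have "(d - 1) * degree V \<le> d * degree V"
    by (intro mult_le_mono1) auto
  also have "\<dots> \<le> degree G * M"
    using dV by (simp add: mult.commute)
  finally show 1: "(d - 1) * degree V \<le> degree G * M" .
  show "degree (V ^ i) \<le> degree G * M" if "i < d"
  proof -
    have "degree (V ^ i) \<le> degree V * i"
      by (rule degree_power_le)
    also have "\<dots> \<le> degree V * (d - 1)"
      using that by (intro mult_le_mono2) auto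
    also have "\<dots> = (d - 1) * degree V"
      by (rule mult.commute)
    finally show ?thesis
      using 1 by simp
  qed
qed

lemma degree_mixed:
  assumes "degree W \<le> 2 * r" "j < P"
  shows "degree (W ^ j * [:0, 1:] ^ (r * (P - 1 - j))) \<le> 2 * M"
proof -
  have "degree (W ^ j * [:0, 1:] ^ (r * (P - 1 - j))) \<le> 2 * r * j + r * (P - 1 - j)"
    using assms by (intro order_trans[OF degree_mult_le] add_mono order_trans[OF degree_power_le])
      (auto simp: degree_power_eq)
  also have "\<dots> \<le> 2 * r * j + 2 * r * (P - 1 - j)"
    by simp
  also have "\<dots> = 2 * (r * (P - 1))"
    using assms by (simp flip: distrib_left)
  finally show ?thesis
    using rP by simp
qed

lemma counting: "M * (A + degree G + 3) + K < d * P * A * K"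
  and A_small: "d * P * (A + degree G + 2) < M" and A_pos: "A > 0" and A_le: "A \<le> M"
proof -
  define D where "D = d * P"
  define e where "e = degree G"
  have D: "D > 0" "16 * D * (e + 4) \<le> M"
    using dP_pos M_large by (simp_all add: D_def e_def)
  have DA1: "2 * (D * A) \<le> M"
    unfolding A_def D_def[symmetric] by (metis div_times_less_eq_dividend mult.assoc mult.commute)
  have DA2: "M < 2 * (D * A) + 2 * D"
    unfolding A_def D_def[symmetric] using D dividend_less_times_div[of "2 * D" M]
    by (simp add: mult.assoc)
  have D64: "64 * D \<le> M"
    using D(2) by (simp add: algebra_simps)
  have DA: "M \<le> 4 * (D * A)"
    using DA2 D64 by linarith
  \<comment> \<open>Rounding down in \<open>M div D\<close> costs one of the 21. Because
    \<open>4 * D * A\<close> is at least \<open>M\<close>, the surplus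
    \<open>D * (4 * e + 20)\<close> times \<open>A\<close> pays for \<open>M * (e + 3) + K\<close>,
    where \<open>K < 2 * M\<close>.\<close>
  have DK: "M + D * (4 * e + 20) \<le> D * K"
  proof -
    have "M < D * (M div D) + D"
      using D dividend_less_times_div[of D M] by simp
    moreover have "K = M div D + (4 * e + 21)"
      by (simp add: K_def D_def e_def)
    ultimately show ?thesis
      by (simp add: algebra_simps)
  qed
  have "4 * degree G + 21 < M"
    using M_ge(2) by simp
  then have KM: "K < 2 * M"
    unfolding K_def D_def[symmetric] mult_2 by (rule add_le_less_mono[OF div_le_dividend])
  have "A * (M + D * (4 * e + 20)) \<le> A * (D * K)"
    using DK by (rule mult_le_mono2)
  then have "A * M + (4 * (D * A)) * (e + 5) \<le> D * A * K"
    by (simp add: algebra_simps)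
  moreover have "M * (e + 5) \<le> (4 * (D * A)) * (e + 5)"
    using DA by (rule mult_le_mono1)
  ultimately have "A * M + M * (e + 5) \<le> D * A * K"
    by linarith
  then show "M * (A + degree G + 3) + K < d * P * A * K"
    using KM by (simp add: D_def e_def algebra_simps)
  have "D * (e + 2) * 2 < M"
    using D by (simp add: algebra_simps)
  then show "d * P * (A + degree G + 2) < M"
    using DA1 unfolding D_def[symmetric] e_def[symmetric] by (simp add: algebra_simps)
  show "A > 0"
    using DA2 D64 D(1) by (cases A) auto
  have "M div (2 * (d * P)) \<le> M"
    by simp
  then show "A \<le> M"
    by (simp add: A_def)
qed

text \<open>The leading term has to be exactly \<open>M * M\<close>, the size of the field, so that
  the comparison with the average leaves an error of order \<open>M\<close>.\<close>

lemma K_bound: "d * P * (M * (K + degree G + 2)) \<le> M * M + d * P * (5 * degree G + 23) * M"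
proof -
  define D where "D = d * P"
  have "D * (M div D) \<le> M"
    by simp
  then have "D * (K + degree G + 2) \<le> M + D * (5 * degree G + 23)"
    unfolding K_def D_def[symmetric] by (simp add: algebra_simps)
  then have "D * (K + degree G + 2) * M \<le> (M + D * (5 * degree G + 23)) * M"
    by (rule mult_le_mono1)
  then show ?thesis
    unfolding D_def by (simp add: algebra_simps)
qed

definition Idx where "Idx = {..<A} \<times> {..<d} \<times> {..<P} \<times> {..<K}"

text \<open>At a point of \<open>B\<close>, the value of \<open>\<Sum>v. c v * vec v\<close> is \<open>g ^ M\<close> times powers of \<open>x\<close> and \<open>V\<close>: there
  \<open>x ^ (M * M) = x\<close>, so \<open>M\<close>-th powers of \<open>V\<close> and \<open>U\<close> are expressed by \<open>\<zeta> / V\<close> and \<open>\<tau> - U\<close>. The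
  coefficients of \<open>g\<close> are \<open>M\<close>-th roots of a solution \<open>c\<close> of the system saying that it is zero.\<close>

definition vec where
  "vec = (\<lambda>(l, i, j, k). [:0, 1:] ^ (l * M) * [:- (x0 ^ (M * M)), 1:] ^ k * smult (\<zeta> ^ i) (V ^ (d - 1 - i)) *
     ((smult \<tau> ([:0, 1:] ^ r) - Ut) ^ j * [:0, 1:] ^ (r * (P - 1 - j))))"

lemma degree_vec: "v \<in> Idx \<Longrightarrow> degree (vec v) < M * (A + degree G + 3) + K"
proof -
  assume "v \<in> Idx"
  then obtain l i j k where v: "v = (l, i, j, k)" "l < A" "i < d" "j < P" "k < K"
    by (auto simp: Idx_def)
  have dW: "degree (smult \<tau> ([:0, 1:] ^ r) - Ut) \<le> 2 * r"
    using degree_Ut by (intro degree_diff_le) (auto simp: degree_power_eq intro: order_trans[OF degree_smult_le])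
  have "degree (smult (\<zeta> ^ i) (V ^ (d - 1 - i))) \<le> degree G * M"
    using degree_V(2)[of "d - 1 - i"] v by (intro order_trans[OF degree_smult_le]) auto
  then have "degree (vec v) \<le> l * M + k + degree G * M + 2 * M"
    unfolding vec_def v prod.case
    by (intro order_trans[OF degree_mult_le] add_mono degree_mixed[OF dW \<open>j < P\<close>])
       (auto simp: degree_power_eq)
  moreover have "l * M \<le> A * M"
    using v by simp
  moreover have "M * (A + degree G + 3) = A * M + degree G * M + 3 * M"
    by (simp add: algebra_simps)
  moreover have "M > 0"
    using M_ge by simp
  ultimately show ?thesis
    using v(5) by linarith
qed

section \<open>The auxiliary polynomial\<close>

lemma exists_coeffs:
  obtains c where "\<exists>v\<in>Idx. c v \<noteq> 0" "(\<Sum>v\<in>Idx. smult (c v) (vec v)) = 0"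
proof -
  interpret poly_vs: vector_space "smult :: 'c \<Rightarrow> 'c poly \<Rightarrow> 'c poly"
    by (rule vector_space_poly)
  define N where "N = M * (A + degree G + 3) + K"
  have span: "f \<in> poly_vs.span ((\<lambda>n. monom 1 n) ` {..<N})" if "degree f < N" for f :: "'c poly"
  proof -
    have "f = (\<Sum>l\<le>degree f. smult (coeff f l) (monom 1 l))"
      by (subst poly_as_sum_of_monoms[symmetric]) (simp add: smult_monom)
    also have "\<dots> \<in> poly_vs.span ((\<lambda>n. monom 1 n) ` {..<N})"
      using that by (intro poly_vs.span_sum poly_vs.span_scale poly_vs.span_base) auto
    finally show ?thesis .
  qed
  have "card ((\<lambda>n. monom (1::'c) n) ` {..<N}) \<le> N"
    using card_image_le[of "{..<N}" "\<lambda>n. monom (1::'c) n"] by simp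
  also have "\<dots> < card Idx"
    using counting by (simp add: N_def Idx_def mult_ac)
  finally have less: "card ((\<lambda>n. monom (1::'c) n) ` {..<N}) < card Idx" .
  have fin: "finite Idx" "finite ((\<lambda>n. monom (1::'c) n) ` {..<N})"
    by (simp_all add: Idx_def)
  have "vec v \<in> poly_vs.span ((\<lambda>n. monom 1 n) ` {..<N})" if "v \<in> Idx" for v
    using degree_vec[OF that] by (intro span) (simp add: N_def)
  from poly_vs.exists_nontrivial_relation[of Idx _ vec, OF fin this less] that show thesis
    by blast
qed

definition c where "c = (SOME c. (\<exists>v\<in>Idx. c v \<noteq> 0) \<and> (\<Sum>v\<in>Idx. smult (c v) (vec v)) = 0)"

lemma c: "\<exists>v\<in>Idx. c v \<noteq> 0" "(\<Sum>v\<in>Idx. smult (c v) (vec v)) = 0"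
proof -
  have "\<exists>c. (\<exists>v\<in>Idx. c v \<noteq> 0) \<and> (\<Sum>v\<in>Idx. smult (c v) (vec v)) = 0"
    using exists_coeffs by metis
  from someI_ex[OF this] show "\<exists>v\<in>Idx. c v \<noteq> 0" "(\<Sum>v\<in>Idx. smult (c v) (vec v)) = 0"
    unfolding c_def by blast+
qed

definition root where "root v = (SOME w. w ^ M = c v)"

lemma root: "root v ^ M = c v"
proof -
  have "\<exists>w. w ^ M = c v"
    using M_ge by (intro nth_root_exists) auto
  then show ?thesis
    unfolding root_def by (rule someI_ex)
qed

definition a where "a i j k = (\<Sum>l<A. monom (root (l, i, j, k)) l)"

lemma degree_a: "degree (a i j k) < A"
  unfolding a_def using A_pos degree_monom_le le_less_trans
  by (intro degree_sum_less) (auto intro: le_less_trans[OF degree_monom_le])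

lemma coeff_a: "l < A \<Longrightarrow> coeff (a i j k) l = root (l, i, j, k)"
  by (simp add: a_def coeff_sum)

text \<open>The exponents \<open>k * M\<close> serve two purposes: expanded at \<open>x0\<close> the
  layers are separated by powers of \<open>X ^ M\<close>, and at points of \<open>B\<close> the
  \<open>M\<close>-th power of such a factor is only \<open>(x - x0 ^ (M * M)) ^ k\<close>.\<close>

definition g where
  "g = (\<Sum>i<d. \<Sum>j<P. \<Sum>k<K. a i j k * [:- x0, 1:] ^ (k * M) * V ^ i * XX j)"

lemma degree_g: "degree g \<le> M * (K + degree G + 2)"
  unfolding g_def
proof (intro degree_sum_le)
  fix i j k assume *: "i \<in> {..<d}" "j \<in> {..<P}" "k \<in> {..<K}"
  have "degree (XX j) \<le> 2 * M"
    unfolding XX_def using * by (intro degree_mixed degree_Ut) auto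
  then have "degree (a i j k * [:- x0, 1:] ^ (k * M) * V ^ i * XX j) \<le> A + k * M + degree G * M + 2 * M"
    using degree_a[of i j k] degree_V(2)[of i] *
    by (intro order_trans[OF degree_mult_le] add_mono) (auto simp: degree_power_eq)
  moreover have "Suc k * M \<le> K * M"
    using * by (intro mult_le_mono1) auto
  ultimately show "degree (a i j k * [:- x0, 1:] ^ (k * M) * V ^ i * XX j) \<le> M * (K + degree G + 2)"
    using A_le by (simp add: algebra_simps)
qed auto

lemma char_c: "prime CHAR('c)" "CHAR('c) = p"
  using p by auto

lemma pow_diff: "((u :: 'c) - w) ^ (p ^ n) = u ^ (p ^ n) - w ^ (p ^ n)"
  using char_power_diff[OF char_c(1), of u w n] char_c(2) by simp

lemma pow_sum: "(\<Sum>i\<in>S. f i :: 'c) ^ (p ^ n) = (\<Sum>i\<in>S. f i ^ (p ^ n))"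
  using char_power_sum[OF char_c(1), of f S n] char_c(2) by simp

lemma pow_sum_M: "(\<Sum>i\<in>S. f i :: 'c) ^ M = (\<Sum>i\<in>S. f i ^ M)"
  unfolding M_p by (rule pow_sum)

lemma sum_c_vec:
  "(\<Sum>v\<in>Idx. smult (c v) (vec v)) = (\<Sum>i<d. \<Sum>j<P. \<Sum>k<K. (\<Sum>l<A. smult (c (l, i, j, k)) ([:0, 1:] ^ (l * M))) *
     [:- (x0 ^ (M * M)), 1:] ^ k * smult (\<zeta> ^ i) (V ^ (d - 1 - i)) *
     ((smult \<tau> ([:0, 1:] ^ r) - Ut) ^ j * [:0, 1:] ^ (r * (P - 1 - j))))"
proof -
  have "(\<Sum>v\<in>Idx. f v) = (\<Sum>i<d. \<Sum>j<P. \<Sum>k<K. \<Sum>l<A. f (l, i, j, k))" for f :: "_ \<Rightarrow> 'c poly"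
  proof -
    have "(\<Sum>v\<in>Idx. f v) = (\<Sum>(i, j, k, l)\<in>{..<d} \<times> {..<P} \<times> {..<K} \<times> {..<A}. f (l, i, j, k))"
      unfolding Idx_def
      by (rule sum.reindex_bij_witness[of _ "\<lambda>(i, j, k, l). (l, i, j, k)" "\<lambda>(l, i, j, k). (i, j, k, l)"]) auto
    then show ?thesis
      by (simp add: sum.cartesian_product case_prod_unfold)
  qed
  then show ?thesis
    by (simp only: vec_def prod.case sum_distrib_right mult_smult_left mult.assoc)
qed

lemma g_vanishes:
  assumes "x \<in> B"
  shows "poly g x = 0"
proof -
  have xR: "x ^ (M * M) = x" and Gx: "poly G x \<noteq> 0" and z: "poly G x ^ ((M * M - 1) div d) = \<zeta>"
    and tr: "P \<noteq> 1 \<Longrightarrow> (\<Sum>i<2 * s * \<kappa>. (\<beta> * x + \<gamma> / x) ^ (p ^ i)) = t"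
    using assms by (auto simp: B_def MM)
  have x: "x \<noteq> 0"
    using Gx G by auto
  define u where "u = (\<Sum>i<s * \<kappa>. (\<beta> * x + \<gamma> / x - h0) ^ (p ^ i))"
  have Ut: "poly Ut x = x ^ r * u"
  proof -
    have "poly hn x ^ (p ^ i) * x ^ (r - p ^ i) = x ^ r * (\<beta> * x + \<gamma> / x - h0) ^ (p ^ i)"
      if "i < s * \<kappa>" for i
    proof -
      have "poly hn x = x * (\<beta> * x + \<gamma> / x - h0)"
        using x by (simp add: hn_def algebra_simps)
      moreover have "p ^ i \<le> r"
        unfolding r_def using that p1 by (intro power_increasing) auto
      then have "x ^ r = x ^ (p ^ i) * x ^ (r - p ^ i)"
        by (simp flip: power_add)
      ultimately show ?thesis
        by (simp add: power_mult_distrib mult_ac)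
    qed
    then show ?thesis
      by (simp add: Ut_def poly_sum u_def sum_distrib_left)
  qed
  have uM: "u ^ M = \<tau> - u" if "P \<noteq> 1"
  proof -
    have n2: "2 * s * \<kappa> = s * \<kappa> + s * \<kappa>"
      by simp
    have "u ^ M = (\<Sum>i<s * \<kappa>. (\<beta> * x + \<gamma> / x - h0) ^ (p ^ (i + s * \<kappa>)))"
      unfolding u_def M_p pow_sum by (simp add: power_add power_mult)
    also have "\<dots> = (\<Sum>i\<in>{s * \<kappa>..<2 * s * \<kappa>}. (\<beta> * x + \<gamma> / x - h0) ^ (p ^ i))"
      by (rule sum.reindex_bij_witness[of _ "\<lambda>i. i - s * \<kappa>" "\<lambda>i. i + s * \<kappa>"]) (auto simp only: n2 atLeastLessThan_iff lessThan_iff)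
    finally have "u + u ^ M = (\<Sum>i<2 * s * \<kappa>. (\<beta> * x + \<gamma> / x - h0) ^ (p ^ i))"
      unfolding u_def lessThan_atLeast0 by (simp add: sum.atLeastLessThan_concat)
    also have "\<dots> = \<tau>"
      using tr[OF that] by (simp add: pow_diff sum_subtractf \<tau>_def)
    finally show ?thesis
      by (simp add: eq_diff_eq add.commute)
  qed
  have VM: "poly V x ^ M * poly V x = \<zeta>"
  proof -
    have "(M - 1) div d * M + (M - 1) div d = (M * M - 1) div d"
    proof -
      obtain e where e: "M - 1 = d * e"
        using d_dvd_M by (elim dvdE)
      have "M * M - 1 = (M - 1) * M + (M - 1)"
        using M_ge by (simp add: algebra_simps diff_mult_distrib)
      then have "M * M - 1 = d * (e * M + e)"
        unfolding e by (simp add: algebra_simps)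
      then show ?thesis
        using e d(2) by simp
    qed
    then show ?thesis
      using z by (simp add: V_def flip: power_mult power_add)
  qed
  have Vx: "poly V x \<noteq> 0"
    using Gx by (simp add: V_def)
  have aM: "poly (a i j k) x ^ M = (\<Sum>l<A. c (l, i, j, k) * x ^ (l * M))" for i j k
    unfolding a_def poly_sum M_p pow_sum
    by (simp add: poly_monom power_mult_distrib root flip: M_p power_mult)
  have x0M: "((x - x0) ^ (k * M)) ^ M = (x - x0 ^ (M * M)) ^ k" for k
  proof -
    have "(x - x0) ^ (M * M) = x - x0 ^ (M * M)"
      using pow_diff[of x x0 "s * \<kappa> + s * \<kappa>"] xR by (simp add: M_p power_add)
    moreover have "((x - x0) ^ (k * M)) ^ M = ((x - x0) ^ (M * M)) ^ k"
      by (simp only: power_mult[symmetric] mult_ac)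
    ultimately show ?thesis
      by simp
  qed
  have XXM: "poly (XX j) x ^ M * x ^ (r * (P - 1)) =
      x ^ (r * (P - 1) * M) * ((\<tau> * x ^ r - poly Ut x) ^ j * x ^ (r * (P - 1 - j)))" if j: "j < P" for j
  proof -
    have rj: "r * (P - 1) = r * j + r * (P - 1 - j)"
      using j by (simp flip: distrib_left)
    have "poly (XX j) x = x ^ (r * (P - 1)) * u ^ j"
      unfolding rj by (simp add: XX_def Ut power_mult_distrib power_mult power_add)
    then have "poly (XX j) x ^ M = x ^ (r * (P - 1) * M) * (u ^ M) ^ j"
      by (simp add: power_mult_distrib mult.commute flip: power_mult)
    also have "(u ^ M) ^ j = (\<tau> - u) ^ j"
      using uM j by (cases "P = 1") auto
    finally have 1: "poly (XX j) x ^ M = x ^ (r * (P - 1) * M) * (\<tau> - u) ^ j" .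
    have "(\<tau> * x ^ r - poly Ut x) ^ j * x ^ (r * (P - 1 - j)) = (x ^ r * (\<tau> - u)) ^ j * x ^ (r * (P - 1 - j))"
      by (simp add: Ut algebra_simps)
    also have "\<dots> = x ^ (r * (P - 1)) * (\<tau> - u) ^ j"
      unfolding rj by (simp add: power_mult_distrib power_add power_mult)
    finally show ?thesis
      unfolding 1 by simp
  qed
  have VM': "(poly V x ^ i) ^ M * poly V x ^ (d - 1) = \<zeta> ^ i * poly V x ^ (d - 1 - i)" if "i < d" for i
  proof -
    have "poly V x ^ (d - 1) = poly V x ^ i * poly V x ^ (d - 1 - i)"
      using that by (simp flip: power_add)
    moreover have "(poly V x ^ i) ^ M = (poly V x ^ M) ^ i"
      by (simp only: power_mult[symmetric] mult.commute)
    ultimately show ?thesis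
      by (simp only: VM[symmetric] power_mult_distrib mult.assoc)
  qed
  \<comment> \<open>The two extra factors are nonzero on \<open>B\<close>; they clear the negative
    powers of \<open>V\<close> and the denominators \<open>x ^ r\<close>.\<close>
  have "poly g x ^ M * poly V x ^ (d - 1) * x ^ (r * (P - 1)) =
    (\<Sum>i<d. \<Sum>j<P. \<Sum>k<K. (poly (a i j k) x ^ M * ((x - x0) ^ (k * M)) ^ M) *
       ((poly V x ^ i) ^ M * poly V x ^ (d - 1)) * (poly (XX j) x ^ M * x ^ (r * (P - 1))))"
    unfolding g_def poly_sum pow_sum_M sum_distrib_right
    by (intro sum.cong refl) (simp add: power_mult_distrib mult_ac)
  also have "\<dots> = (\<Sum>i<d. \<Sum>j<P. \<Sum>k<K. x ^ (r * (P - 1) * M) * ((\<Sum>l<A. c (l, i, j, k) * x ^ (l * M)) *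
     (x - x0 ^ (M * M)) ^ k * (\<zeta> ^ i * poly V x ^ (d - 1 - i)) *
     ((\<tau> * x ^ r - poly Ut x) ^ j * x ^ (r * (P - 1 - j)))))"
    by (intro sum.cong refl) (simp only: aM x0M XXM VM' lessThan_iff, simp only: mult_ac)
  also have "\<dots> = x ^ (r * (P - 1) * M) * poly (\<Sum>v\<in>Idx. smult (c v) (vec v)) x"
    unfolding sum_c_vec poly_sum sum_distrib_left
    by (intro sum.cong refl) (simp add: poly_sum mult_ac)
  also have "\<dots> = 0"
    using c by simp
  finally show ?thesis
    using Vx x M_ge by simp
qed

text \<open>Modulo \<open>X ^ M\<close> at \<open>x0\<close>, \<open>y ^ M\<close> is 1 and
  \<open>z ^ M\<close> is 0, so \<open>V\<close> becomes a constant divided by \<open>y\<close>, and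
  the sum behind \<open>XX\<close> becomes \<open>- z\<close>. If \<open>g\<close> were zero, its
  lowest layer would thus give a combination of the \<open>y ^ i * z ^ j\<close> that is divisible
  by \<open>X ^ M\<close> and has coefficients of degree below \<open>A\<close>;
  \<open>zero_estimate\<close> makes that layer zero.\<close>

lemma g_nonzero: "g \<noteq> 0"
proof
  assume g0: "g = 0"
  define G0 where "G0 = poly G x0"
  have G0: "G0 \<noteq> 0"
    using x0 by (simp add: G0_def)
  define Xt where "Xt = taylor x0 [:0, 1:]"
  have Xt0: "fps_nth Xt 0 \<noteq> 0"
    using x0 by (simp add: Xt_def)
  have "fps_nth (fps_const (1 / G0) * taylor x0 G) 0 = 1"
    using G0 by (simp add: G0_def)
  then obtain y where y: "fps_nth y 0 = 1" "y ^ d = fps_const (1 / G0) * taylor x0 G"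
    using fps_kummer_root[of Q \<kappa> d "fps_const (1 / G0) * taylor x0 G"] p Q d by metis
  have "fps_nth (taylor x0 hn * inverse Xt) 0 = 0"
    by (simp add: hn_x0)
  then obtain z where z: "fps_nth z 0 = 0" "z ^ p - z = taylor x0 hn * inverse Xt"
    using fps_artin_schreier_root[of "taylor x0 hn * inverse Xt"] p by metis
  have Xinv: "Xt * (f * inverse Xt) = f" for f
  proof -
    have "Xt * inverse Xt = 1"
      using Xt0 by (rule inverse_mult_eq_1')
    then show ?thesis
      by (metis mult.left_commute mult_1_right)
  qed
  interpret C: fps_cover p Q \<kappa> d P G hn "1 / G0" x0 y z
  proof
    show "P = 1 \<or> P = p \<and> degree hn = 2 \<and> taylor x0 [:0, 1:] * (z ^ p - z) = taylor x0 hn"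
      using P unfolding z(2) Xt_def[symmetric] Xinv by (auto simp: hn_def)
    show "d dvd i" if "\<And>\<rho>. d dvd i * order \<rho> G" for i
      using that by (rule kummer)
  qed (use p Q d G y G0 in auto)
  have yM: "fps_X ^ M dvd y ^ M - 1"
  proof -
    have "(y - 1) ^ M = y ^ M - 1"
      unfolding M_p using C.pow_p_diff[of y 1 "s * \<kappa>"] by (simp only: power_one)
    moreover have "fps_X ^ M dvd (y - 1) ^ M"
      using y(1) by (intro dvd_power_same) (simp add: fps_X_dvd_iff)
    ultimately show ?thesis
      by simp
  qed
  have zM: "fps_X ^ M dvd z ^ M"
    using z(1) by (intro dvd_power_same) (simp add: fps_X_dvd_iff)
  define v0 where "v0 = G0 ^ ((M - 1) div d)"
  have v0: "v0 \<noteq> 0"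
    using G0 by (simp add: v0_def)
  have tV: "taylor x0 V * y = fps_const v0 * y ^ M"
  proof -
    have "taylor x0 G = fps_const G0 * y ^ d"
      using G0 by (simp add: y fps_const_mult[symmetric] mult.assoc[symmetric] del: fps_const_mult)
    then have "taylor x0 V = fps_const v0 * y ^ (d * ((M - 1) div d))"
      by (simp add: V_def taylor_power power_mult_distrib fps_const_power v0_def power_mult)
    also have "d * ((M - 1) div d) = M - 1"
      using d_dvd_M by simp
    finally have "taylor x0 V * y = fps_const v0 * y ^ Suc (M - 1)"
      by simp
    then show ?thesis
      using M_ge by simp
  qed
  have tX: "taylor x0 (XX j) = Xt ^ (r * (P - 1)) * (z ^ M - z) ^ j" if j: "j < P" for j
  proof -
    have rj: "r * (P - 1) = r * j + r * (P - 1 - j)"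
      using j by (simp flip: distrib_left)
    show ?thesis
    proof (cases "P = 1")
      case False
      have "taylor x0 Ut = Xt ^ r * (z ^ M - z)"
        using C.taylor_AS[OF False, of "s * \<kappa>"]
        by (simp add: Xt_def r_def Ut_def C.AS_def M_p)
      then have "taylor x0 (XX j) = (Xt ^ r) ^ j * (z ^ M - z) ^ j * Xt ^ (r * (P - 1 - j))"
        by (simp only: XX_def taylor_mult taylor_power Xt_def power_mult_distrib)
      also have "\<dots> = Xt ^ (r * (P - 1)) * (z ^ M - z) ^ j"
        unfolding rj by (simp only: power_add power_mult[symmetric]) (simp only: mult_ac)
      finally show ?thesis .
    next
      case True
      then show ?thesis
        unfolding XX_def using j by simp
    qed
  qed
  have nz: "\<exists>i j k. i < d \<and> j < P \<and> k < K \<and> a i j k \<noteq> 0"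
  proof -
    obtain l i j k where v: "(l, i, j, k) \<in> Idx" "c (l, i, j, k) \<noteq> 0"
      using c(1) by (metis prod_cases4)
    have "root (l, i, j, k) \<noteq> 0"
      using root[of "(l, i, j, k)"] v M_ge by (auto simp: power_0_left)
    then have "a i j k \<noteq> 0"
      using coeff_a[of l i j k] v by (auto simp: Idx_def)
    with v show ?thesis
      by (auto simp: Idx_def)
  qed
  \<comment> \<open>The layers below \<open>k0\<close> are zero, and those above it carry a further
    factor \<open>fps_X ^ M\<close>.\<close>
  define k0 where "k0 = (LEAST k. k < K \<and> (\<exists>i j. i < d \<and> j < P \<and> a i j k \<noteq> 0))"
  have k0: "k0 < K" "\<exists>i j. i < d \<and> j < P \<and> a i j k0 \<noteq> 0"
  proof -
    have "\<exists>k. k < K \<and> (\<exists>i j. i < d \<and> j < P \<and> a i j k \<noteq> 0)"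
      using nz by blast
    from LeastI_ex[OF this] show "k0 < K" "\<exists>i j. i < d \<and> j < P \<and> a i j k0 \<noteq> 0"
      unfolding k0_def by blast+
  qed
  have below: "a i j k = 0" if "k < k0" "i < d" "j < P" for i j k
    using not_less_Least[of k "\<lambda>k. k < K \<and> (\<exists>i j. i < d \<and> j < P \<and> a i j k \<noteq> 0)"] that k0
    unfolding k0_def[symmetric] by auto
  define F where "F = (\<lambda>k. \<Sum>i<d. \<Sum>j<P. taylor x0 (a i j k) * taylor x0 V ^ i * taylor x0 (XX j))"
  have "0 = taylor x0 g"
    using g0 by simp
  also have "taylor x0 g = (\<Sum>i<d. \<Sum>j<P. \<Sum>k<K. fps_X ^ (k * M) * (taylor x0 (a i j k) * taylor x0 V ^ i * taylor x0 (XX j)))"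
    by (simp add: g_def taylor_sum taylor_mult taylor_power taylor_X mult_ac)
  also have "\<dots> = (\<Sum>i<d. \<Sum>k<K. \<Sum>j<P. fps_X ^ (k * M) * (taylor x0 (a i j k) * taylor x0 V ^ i * taylor x0 (XX j)))"
    by (intro sum.cong refl sum.swap)
  also have "\<dots> = (\<Sum>k<K. \<Sum>i<d. \<Sum>j<P. fps_X ^ (k * M) * (taylor x0 (a i j k) * taylor x0 V ^ i * taylor x0 (XX j)))"
    by (rule sum.swap)
  also have "\<dots> = (\<Sum>k<K. fps_X ^ (k * M) * F k)"
    by (simp add: F_def sum_distrib_left)
  also have "\<dots> = (\<Sum>k\<in>{k0..<K}. fps_X ^ (k * M) * F k)"
    using below by (intro sum.mono_neutral_right) (auto simp: F_def)
  also have "\<dots> = fps_X ^ (k0 * M) * (\<Sum>k\<in>{k0..<K}. fps_X ^ ((k - k0) * M) * F k)"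
    unfolding sum_distrib_left
  proof (intro sum.cong refl)
    fix k assume "k \<in> {k0..<K}"
    then have "k * M = k0 * M + (k - k0) * M"
      by (simp flip: distrib_right)
    then show "fps_X ^ (k * M) * F k = fps_X ^ (k0 * M) * (fps_X ^ ((k - k0) * M) * F k)"
      by (simp add: power_add mult.assoc)
  qed
  finally have S0: "(\<Sum>k\<in>{k0..<K}. fps_X ^ ((k - k0) * M) * F k) = 0"
    by simp
  have S1: "(\<Sum>k\<in>{k0..<K}. fps_X ^ ((k - k0) * M) * F k) =
      F k0 + (\<Sum>k\<in>{k0<..<K}. fps_X ^ ((k - k0) * M) * F k)"
  proof -
    have "{k0..<K} = insert k0 {k0<..<K}"
      using k0 by auto
    then show ?thesis
      by simp
  qed
  have S2: "fps_X ^ M dvd (\<Sum>k\<in>{k0<..<K}. fps_X ^ ((k - k0) * M) * F k)"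
    by (intro dvd_sum dvd_mult2 le_imp_power_dvd) auto
  have "fps_X ^ M dvd F k0"
    using dvd_add_eq_0[OF S2 S0[unfolded S1 add.commute[of "F k0"]]] .
  then have "fps_X ^ M dvd F k0 * y ^ (d - 1)"
    by simp
  also have "F k0 * y ^ (d - 1) = Xt ^ (r * (P - 1)) * (\<Sum>i<d. \<Sum>j<P.
      taylor x0 (smult (v0 ^ i) (a i j k0)) * (y ^ M) ^ i * y ^ (d - 1 - i) * (z ^ M - z) ^ j)"
  proof -
    have *: "taylor x0 V ^ i * y ^ (d - 1) = fps_const (v0 ^ i) * (y ^ M) ^ i * y ^ (d - 1 - i)" if "i < d" for i
    proof -
      have "y ^ (d - 1) = y ^ i * y ^ (d - 1 - i)"
        using that by (simp flip: power_add)
      then have "taylor x0 V ^ i * y ^ (d - 1) = (taylor x0 V * y) ^ i * y ^ (d - 1 - i)"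
        by (simp only: power_mult_distrib mult.assoc)
      then show ?thesis
        by (simp add: tV power_mult_distrib fps_const_power)
    qed
    have "F k0 * y ^ (d - 1) = (\<Sum>i<d. \<Sum>j<P. taylor x0 (a i j k0) * (taylor x0 V ^ i * y ^ (d - 1)) * taylor x0 (XX j))"
      unfolding F_def sum_distrib_right by (intro sum.cong refl) (simp only: mult_ac)
    also have "\<dots> = (\<Sum>i<d. \<Sum>j<P. Xt ^ (r * (P - 1)) * (
      taylor x0 (smult (v0 ^ i) (a i j k0)) * (y ^ M) ^ i * y ^ (d - 1 - i) * (z ^ M - z) ^ j))"
      by (intro sum.cong refl) (simp only: * tX taylor_smult lessThan_iff, simp only: mult_ac)
    finally show ?thesis
      by (simp add: sum_distrib_left)
  qed
  finally have "fps_X ^ M dvd inverse Xt ^ (r * (P - 1)) * (Xt ^ (r * (P - 1)) * (\<Sum>i<d. \<Sum>j<P.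
      taylor x0 (smult (v0 ^ i) (a i j k0)) * (y ^ M) ^ i * y ^ (d - 1 - i) * (z ^ M - z) ^ j))"
    by (rule dvd_mult)
  also have "inverse Xt ^ (r * (P - 1)) * (Xt ^ (r * (P - 1)) * f) = f" for f
    by (simp only: mult.assoc[symmetric] power_mult_distrib[symmetric] inverse_mult_eq_1[OF Xt0]
        power_one mult_1_left)
  finally have 1: "fps_X ^ M dvd (\<Sum>i<d. \<Sum>j<P.
      taylor x0 (smult (v0 ^ i) (a i j k0)) * (y ^ M) ^ i * y ^ (d - 1 - i) * (z ^ M - z) ^ j)" .
  \<comment> \<open>Modulo \<open>X ^ M\<close>, multiplying \<open>V ^ i\<close> by
    \<open>y ^ (d - 1)\<close> leaves \<open>v0 ^ i * y ^ (d - 1 - i)\<close>, hence the reversed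
    index; the sign comes from \<open>(- z) ^ j\<close>.\<close>
  define b where "b = (\<lambda>i j. smult (v0 ^ (d - 1 - i) * (-1) ^ j) (a (d - 1 - i) j k0))"
  have 2: "fps_X ^ M dvd (\<Sum>i<d. \<Sum>j<P. taylor x0 (smult (v0 ^ i) (a i j k0)) * (y ^ M) ^ i * y ^ (d - 1 - i) * (z ^ M - z) ^ j) -
      (\<Sum>i<d. \<Sum>j<P. taylor x0 (smult (v0 ^ i) (a i j k0)) * 1 ^ i * y ^ (d - 1 - i) * (- z) ^ j)"
    unfolding sum_subtractf[symmetric]
  proof (intro dvd_sum)
    fix i j
    have "fps_X ^ M dvd (y ^ M) ^ i - 1 ^ i"
      using dvd_trans[OF yM diff_dvd_power_diff] .
    moreover have "fps_X ^ M dvd (z ^ M - z) ^ j - (- z) ^ j"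
      using dvd_trans[OF _ diff_dvd_power_diff[of "z ^ M - z" "- z"]] zM by simp
    moreover have "f * (y ^ M) ^ i * h * (z ^ M - z) ^ j - f * 1 ^ i * h * (- z) ^ j =
       f * h * (z ^ M - z) ^ j * ((y ^ M) ^ i - 1 ^ i) + f * h * 1 ^ i * ((z ^ M - z) ^ j - (- z) ^ j)" for f h
      by (simp only: algebra_simps)
    ultimately show "fps_X ^ M dvd taylor x0 (smult (v0 ^ i) (a i j k0)) * (y ^ M) ^ i * y ^ (d - 1 - i) * (z ^ M - z) ^ j -
      taylor x0 (smult (v0 ^ i) (a i j k0)) * 1 ^ i * y ^ (d - 1 - i) * (- z) ^ j"
      by (simp only: dvd_add dvd_mult)
  qed
  have 3: "(\<Sum>i<d. \<Sum>j<P. taylor x0 (smult (v0 ^ i) (a i j k0)) * 1 ^ i * y ^ (d - 1 - i) * (- z) ^ j) =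
      (\<Sum>i<d. \<Sum>j<P. taylor x0 (b i j) * y ^ i * z ^ j)"
  proof (rule sum.reindex_bij_witness[of _ "\<lambda>i. d - 1 - i" "\<lambda>i. d - 1 - i"])
    fix i assume "i \<in> {..<d}"
    then have "d - 1 - (d - 1 - i) = i"
      by auto
    then show "(\<Sum>j<P. taylor x0 (b (d - 1 - i) j) * y ^ (d - 1 - i) * z ^ j) =
        (\<Sum>j<P. taylor x0 (smult (v0 ^ i) (a i j k0)) * 1 ^ i * y ^ (d - 1 - i) * (- z) ^ j)"
      by (intro sum.cong refl) (simp add: b_def taylor_smult power_minus[of z] fps_const_mult[symmetric]
          fps_const_power[symmetric] fps_const_neg[symmetric] mult_ac del: fps_const_mult fps_const_power fps_const_neg)
  qed auto
  have "fps_X ^ M dvd (\<Sum>i<d. \<Sum>j<P. taylor x0 (b i j) * y ^ i * z ^ j)"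
    using dvd_diff[OF 1 2] unfolding diff_diff_eq2 add_diff_cancel_left' 3 .
  moreover have "degree (b i j) < A" for i j
    unfolding b_def by (rule le_less_trans[OF degree_smult_le degree_a])
  ultimately have "b i j = 0" if "i < d" "j < P" for i j
    using C.zero_estimate[OF _ A_small, of b i j] that by blast
  moreover obtain i j where ij: "i < d" "j < P" "a i j k0 \<noteq> 0"
    using k0 by blast
  ultimately have "b (d - 1 - i) j = 0"
    by simp
  then show False
    using ij v0 by (simp add: b_def)
qed

theorem stepanov_bound: "finite B" "d * P * card B \<le> M * M + d * P * (5 * degree G + 23) * M"
proof -
  have sub: "B \<subseteq> {x. poly g x = 0}"
    using g_vanishes by auto
  have fin: "finite {x. poly g x = 0}"
    using g_nonzero by (rule poly_roots_finite)
  with sub show "finite B"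
    by (rule finite_subset)
  have "card B \<le> card {x. poly g x = 0}"
    using sub fin by (rule card_mono[rotated])
  also have "\<dots> \<le> degree g"
    using g_nonzero by (rule card_poly_roots_bound)
  also have "\<dots> \<le> M * (K + degree G + 2)"
    by (rule degree_g)
  finally have "d * P * card B \<le> d * P * (M * (K + degree G + 2))"
    by (rule mult_le_mono2)
  with K_bound show "d * P * card B \<le> M * M + d * P * (5 * degree G + 23) * M"
    by linarith
qed

end

section \<open>Exponential sums over extensions of even degree\<close>

lemma proots_factorization:
  fixes f :: "'a::alg_closed_field poly"
  assumes "f \<noteq> 0"
  shows "f = smult (lead_coeff f) (\<Prod>x\<in>#proots f. [:-x, 1:])" and "size (proots f) = degree f"
proof -
  obtain A where A: "size A = degree f" "f = smult (lead_coeff f) (\<Prod>x\<in>#A. [:-x, 1:])"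
    using alg_closed_imp_factorization[OF assms] by blast
  have nz: "(\<Prod>x\<in>#A. [:-x, 1:]) \<noteq> 0" for A :: "'a multiset"
    by (auto simp: prod_mset_zero_iff)
  have pr: "proots (\<Prod>x\<in>#A. [:-x, 1:]) = A" for A :: "'a multiset"
  proof (induction A)
    case (add x A)
    have "proots (\<Prod>y\<in>#add_mset x A. [:-y, 1:]) = proots [:-x, 1:] + proots (\<Prod>y\<in>#A. [:-y, 1:])"
      using nz by (simp only: image_mset_add_mset prod_mset.add_mset) (rule proots_mult; simp)
    then show ?case
      using add by simp
  qed simp
  have "proots f = A"
    using assms by (subst A(2), subst proots_smult) (auto simp: pr)
  with A show "f = smult (lead_coeff f) (\<Prod>x\<in>#proots f. [:-x, 1:])" and "size (proots f) = degree f"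
    by simp_all
qed

lemma sum_order_eq_degree:
  fixes f :: "'a::alg_closed_field poly"
  assumes "f \<noteq> 0"
  shows "(\<Sum>x | poly f x = 0. order x f) = degree f"
  using assms proots_factorization(2)[OF assms] by (simp add: size_multiset_overloaded_eq)

lemma poly_eq_prod_roots:
  fixes f :: "'a::alg_closed_field poly"
  assumes "f \<noteq> 0"
  shows "f = smult (lead_coeff f) (\<Prod>\<rho> | poly f \<rho> = 0. [:-\<rho>, 1:] ^ order \<rho> f)"
  using proots_factorization(1)[OF assms] assms by (simp add: image_prod_mset_multiplicity)

lemma order_power: "(f :: 'a::idom poly) \<noteq> 0 \<Longrightarrow> order x (f ^ n) = n * order x f"
  by (induction n) (auto simp: order_mult)

lemma order_prod_powers:
  fixes e :: "'a::field \<Rightarrow> nat"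
  assumes "finite S"
  shows "order \<rho> (\<Prod>\<sigma>\<in>S. [:-\<sigma>, 1:] ^ e \<sigma>) = (if \<rho> \<in> S then e \<rho> else 0)"
  using assms
proof (induction S rule: finite_induct)
  case (insert \<sigma> S)
  have nz: "(\<Prod>\<sigma>\<in>S. [:-\<sigma>, 1:] ^ e \<sigma>) \<noteq> 0" "[:-\<sigma>, 1:] ^ e \<sigma> \<noteq> 0"
    using insert by auto
  have "order \<rho> ([:-\<sigma>, 1:] ^ e \<sigma>) = (if \<rho> = \<sigma> then e \<sigma> else 0)"
    by (auto simp: order_power_n_n intro!: order_0I)
  then show ?case
    using insert nz by (simp add: order_mult)
qed simp

text \<open>Weights with sum zero do not see the constant \<open>u\<close>, and all
  \<open>u - N i\<close> are nonnegative; this is how one-sided bounds control an oscillating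
  sum.\<close>

lemma norm_sum_sub:
  fixes w :: "'i \<Rightarrow> complex" and N :: "'i \<Rightarrow> real"
  assumes "finite S" "(\<Sum>i\<in>S. w i) = 0" "\<And>i. i \<in> S \<Longrightarrow> norm (w i) \<le> 1" "\<And>i. i \<in> S \<Longrightarrow> N i \<le> u"
  shows "norm (\<Sum>i\<in>S. w i * of_real (N i)) \<le> real (card S) * u - (\<Sum>i\<in>S. N i)"
proof -
  have "(\<Sum>i\<in>S. w i * of_real (N i)) = (\<Sum>i\<in>S. w i * of_real (N i)) - of_real u * (\<Sum>i\<in>S. w i)"
    by (simp add: assms)
  also have "\<dots> = (\<Sum>i\<in>S. w i * of_real (N i - u))"
    by (simp add: sum_distrib_left algebra_simps sum_subtractf)
  also have "norm \<dots> \<le> (\<Sum>i\<in>S. u - N i)"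
  proof (rule sum_norm_le)
    fix i assume i: "i \<in> S"
    have "norm (w i * of_real (N i - u)) = norm (w i) * \<bar>N i - u\<bar>"
      by (simp only: norm_mult norm_of_real)
    also have "\<dots> \<le> 1 * \<bar>N i - u\<bar>"
      using assms(3)[OF i] by (intro mult_right_mono) auto
    finally show "norm (w i * of_real (N i - u)) \<le> u - N i"
      using assms(4)[OF i] by simp
  qed
  finally show ?thesis
    by (simp add: sum_subtractf)
qed

text \<open>The base field is the set of fixed points of \<open>x ^ Q\<close> in an algebraically
  closed field, so \<open>\<theta>\<close> and \<open>E\<close> are constrained only on fixed
  points. In \<open>nontrivial\<close> the first case has a pole at infinity, the second no additive
  part; \<open>poly G 0 = 0\<close> keeps \<open>x = 0\<close> out of the sums.\<close>

locale weil =
  fixes p Q \<kappa> :: nat and G :: "'c::alg_closed_field poly" and \<beta> \<gamma> :: 'c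
    and \<theta> E :: "'c \<Rightarrow> complex"
  assumes p: "prime p" "p = CHAR('c)" and Q: "Q = p ^ \<kappa>" "\<kappa> > 0"
    and G: "G \<noteq> 0" "poly G 0 = 0" "\<And>i. coeff G i ^ Q = coeff G i"
    and \<beta>: "\<beta> ^ Q = \<beta>" and \<gamma>: "\<gamma> ^ Q = \<gamma>"
    and \<theta>_mult: "\<And>u w. u ^ Q = u \<Longrightarrow> w ^ Q = w \<Longrightarrow> u \<noteq> 0 \<Longrightarrow> w \<noteq> 0 \<Longrightarrow> \<theta> (u * w) = \<theta> u * \<theta> w"
    and norm_\<theta>: "\<And>u. u ^ Q = u \<Longrightarrow> u \<noteq> 0 \<Longrightarrow> norm (\<theta> u) = 1"
    and E_add: "\<And>u w. u ^ p = u \<Longrightarrow> w ^ p = w \<Longrightarrow> E (u + w) = E u * E w"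
    and norm_E: "\<And>u. u ^ p = u \<Longrightarrow> norm (E u) = 1"
    and nontrivial: "\<beta> \<noteq> 0 \<and> (\<exists>t. t ^ p = t \<and> E t \<noteq> 1) \<or>
      \<beta> = 0 \<and> \<gamma> = 0 \<and> (\<exists>\<rho> w. poly G \<rho> = 0 \<and> w ^ Q = w \<and> w \<noteq> 0 \<and> \<theta> (w ^ order \<rho> G) \<noteq> 1)"
begin

lemma p1: "p > 1"
  using p prime_gt_1_nat by blast

lemma Q1: "Q > 1"
  using p1 Q one_less_power[of p \<kappa>] by simp

lemma char_c: "prime CHAR('c)" "CHAR('c) = p"
  using p by auto

lemma pow_add: "((u :: 'c) + w) ^ (p ^ n) = u ^ (p ^ n) + w ^ (p ^ n)"
  using char_power_add[OF char_c(1), of u w n] char_c(2) by simp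

lemma pow_sum: "(\<Sum>i\<in>S. f i :: 'c) ^ (p ^ n) = (\<Sum>i\<in>S. f i ^ (p ^ n))"
  using char_power_sum[OF char_c(1), of f S n] char_c(2) by simp

lemma pow_inject: "(u :: 'c) ^ (p ^ n) = w ^ (p ^ n) \<longleftrightarrow> u = w"
  using char_power_inject[OF char_c(1), of u n w] char_c(2) by auto

lemma Q_add: "((u :: 'c) + w) ^ Q = u ^ Q + w ^ Q"
  unfolding Q(1) by (rule pow_add)

lemma Q_sum: "(\<Sum>i\<in>S. f i :: 'c) ^ Q = (\<Sum>i\<in>S. f i ^ Q)"
  unfolding Q(1) by (rule pow_sum)

lemma Q_inject: "(u :: 'c) ^ Q = w ^ Q \<longleftrightarrow> u = w"
  unfolding Q(1) by (rule pow_inject)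

lemma Qr: "Q ^ r = p ^ (\<kappa> * r)"
  by (simp add: Q power_mult)

lemma Q_minus: "(- u :: 'c) ^ Q = - (u ^ Q)"
proof -
  have "(- u) ^ Q + u ^ Q = (- u + u) ^ Q"
    by (simp only: Q_add)
  also have "\<dots> = 0"
    using Q1 by (simp add: power_0_left)
  finally show ?thesis
    by (simp add: eq_neg_iff_add_eq_0)
qed

lemma Q_diff: "((u :: 'c) - w) ^ Q = u ^ Q - w ^ Q"
  using Q_add[of u "- w"] by (simp add: Q_minus)

section \<open>Finite subfields and polynomials over the base field\<close>

definition Fr :: "nat \<Rightarrow> 'c set" where "Fr r = {x. x ^ (Q ^ r) = x}"

lemma Fr_1: "x \<in> Fr 1 \<longleftrightarrow> x ^ Q = x"
  by (simp add: Fr_def)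

lemma Fr_add: "x \<in> Fr r \<Longrightarrow> y \<in> Fr r \<Longrightarrow> x + y \<in> Fr r"
  and Fr_mult: "x \<in> Fr r \<Longrightarrow> y \<in> Fr r \<Longrightarrow> x * y \<in> Fr r"
  and Fr_divide: "x \<in> Fr r \<Longrightarrow> y \<in> Fr r \<Longrightarrow> x / y \<in> Fr r"
  by (simp_all add: Fr_def Qr pow_add power_mult_distrib power_divide)

lemma Fr_power: "x \<in> Fr r \<Longrightarrow> x ^ n \<in> Fr r"
  unfolding Fr_def mem_Collect_eq by (metis power_mult mult.commute)

lemma Fr_base: "x ^ Q = x \<Longrightarrow> x \<in> Fr r"
  by (induction r) (auto simp: Fr_def power_mult)

lemma card_Fr:
  assumes "r > 0"
  shows "finite (Fr r)" "card (Fr r) = Q ^ r"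
proof -
  define n where "n = Q ^ r"
  have n: "n > 1"
    unfolding n_def using Q1 assms one_less_power by blast
  define f :: "'c poly" where "f = monom 1 n - monom 1 1"
  have deg: "degree f = n"
    unfolding f_def diff_conv_add_uminus using n
    by (subst degree_add_eq_left) (auto simp: degree_monom_eq)
  have f0: "f \<noteq> 0"
    using deg n by auto
  have n0: "of_nat n = (0 :: 'c)"
  proof -
    have "p dvd p ^ (\<kappa> * r)"
      using assms Q(2) by (intro dvd_power) auto
    then show ?thesis
      unfolding n_def Qr of_nat_eq_0_iff_char_dvd char_c(2) .
  qed
  have d: "pderiv f = -1"
    by (simp add: f_def pderiv_diff pderiv_monom n0 one_pCons monom_0)
  have roots: "{x. poly f x = 0} = Fr r"
    by (auto simp: f_def Fr_def poly_monom n_def)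
  have ord: "order x f = 1" if "poly f x = 0" for x
  proof (rule ccontr)
    assume "order x f \<noteq> 1"
    moreover have "order x f \<noteq> 0"
      using that f0 order_root by blast
    ultimately have "2 \<le> order x f"
      by simp
    then have "[:-x, 1:] ^ 2 dvd f"
      using order_1[of x f] le_imp_power_dvd dvd_trans by blast
    then obtain q where "f = [:-x, 1:] ^ 2 * q"
      by (elim dvdE)
    then have "f = [:-x, 1:] * ([:-x, 1:] * q)"
      by (simp only: power2_eq_square mult.assoc)
    then have "pderiv f = [:-x, 1:] * pderiv ([:-x, 1:] * q) + ([:-x, 1:] * q) * pderiv [:-x, 1:]"
      by (simp only: pderiv_mult)
    then have "poly (pderiv f) x = 0"
      by simp
    then show False
      by (simp add: d)
  qed
  show "finite (Fr r)"
    using poly_roots_finite[OF f0] roots by simp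
  have "(\<Sum>x | poly f x = 0. order x f) = card (Fr r)"
    unfolding roots[symmetric] using ord by simp
  then show "card (Fr r) = Q ^ r"
    using sum_order_eq_degree[OF f0] deg by (simp add: n_def)
qed

definition rat :: "'c poly \<Rightarrow> bool" where "rat f \<longleftrightarrow> (\<forall>i. coeff f i ^ Q = coeff f i)"

definition frob :: "'c poly \<Rightarrow> 'c poly" where "frob f = map_poly (\<lambda>x. x ^ Q) f"

lemma coeff_frob: "coeff (frob f) i = coeff f i ^ Q"
  unfolding frob_def using Q1 by (subst coeff_map_poly) (auto simp: power_0_left)

lemma rat_iff: "rat f \<longleftrightarrow> frob f = f"
  by (auto simp: rat_def poly_eq_iff coeff_frob)

lemma frob_mult: "frob (f * g) = frob f * frob g"
  by (rule poly_eqI) (simp add: coeff_frob coeff_mult Q_sum power_mult_distrib)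

lemma frob_diff: "frob (f - g) = frob f - frob g"
  by (rule poly_eqI) (simp add: coeff_frob Q_diff)

lemma frob_add: "frob (f + g) = frob f + frob g"
  by (rule poly_eqI) (simp add: coeff_frob Q_add)

lemma frob_1: "frob 1 = 1"
  using Q1 by (intro poly_eqI) (auto simp: coeff_frob power_0_left)

lemma frob_power: "frob (f ^ n) = frob f ^ n"
  by (induction n) (auto simp: frob_mult frob_1)

lemma frob_prod: "frob (\<Prod>i\<in>S. f i) = (\<Prod>i\<in>S. frob (f i))"
  by (induction S rule: infinite_finite_induct) (auto simp: frob_mult frob_1)

lemma frob_linear: "frob [:-a, 1:] = [:-(a ^ Q), 1:]"
  using Q1 by (intro poly_eqI) (auto simp: coeff_frob coeff_pCons Q_minus power_0_left split: nat.split)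

lemma poly_frob: "poly (frob f) (x ^ Q) = poly f x ^ Q"
proof (induction f)
  case (pCons a f)
  have "frob (pCons a f) = pCons (a ^ Q) (frob f)"
    by (rule poly_eqI) (simp add: coeff_frob coeff_pCons split: nat.split)
  then show ?case
    using pCons by (simp add: Q_add power_mult_distrib)
qed (use Q1 in \<open>simp add: frob_def power_0_left\<close>)

lemma rat_poly: "rat f \<Longrightarrow> poly f (x ^ Q) = poly f x ^ Q"
  using poly_frob[of f x] by (simp add: rat_iff)

lemma rat_poly_Fr: "rat f \<Longrightarrow> x \<in> Fr r \<Longrightarrow> poly f x \<in> Fr r"
proof -
  assume f: "rat f" and x: "x \<in> Fr r"
  have "poly f (x ^ (Q ^ n)) = poly f x ^ (Q ^ n)" for n
    by (induction n) (simp_all add: rat_poly[OF f] power_mult mult.commute[of Q])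
  from this[of r] x show "poly f x \<in> Fr r"
    by (simp add: Fr_def)
qed

lemma rat_mult: "rat f \<Longrightarrow> rat g \<Longrightarrow> rat (f * g)"
  by (simp add: rat_iff frob_mult)

lemma rat_cancel: "rat (f * g) \<Longrightarrow> rat f \<Longrightarrow> f \<noteq> 0 \<Longrightarrow> rat g"
  by (simp add: rat_iff frob_mult)

lemma rat_G: "rat G"
  using G by (simp add: rat_def)

text \<open>Frobenius permutes the roots and cannot lower their orders; as the sum of the orders
  over all roots is unchanged, each order is preserved.\<close>

lemma rat_roots:
  assumes "rat f" "f \<noteq> 0"
  shows "bij_betw (\<lambda>x. x ^ Q) {x. poly f x = 0} {x. poly f x = 0}"
    and "order (x ^ Q) f = order x f"
proof -
  have inj: "inj_on (\<lambda>x. x ^ Q) {x. poly f x = 0}"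
    by (rule inj_onI) (simp add: Q_inject)
  have fin: "finite {x. poly f x = 0}"
    using assms by (intro poly_roots_finite)
  have sub: "(\<lambda>x. x ^ Q) ` {x. poly f x = 0} \<subseteq> {x. poly f x = 0}"
    using assms Q1 by (auto simp: rat_poly)
  with inj fin have "(\<lambda>x. x ^ Q) ` {x. poly f x = 0} = {x. poly f x = 0}"
    by (intro endo_inj_surj)
  with inj show bij: "bij_betw (\<lambda>x. x ^ Q) {x. poly f x = 0} {x. poly f x = 0}"
    by (simp add: bij_betw_def)
  have le: "order x f \<le> order (x ^ Q) f" for x
  proof -
    obtain h where "f = [:-x, 1:] ^ order x f * h"
      using order_1[of x f] by (elim dvdE)
    then have "f = [:-(x ^ Q), 1:] ^ order x f * frob h"
      using assms(1) by (metis frob_linear frob_mult frob_power rat_iff)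
    then have "[:-(x ^ Q), 1:] ^ order x f dvd f"
      by (metis dvd_triv_left)
    then show ?thesis
      using assms order_divides by blast
  qed
  have "(\<Sum>x | poly f x = 0. order (x ^ Q) f) = (\<Sum>x | poly f x = 0. order x f)"
    by (rule sum.reindex_bij_betw[OF bij])
  then have eq: "order (x ^ Q) f = order x f" if "poly f x = 0"
    using sum_mono_inv[OF _ _ _ fin, of "\<lambda>x. order x f" "\<lambda>x. order (x ^ Q) f" x] le that by auto
  show "order (x ^ Q) f = order x f"
  proof (cases "poly f x = 0")
    case False
    then have "poly f (x ^ Q) \<noteq> 0"
      using rat_poly[OF assms(1)] by auto
    with False show ?thesis
      by (simp add: order_0I)
  qed (rule eq)
qed

lemma rat_prod_roots:
  assumes "rat f" "f \<noteq> 0" and e: "\<And>x. e (x ^ Q) = e x"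
  shows "rat (\<Prod>\<rho> | poly f \<rho> = 0. [:-\<rho>, 1:] ^ e \<rho>)"
proof -
  have "frob (\<Prod>\<rho> | poly f \<rho> = 0. [:-\<rho>, 1:] ^ e \<rho>) = (\<Prod>\<rho> | poly f \<rho> = 0. [:-(\<rho> ^ Q), 1:] ^ e (\<rho> ^ Q))"
    by (simp add: frob_prod frob_power frob_linear e)
  also have "\<dots> = (\<Prod>\<rho> | poly f \<rho> = 0. [:-\<rho>, 1:] ^ e \<rho>)"
    by (rule prod.reindex_bij_betw[OF rat_roots(1)[OF assms(1,2)]])
  finally show ?thesis
    by (simp add: rat_iff)
qed

section \<open>Classes of character values\<close>

definition P where "P = (if \<beta> = 0 then 1 else p)"

definition hh :: "'c \<Rightarrow> 'c" where "hh x = \<beta> * x + \<gamma> / x"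

text \<open>The exponent of \<open>G x\<close> and the sum inside \<open>E\<close> are the norm to the field of \<open>Q\<close> elements and the
  absolute trace.\<close>

definition S :: "nat \<Rightarrow> complex" where
  "S r = (\<Sum>x | x \<in> Fr r \<and> poly G x \<noteq> 0.
     \<theta> (poly G x ^ ((Q ^ r - 1) div (Q - 1))) * E (\<Sum>i<r * \<kappa>. hh x ^ (p ^ i)))"

text \<open>\<open>G\<close> is a constant times \<open>G1 ^ g\<close>, so \<open>\<theta> (G x)\<close> only depends on the class of \<open>G1\<close> modulo \<open>d\<close>-th powers, and
  \<open>G1\<close> satisfies the assumption \<open>kummer\<close> for \<open>d\<close>.\<close>

definition g where "g = Gcd (insert (Q - 1) ((\<lambda>\<rho>. order \<rho> G) ` {\<rho>. poly G \<rho> = 0}))"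

definition G1 where "G1 = (\<Prod>\<rho> | poly G \<rho> = 0. [:-\<rho>, 1:] ^ (order \<rho> G div g))"

definition d where "d = (Q - 1) div g"

lemma g_dvd: "g dvd Q - 1" "g dvd order \<rho> G"
proof -
  show "g dvd Q - 1"
    by (simp add: g_def)
  show "g dvd order \<rho> G"
  proof (cases "poly G \<rho> = 0")
    case True
    then show ?thesis
      unfolding g_def by (intro Gcd_dvd) auto
  qed (simp add: order_0I)
qed

lemma Q_eq: "Q - 1 = d * g"
  using g_dvd by (simp add: d_def)

lemma g_pos: "g > 0" and d_pos: "d > 0"
  using Q_eq Q1 by (auto intro!: Nat.gr0I)

lemma finite_roots: "finite {\<rho>. poly G \<rho> = 0}"
  using G by (intro poly_roots_finite)

lemma G1_nz: "G1 \<noteq> 0"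
  using finite_roots by (simp add: G1_def)

lemma order_G1: "order \<rho> G1 = order \<rho> G div g"
  unfolding G1_def by (subst order_prod_powers[OF finite_roots]) (auto simp: order_0I)

lemma G_eq: "G = smult (lead_coeff G) (G1 ^ g)"
proof -
  have "G1 ^ g = (\<Prod>\<rho> | poly G \<rho> = 0. [:-\<rho>, 1:] ^ order \<rho> G)"
    unfolding G1_def prod_power_distrib power_mult[symmetric]
    using g_dvd(2) by (intro prod.cong refl) simp
  then show ?thesis
    using poly_eq_prod_roots[OF G(1)] by simp
qed

lemma rat_G1: "rat G1"
  unfolding G1_def using rat_roots(2)[OF rat_G G(1)]
  by (intro rat_prod_roots rat_G G) simp

lemma G1_root_iff: "poly G1 x = 0 \<longleftrightarrow> poly G x = 0"
  using g_pos G by (subst (2) G_eq) simp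

text \<open>With \<open>Q - 1 = d * g\<close> and \<open>g\<close> the gcd of \<open>Q - 1\<close>
  and all orders of roots of \<open>G\<close>, the assumption says that \<open>d * g\<close> divides
  \<open>i\<close> times each of these numbers, hence \<open>i * g\<close>.\<close>

lemma kummer: "d dvd i" if "\<And>\<rho>. d dvd i * order \<rho> G1"
proof -
  have "d * g dvd i * order \<rho> G" for \<rho>
    using mult_dvd_mono[OF that[of \<rho>] dvd_refl[of g]] g_dvd(2)[of \<rho>] by (simp add: order_G1 mult.assoc)
  then have "d * g dvd Gcd ((*) i ` insert (Q - 1) ((\<lambda>\<rho>. order \<rho> G) ` {\<rho>. poly G \<rho> = 0}))"
    unfolding Q_eq by (intro Gcd_greatest) auto
  then have "d * g dvd i * g"
    unfolding g_def by (simp only: Gcd_mult normalize_idem) simp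
  then show ?thesis
    using g_pos by simp
qed

lemma dvd_Qr: "Q - 1 dvd Q ^ r - 1"
proof (induction r)
  case (Suc r)
  have "Q ^ Suc r - 1 = Q * (Q ^ r - 1) + (Q - 1)"
    using Q1 by (simp add: diff_mult_distrib2)
  then show ?case
    using Suc by simp
qed simp

lemma G_power:
  "poly G x ^ ((Q ^ r - 1) div (Q - 1)) =
    lead_coeff G ^ ((Q ^ r - 1) div (Q - 1)) * poly G1 x ^ ((Q ^ r - 1) div d)"
proof -
  obtain k where k: "Q ^ r - 1 = (Q - 1) * k"
    using dvd_Qr[of r] by (elim dvdE)
  have "(Q ^ r - 1) div (Q - 1) = k"
    using k Q1 by simp
  moreover have "(Q ^ r - 1) div d = g * k"
    unfolding k unfolding Q_eq mult.assoc using d_pos by simp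
  ultimately show ?thesis
    by (subst G_eq) (simp add: power_mult_distrib power_mult)
qed

definition T where "T = (if \<beta> = 0 then {0} else {t :: 'c. t ^ p = t})"

definition mu where "mu = {z :: 'c. z ^ d = 1}"

lemma card_pow_eq:
  fixes a :: "nat \<Rightarrow> 'c"
  assumes "n > 1"
  shows "finite {t :: 'c. t ^ n = t}" "card {t :: 'c. t ^ n = t} \<le> n"
proof -
  define f :: "'c poly" where "f = monom 1 n - monom 1 1"
  have deg: "degree f = n"
    unfolding f_def diff_conv_add_uminus using assms
    by (subst degree_add_eq_left) (auto simp: degree_monom_eq)
  have f0: "f \<noteq> 0"
    using deg assms by auto
  have roots: "{x. poly f x = 0} = {t. t ^ n = t}"
    by (auto simp: f_def poly_monom)
  show "finite {t :: 'c. t ^ n = t}" "card {t :: 'c. t ^ n = t} \<le> n"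
    using poly_roots_finite[OF f0] card_poly_roots_bound[OF f0] roots deg by simp_all
qed

lemma T: "finite T" "card T \<le> P"
  using card_pow_eq[OF p1] p1 by (auto simp: T_def P_def)

lemma mu: "finite mu" "card mu \<le> d"
proof -
  define f :: "'c poly" where "f = monom 1 d - 1"
  have deg: "degree f = d"
    unfolding f_def diff_conv_add_uminus using d_pos
    by (subst degree_add_eq_left) (auto simp: degree_monom_eq)
  have f0: "f \<noteq> 0"
    using deg d_pos by auto
  have roots: "{x. poly f x = 0} = mu"
    by (auto simp: f_def poly_monom mu_def)
  show "finite mu" "card mu \<le> d"
    using poly_roots_finite[OF f0] card_poly_roots_bound[OF f0] roots deg by simp_all
qed

lemma mu_Fr: "z \<in> mu \<Longrightarrow> z ^ Q = z" "z \<in> mu \<Longrightarrow> z \<noteq> 0"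
proof -
  assume z: "z \<in> mu"
  have "z ^ Q = z * z ^ (Q - 1)"
    using Q1 by (simp flip: power_Suc)
  moreover have "z ^ (Q - 1) = 1"
    unfolding Q_eq power_mult using z by (simp add: mu_def)
  ultimately show "z ^ Q = z"
    by simp
  show "z \<noteq> 0"
    using z d_pos by (auto simp: mu_def power_0_left)
qed

lemma T_p: "t \<in> T \<Longrightarrow> t ^ p = t"
  using p1 by (auto simp: T_def power_0_left split: if_splits)

lemma sum_character_zero:
  fixes f :: "'c \<Rightarrow> complex"
  assumes "bij_betw h A A" "\<And>a. a \<in> A \<Longrightarrow> f (h a) = w * f a" "w \<noteq> 1"
  shows "(\<Sum>a\<in>A. f a) = 0"
proof -
  have "(\<Sum>a\<in>A. f a) = (\<Sum>a\<in>A. f (h a))"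
    by (rule sum.reindex_bij_betw[OF assms(1), symmetric])
  also have "\<dots> = w * (\<Sum>a\<in>A. f a)"
    using assms(2) by (simp add: sum_distrib_left)
  finally show ?thesis
    using assms(3) by (simp add: algebra_simps)
qed

text \<open>One of the two factors is an orthogonality sum. In the multiplicative case the witness
  \<open>w ^ order \<rho> G\<close> lies in \<open>mu\<close>, because \<open>g\<close> divides the
  order and \<open>w ^ (d * g) = 1\<close>.\<close>

lemma sum_characters: "(\<Sum>(z, t)\<in>mu \<times> T. \<theta> z * E t) = 0"
proof -
  have "(\<Sum>(z, t)\<in>mu \<times> T. \<theta> z * E t) = (\<Sum>z\<in>mu. \<theta> z) * (\<Sum>t\<in>T. E t)"
    by (simp add: sum_product sum.cartesian_product)
  moreover have "(\<Sum>z\<in>mu. \<theta> z) = 0 \<or> (\<Sum>t\<in>T. E t) = 0"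
    using nontrivial
  proof
    assume *: "\<beta> \<noteq> 0 \<and> (\<exists>t. t ^ p = t \<and> E t \<noteq> 1)"
    then obtain t0 :: 'c where t0: "t0 ^ p = t0" "E t0 \<noteq> 1"
      by blast
    have T_eq: "T = {t :: 'c. t ^ p = t}"
      using * by (simp add: T_def)
    have add: "(u + w) ^ p = u ^ p + w ^ p" for u w :: 'c
      using pow_add[of u w 1] by simp
    have "bij_betw (\<lambda>t. t0 + t) T T"
      unfolding T_eq
    proof (rule bij_betwI[where g = "\<lambda>t. t - t0"])
      show "(\<lambda>t. t - t0) \<in> {t :: 'c. t ^ p = t} \<rightarrow> {t. t ^ p = t}"
      proof
        fix t :: 'c assume "t \<in> {t. t ^ p = t}"
        then show "t - t0 \<in> {t. t ^ p = t}"
          using add[of "t - t0" t0] t0 by (simp add: eq_diff_eq)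
      qed
    qed (use add t0 in auto)
    then have "(\<Sum>t\<in>T. E t) = 0"
      by (rule sum_character_zero[where w = "E t0"]) (use t0 T_p E_add in auto)
    then show ?thesis ..
  next
    assume "\<beta> = 0 \<and> \<gamma> = 0 \<and> (\<exists>\<rho> w. poly G \<rho> = 0 \<and> w ^ Q = w \<and> w \<noteq> 0 \<and> \<theta> (w ^ order \<rho> G) \<noteq> 1)"
    then obtain \<rho> w where w: "w ^ Q = w" "w \<noteq> 0" "\<theta> (w ^ order \<rho> G) \<noteq> 1"
      by blast
    define z0 where "z0 = w ^ order \<rho> G"
    have "w * w ^ (Q - 1) = w * 1"
      using w(1) Q1 by (simp flip: power_Suc)
    then have w1: "w ^ (d * g) = 1"
      using w(2) unfolding Q_eq by simp
    obtain k where "order \<rho> G = g * k"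
      using g_dvd(2)[of \<rho>] by (elim dvdE)
    then have "z0 ^ d = (w ^ (d * g)) ^ k"
      by (simp only: z0_def power_mult[symmetric] mult_ac)
    then have z0: "z0 ^ d = 1" "z0 \<noteq> 0" "z0 \<in> mu"
      using w1 w(2) by (auto simp: z0_def mu_def)
    have "bij_betw (\<lambda>t. z0 * t) mu mu"
    proof (rule bij_betwI[where g = "\<lambda>t. t / z0"])
    qed (use z0 in \<open>auto simp: mu_def power_mult_distrib power_divide\<close>)
    then have "(\<Sum>z\<in>mu. \<theta> z) = 0"
    proof (rule sum_character_zero)
      show "\<theta> (z0 * z) = \<theta> z0 * \<theta> z" if "z \<in> mu" for z
        using mu_Fr that z0(3) by (intro \<theta>_mult) auto
      show "\<theta> z0 \<noteq> 1"
        using w(3) by (simp add: z0_def)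
    qed
    then show ?thesis ..
  qed
  ultimately show ?thesis
    by auto
qed

text \<open>\<open>norm_sum_sub\<close> is applied to the class sizes: \<open>\<Delta>\<close> times
  the Stepanov bound exceeds the number of points, at least \<open>M * M - e\<close>, only by a
  multiple of \<open>M\<close>.\<close>

theorem S_even_bound:
  obtains C s0 where "\<And>s. s \<ge> s0 \<Longrightarrow> norm (S (2 * s)) \<le> C * real (Q ^ s)"
proof
  define e where "e = degree G1"
  define \<Delta> where "\<Delta> = d * P"
  define s0 where "s0 = 16 * \<Delta> * (e + 4)"
  define C where "C = real (\<Delta> * (5 * e + 23) + e)"
  fix s assume s: "s \<ge> s0"
  define M where "M = Q ^ s"
  have M1: "M \<ge> 1"
    unfolding M_def using Q1 by simp
  have P: "P > 0" "\<Delta> > 0"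
    using p1 d_pos by (simp_all add: P_def \<Delta>_def)
  have "s < Q ^ s"
    using less_exp[of s] power_mono[of 2 Q s] Q1 by linarith
  then have large: "16 * (d * P) * (degree G1 + 4) \<le> Q ^ s"
    using s unfolding s0_def e_def \<Delta>_def by simp
  have s1: "s > 0"
    using s P unfolding s0_def by (cases s) auto
  define r where "r = 2 * s"
  have r: "r > 0"
    using s1 by (simp add: r_def)
  define A where "A = {x \<in> Fr r. poly G x \<noteq> 0}"
  define cls where "cls = (\<lambda>x. (poly G1 x ^ ((Q ^ r - 1) div d), if \<beta> = 0 then 0 else \<Sum>i<r * \<kappa>. hh x ^ (p ^ i)))"
  define N where "N = (\<lambda>c. card {x \<in> A. cls x = c})"
  have finA: "finite A"
    using card_Fr(1)[OF r] by (simp add: A_def)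
  have Frx: "x ^ (Q ^ r) = x" if "x \<in> A" for x
    using that by (simp add: A_def Fr_def)
  have hh_Fr: "hh x \<in> Fr r" if "x \<in> A" for x
    unfolding hh_def using that Fr_base[OF \<beta>] Fr_base[OF \<gamma>]
    by (auto simp: A_def intro!: Fr_add Fr_mult Fr_divide)
  have cls: "cls x \<in> mu \<times> T" if x: "x \<in> A" for x
  proof -
    have "poly G1 x \<in> Fr r" "poly G1 x \<noteq> 0"
      using x rat_poly_Fr[OF rat_G1] G1_root_iff by (auto simp: A_def)
    moreover from this have "poly G1 x * poly G1 x ^ (Q ^ r - 1) = poly G1 x * 1"
      using Q1 by (simp add: Fr_def flip: power_Suc)
    ultimately have "poly G1 x ^ (Q ^ r - 1) = 1"
      by (metis mult_left_cancel)
    moreover have "d dvd Q ^ r - 1"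
      using dvd_Qr[of r] unfolding Q_eq by (rule dvd_mult_left)
    ultimately have "poly G1 x ^ ((Q ^ r - 1) div d) \<in> mu"
      by (simp add: mu_def flip: power_mult)
    moreover have "(\<Sum>i<r * \<kappa>. hh x ^ (p ^ i)) ^ p = (\<Sum>i<r * \<kappa>. hh x ^ (p ^ i))"
    proof -
      have "(\<Sum>i<r * \<kappa>. hh x ^ (p ^ i)) ^ p = (\<Sum>i<r * \<kappa>. hh x ^ (p ^ Suc i))"
        using pow_sum[of "\<lambda>i. hh x ^ (p ^ i)" "{..<r * \<kappa>}" 1] by (simp add: mult.commute flip: power_mult)
      moreover have "(\<Sum>i<r * \<kappa>. hh x ^ (p ^ Suc i) - hh x ^ (p ^ i)) = hh x ^ (p ^ (r * \<kappa>)) - hh x ^ (p ^ 0)"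
        by (rule sum_lessThan_telescope)
      moreover have "hh x ^ (p ^ (r * \<kappa>)) = hh x"
        using hh_Fr[OF x] by (simp add: Fr_def Qr mult.commute)
      ultimately show ?thesis
        by (simp add: sum_subtractf)
    qed
    ultimately show ?thesis
      by (simp add: cls_def T_def)
  qed
  have N_le: "real (N c) \<le> real (M * M + \<Delta> * (5 * e + 23) * M) / \<Delta>" for c
  proof -
    obtain z t where c: "c = (z, t)"
      by (cases c)
    interpret st: stepanov p Q \<kappa> d P s G1 \<beta> \<gamma> z t
    proof
      show "d dvd Q - 1"
        unfolding Q_eq by simp
      show "poly G1 0 = 0"
        using G1_root_iff G by simp
      show "P = 1 \<or> P = p \<and> \<beta> \<noteq> 0"
        by (simp add: P_def)
      show "d dvd i" if "\<And>\<rho>. d dvd i * order \<rho> G1" for i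
        using that by (rule kummer)
    qed (use p Q d_pos G1_nz large in auto)
    have "{x \<in> A. cls x = c} \<subseteq> st.B"
      unfolding st.B_def using Frx G1_root_iff
      by (auto simp: c cls_def r_def hh_def P_def A_def split: if_splits)
    then have "N c \<le> card st.B"
      unfolding N_def using st.stepanov_bound(1) by (rule card_mono[rotated])
    then have "\<Delta> * N c \<le> \<Delta> * card st.B"
      by simp
    also have "\<dots> \<le> M * M + \<Delta> * (5 * e + 23) * M"
      using st.stepanov_bound(2) by (simp add: \<Delta>_def e_def st.M_def M_def)
    finally have "real (\<Delta> * N c) \<le> real (M * M + \<Delta> * (5 * e + 23) * M)"
      by (rule of_nat_mono)
    then show ?thesis
      using P by (simp add: field_simps)
  qed
  have cardA: "M * M - e \<le> card A"
  proof -
    have "Fr r \<subseteq> A \<union> {x. poly G1 x = 0}"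
      using G1_root_iff by (auto simp: A_def)
    then have "card (Fr r) \<le> card (A \<union> {x. poly G1 x = 0})"
      using finA poly_roots_finite[OF G1_nz] by (intro card_mono) auto
    also have "\<dots> \<le> card A + card {x. poly G1 x = 0}"
      by (rule card_Un_le)
    also have "\<dots> \<le> card A + e"
      using card_poly_roots_bound[OF G1_nz] by (simp add: e_def)
    finally show ?thesis
      using card_Fr(2)[OF r] by (simp add: M_def r_def power_add mult_2)
  qed
  have sumN: "(\<Sum>c\<in>mu \<times> T. N c) = card A"
  proof -
    have "(\<Sum>c\<in>mu \<times> T. N c) = (\<Sum>c\<in>mu \<times> T. \<Sum>x\<in>{x \<in> A. cls x = c}. 1)"
      by (simp add: N_def)
    also have "\<dots> = (\<Sum>x\<in>A. 1)"
      using finA cls mu T by (intro sum.group finite_cartesian_product image_subsetI) simp_all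
    finally show ?thesis
      by simp
  qed
  \<comment> \<open>The leading coefficient of \<open>G\<close> contributes the same factor
    \<open>\<theta> w0\<close>, of absolute value 1, at every point.\<close>
  define w0 where "w0 = lead_coeff G ^ ((Q ^ r - 1) div (Q - 1))"
  have w0: "w0 ^ Q = w0" "w0 \<noteq> 0"
  proof -
    have "w0 \<in> Fr 1"
      unfolding w0_def by (rule Fr_power[OF Fr_base[OF G(3)]])
    then show "w0 ^ Q = w0" "w0 \<noteq> 0"
      using G(1) unfolding Fr_1 by (simp_all add: w0_def)
  qed
  have "S r = (\<Sum>x\<in>A. \<theta> w0 * (\<theta> (fst (cls x)) * E (snd (cls x))))"
    unfolding S_def A_def[symmetric] Collect_conj_eq[symmetric]
  proof (rule sum.cong)
    fix x assume x: "x \<in> A"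
    have "fst (cls x) \<in> mu"
      using cls[OF x] by auto
    then have "\<theta> (w0 * fst (cls x)) = \<theta> w0 * \<theta> (fst (cls x))"
      using w0 mu_Fr by (intro \<theta>_mult) auto
    moreover have "(\<Sum>i<r * \<kappa>. hh x ^ (p ^ i)) = snd (cls x)"
    proof (cases "\<beta> = 0")
      case True
      then have "hh x = 0"
        unfolding hh_def using nontrivial by auto
      then show ?thesis
        using p1 True by (simp add: cls_def power_0_left)
    qed (simp add: cls_def)
    moreover have "poly G x ^ ((Q ^ r - 1) div (Q - 1)) = w0 * fst (cls x)"
      unfolding G_power w0_def cls_def by simp
    ultimately show "\<theta> (poly G x ^ ((Q ^ r - 1) div (Q - 1))) * E (\<Sum>i<r * \<kappa>. hh x ^ (p ^ i)) =
        \<theta> w0 * (\<theta> (fst (cls x)) * E (snd (cls x)))"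
      by (simp only: mult.assoc)
  qed (simp add: A_def)
  also have "\<dots> = \<theta> w0 * (\<Sum>x\<in>A. \<theta> (fst (cls x)) * E (snd (cls x)))"
    by (simp add: sum_distrib_left)
  also have "(\<Sum>x\<in>A. \<theta> (fst (cls x)) * E (snd (cls x))) =
      (\<Sum>c\<in>mu \<times> T. \<Sum>x\<in>{x \<in> A. cls x = c}. \<theta> (fst (cls x)) * E (snd (cls x)))"
    using finA cls mu T by (intro sum.group[symmetric] finite_cartesian_product image_subsetI) simp_all
  also have "\<dots> = (\<Sum>c\<in>mu \<times> T. (\<theta> (fst c) * E (snd c)) * of_real (real (N c)))"
    by (intro sum.cong refl) (simp add: N_def mult.commute)
  finally have Sr: "norm (S r) = norm (\<Sum>c\<in>mu \<times> T. (\<theta> (fst c) * E (snd c)) * of_real (real (N c)))"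
    using norm_\<theta>[OF w0] by (simp add: norm_mult)
  also have "\<dots> \<le> real (card (mu \<times> T)) * (real (M * M + \<Delta> * (5 * e + 23) * M) / \<Delta>) - (\<Sum>c\<in>mu \<times> T. real (N c))"
  proof (rule norm_sum_sub)
    show "finite (mu \<times> T)"
      using mu T by simp
    show "(\<Sum>c\<in>mu \<times> T. \<theta> (fst c) * E (snd c)) = 0"
      using sum_characters by (simp add: case_prod_unfold)
    show "norm (\<theta> (fst c) * E (snd c)) \<le> 1" if "c \<in> mu \<times> T" for c
      using that mu_Fr norm_\<theta> norm_E T_p by (auto simp: norm_mult)
  qed (rule N_le)
  also have "\<dots> \<le> real \<Delta> * (real (M * M + \<Delta> * (5 * e + 23) * M) / \<Delta>) - (\<Sum>c\<in>mu \<times> T. real (N c))"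
  proof -
    have "card (mu \<times> T) \<le> \<Delta>"
      using mult_le_mono[OF mu(2) T(2)] by (simp add: card_cartesian_product \<Delta>_def)
    then show ?thesis
      by (intro diff_right_mono mult_right_mono) auto
  qed
  also have "\<dots> = real (M * M + \<Delta> * (5 * e + 23) * M) - real (card A)"
    using P sumN by (simp flip: of_nat_sum)
  also have "\<dots> \<le> real (\<Delta> * (5 * e + 23) * M) + real e"
  proof -
    have "M * M \<le> card A + e"
      using cardA by simp
    then have "real (M * M) \<le> real (card A) + real e"
      by (metis of_nat_add of_nat_mono)
    then show ?thesis
      by simp
  qed
  also have "\<dots> \<le> C * real M"
  proof -
    have "real e * 1 \<le> real e * real M"
      using M1 by (intro mult_left_mono) auto
    then show ?thesis
      by (simp add: C_def algebra_simps)
  qed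
  finally show "norm (S (2 * s)) \<le> C * real (Q ^ s)"
    by (simp add: r_def M_def)
qed

end

section \<open>The L-function\<close>

context weil
begin

definition res0 :: "'c poly \<Rightarrow> 'c" where
  "res0 f = (\<Prod>\<rho> | poly G \<rho> = 0. poly f \<rho> ^ order \<rho> G)"

text \<open>For monic \<open>f = \<Prod>(X - \<xi>)\<close> this is \<open>\<Prod>G(\<xi>)\<close>.\<close>

definition resG :: "'c poly \<Rightarrow> 'c" where
  "resG f = ((-1) ^ degree G * lead_coeff G) ^ degree f * res0 f"

text \<open>The logarithmic derivative at 0, hence additive on products. For
  \<open>X - \<xi>\<close> it is \<open>-1/\<xi>\<close>, and for the reflected polynomial
  \<open>- \<xi>\<close>.\<close>

definition lin :: "'c poly \<Rightarrow> 'c" where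
  "lin f = coeff f 1 / coeff f 0"

text \<open>For \<open>f = \<Prod>(X - \<xi>)\<close> this is \<open>\<Sum>(\<beta>\<xi> + \<gamma>/\<xi>)\<close>.\<close>

definition hs :: "'c poly \<Rightarrow> 'c" where
  "hs f = - \<beta> * lin (reflect_poly f) - \<gamma> * lin f"

definition tr0 :: "'c \<Rightarrow> 'c" where "tr0 v = (\<Sum>i<\<kappa>. v ^ (p ^ i))"

definition good :: "'c poly \<Rightarrow> bool" where
  "good f \<longleftrightarrow> (\<forall>\<rho>. poly G \<rho> = 0 \<longrightarrow> poly f \<rho> \<noteq> 0)"

text \<open>A Dirichlet character on the monic polynomials over the base field; the
  \<open>S r\<close> are the coefficients of the logarithmic derivative of its
  \<open>L\<close>-function.\<close>

definition Lam :: "'c poly \<Rightarrow> complex" where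
  "Lam f = (if good f then \<theta> (resG f) * E (tr0 (hs f)) else 0)"

lemma good_coeff_0: "good f \<Longrightarrow> coeff f 0 \<noteq> 0"
  using G(2) unfolding good_def by (metis poly_0_coeff_0)

lemma good_nz: "good f \<Longrightarrow> f \<noteq> 0"
  using good_coeff_0[of f] by auto

lemma good_mult: "good (f * h) \<longleftrightarrow> good f \<and> good h"
  by (auto simp: good_def)

lemma res0_mult: "res0 (f * h) = res0 f * res0 h"
  by (simp add: res0_def power_mult_distrib prod.distrib)

lemma resG_mult: "f \<noteq> 0 \<Longrightarrow> h \<noteq> 0 \<Longrightarrow> resG (f * h) = resG f * resG h"
  by (simp add: resG_def res0_mult degree_mult_eq power_add mult_ac)

lemma lin_mult: "coeff f 0 \<noteq> 0 \<Longrightarrow> coeff h 0 \<noteq> 0 \<Longrightarrow> lin (f * h) = lin f + lin h"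
  by (simp add: lin_def coeff_mult field_simps atMost_Suc)

lemma hs_mult: "coeff f 0 \<noteq> 0 \<Longrightarrow> coeff h 0 \<noteq> 0 \<Longrightarrow> hs (f * h) = hs f + hs h"
proof -
  assume "coeff f 0 \<noteq> 0" "coeff h 0 \<noteq> 0"
  moreover from this have "f \<noteq> 0" "h \<noteq> 0"
    by auto
  ultimately show ?thesis
    using lin_mult[of f h] lin_mult[of "reflect_poly f" "reflect_poly h"]
    by (simp add: hs_def reflect_poly_mult algebra_simps)
qed

lemma good_res0: "good f \<Longrightarrow> res0 f \<noteq> 0"
  by (simp add: res0_def good_def finite_roots)

lemma good_resG: "good f \<Longrightarrow> resG f \<noteq> 0"
  using G good_res0 by (simp add: resG_def)

lemma rat_res0: "rat f \<Longrightarrow> res0 f ^ Q = res0 f"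
proof -
  assume f: "rat f"
  have "res0 f ^ Q = (\<Prod>\<rho> | poly G \<rho> = 0. (poly f \<rho> ^ Q) ^ order \<rho> G)"
    by (simp add: res0_def prod_power_distrib mult.commute flip: power_mult)
  also have "\<dots> = (\<Prod>\<rho> | poly G \<rho> = 0. poly f (\<rho> ^ Q) ^ order (\<rho> ^ Q) G)"
    by (simp add: rat_poly[OF f] rat_roots(2)[OF rat_G G(1)])
  also have "\<dots> = res0 f"
    unfolding res0_def by (rule prod.reindex_bij_betw[OF rat_roots(1)[OF rat_G G(1)]])
  finally show ?thesis .
qed

definition sg where "sg = (-1) ^ degree G * lead_coeff G"

lemma sg: "sg ^ Q = sg" "sg \<noteq> 0"
proof -
  have "(-1 :: 'c) ^ Q = -1"
    using Q_minus[of 1] by simp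
  then have "((-1) ^ degree G) ^ Q = ((-1) ^ degree G :: 'c)"
    by (metis power_mult mult.commute)
  then show "sg ^ Q = sg" "sg \<noteq> 0"
    using G by (auto simp: sg_def power_mult_distrib)
qed

lemma rat_resG: "rat f \<Longrightarrow> resG f ^ Q = resG f"
proof -
  assume f: "rat f"
  have "(sg ^ degree f) ^ Q = (sg ^ Q) ^ degree f"
    by (simp only: power_mult[symmetric] mult.commute)
  then show ?thesis
    unfolding resG_def sg_def[symmetric] by (simp add: power_mult_distrib rat_res0[OF f] sg)
qed

lemma rat_hs: "rat f \<Longrightarrow> hs f ^ Q = hs f"
proof -
  assume f: "rat f"
  have "coeff (reflect_poly f) i ^ Q = coeff (reflect_poly f) i" for i
    using f Q1 by (auto simp: coeff_reflect_poly rat_def power_0_left)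
  then show ?thesis
    using f \<beta> \<gamma> by (simp add: hs_def lin_def rat_def power_mult_distrib power_divide Q_diff Q_minus)
qed

lemma tr0_add: "tr0 (u + v) = tr0 u + tr0 v"
  by (simp add: tr0_def pow_add sum.distrib)

lemma tr0_0: "tr0 0 = 0"
  using p1 by (simp add: tr0_def power_0_left)

lemma tr0_p: "v ^ Q = v \<Longrightarrow> tr0 v ^ p = tr0 v"
proof -
  assume v: "v ^ Q = v"
  have "tr0 v ^ p = (\<Sum>i<\<kappa>. v ^ (p ^ Suc i))"
    unfolding tr0_def using pow_sum[of "\<lambda>i. v ^ (p ^ i)" "{..<\<kappa>}" 1]
    by (simp add: mult.commute flip: power_mult)
  moreover have "(\<Sum>i<\<kappa>. v ^ (p ^ Suc i) - v ^ (p ^ i)) = v ^ (p ^ \<kappa>) - v ^ (p ^ 0)"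
    by (rule sum_lessThan_telescope)
  ultimately show ?thesis
    using v by (simp add: Q sum_subtractf tr0_def)
qed

lemma E_0: "E 0 = 1"
proof -
  have 0: "(0::'c) ^ p = 0"
    using p1 by (simp add: power_0_left)
  then have "E 0 = E 0 * E 0" "E 0 \<noteq> 0"
    using E_add[OF 0 0] norm_E[OF 0] by auto
  then show ?thesis
    by simp
qed

lemma \<theta>_1: "\<theta> 1 = 1"
proof -
  have "\<theta> 1 = \<theta> 1 * \<theta> 1" "\<theta> 1 \<noteq> 0"
    using \<theta>_mult[of 1 1] norm_\<theta>[of 1] by auto
  then show ?thesis
    by simp
qed

lemma \<theta>_power: "u ^ Q = u \<Longrightarrow> u \<noteq> 0 \<Longrightarrow> \<theta> (u ^ n) = \<theta> u ^ n"
proof (induction n)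
  case (Suc n)
  have "(u ^ n) ^ Q = u ^ n"
    using Suc.prems by (metis power_mult mult.commute)
  then show ?case
    using Suc \<theta>_mult[of u "u ^ n"] by simp
qed (simp add: \<theta>_1)

lemma Lam_mult:
  assumes "rat f" "rat h"
  shows "Lam (f * h) = Lam f * Lam h"
proof (cases "good f \<and> good h")
  case True
  have "\<theta> (resG f * resG h) = \<theta> (resG f) * \<theta> (resG h)"
    using assms True by (intro \<theta>_mult rat_resG good_resG) auto
  moreover have "E (tr0 (hs f) + tr0 (hs h)) = E (tr0 (hs f)) * E (tr0 (hs h))"
    using assms by (intro E_add tr0_p rat_hs)
  ultimately show ?thesis
    using True by (simp add: Lam_def good_mult resG_mult good_nz hs_mult good_coeff_0 tr0_add)
qed (auto simp: Lam_def good_mult)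

lemma Lam_1: "Lam 1 = 1"
proof -
  have "resG 1 = 1" "hs 1 = 0" "good 1"
    by (simp_all add: resG_def res0_def hs_def lin_def good_def)
  then show ?thesis
    by (simp add: Lam_def \<theta>_1 tr0_0 E_0)
qed

text \<open>For \<open>x\<close> in the extension of degree \<open>r\<close>, its characteristic
  polynomial over the base field, a power of the minimal polynomial.\<close>

definition cp :: "nat \<Rightarrow> 'c \<Rightarrow> 'c poly" where
  "cp r x = (\<Prod>i<r. [:-(x ^ (Q ^ i)), 1:])"

lemma cp_add: "cp (a + b) x = cp a x * cp b (x ^ (Q ^ a))"
  by (induction b) (simp_all add: cp_def power_add mult_ac flip: power_mult)

lemma cp_Suc: "cp (Suc r) x = cp r x * [:-(x ^ (Q ^ r)), 1:]"
  by (simp add: cp_def)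

lemma cp_nz: "cp r x \<noteq> 0"
  by (auto simp: cp_def)

lemma degree_cp: "degree (cp r x) = r"
proof (induction r)
  case (Suc r)
  then show ?case
    unfolding cp_Suc by (subst degree_mult_eq) (auto simp: cp_nz)
qed (simp add: cp_def)

lemma monic_cp: "lead_coeff (cp r x) = 1"
proof (induction r)
  case (Suc r)
  then show ?case
    unfolding cp_Suc lead_coeff_mult by simp
qed (simp add: cp_def)

lemma rat_cp: "x \<in> Fr r \<Longrightarrow> rat (cp r x)"
proof (cases r)
  case (Suc n)
  assume x: "x \<in> Fr r"
  have "frob (cp r x) = (\<Prod>i<r. [:-(x ^ (Q ^ Suc i)), 1:])"
    unfolding cp_def frob_prod frob_linear by (simp only: power_mult[symmetric] power_Suc2)
  also have "\<dots> = (\<Prod>i<n. [:-(x ^ (Q ^ Suc i)), 1:]) * [:-(x ^ (Q ^ 0)), 1:]"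
    using x unfolding Suc Fr_def by simp
  also have "\<dots> = cp r x"
    unfolding cp_def Suc by (simp only: prod.lessThan_Suc_shift mult.commute o_def)
  finally show ?thesis
    by (simp add: rat_iff)
qed (simp add: cp_def rat_iff frob_1)

lemma poly_G_pow: "poly G (x ^ (Q ^ i)) = poly G x ^ (Q ^ i)"
  by (induction i) (simp_all add: rat_poly[OF rat_G] power_mult mult.commute[of Q])

lemma good_cp: "r > 0 \<Longrightarrow> good (cp r x) \<longleftrightarrow> poly G x \<noteq> 0"
proof -
  assume r: "r > 0"
  have "good (cp r x) \<longleftrightarrow> (\<forall>i<r. poly G (x ^ (Q ^ i)) \<noteq> 0)"
    by (auto simp: good_def cp_def poly_prod)
  also have "\<dots> \<longleftrightarrow> poly G x \<noteq> 0"
    using r unfolding poly_G_pow by auto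
  finally show ?thesis .
qed

lemma resG_linear: "resG [:-x, 1:] = poly G x"
proof -
  have "res0 [:-x, 1:] = (\<Prod>\<rho> | poly G \<rho> = 0. (-1) ^ order \<rho> G * (x - \<rho>) ^ order \<rho> G)"
    unfolding res0_def by (intro prod.cong refl) (simp flip: power_mult_distrib)
  also have "\<dots> = (-1) ^ degree G * (\<Prod>\<rho> | poly G \<rho> = 0. (x - \<rho>) ^ order \<rho> G)"
    by (simp add: prod.distrib sum_order_eq_degree[OF G(1)] flip: power_sum)
  finally have "resG [:-x, 1:] = ((-1) ^ degree G * (-1) ^ degree G) *
      (lead_coeff G * (\<Prod>\<rho> | poly G \<rho> = 0. (x - \<rho>) ^ order \<rho> G))"
    by (simp add: resG_def mult_ac)
  also have "((-1) ^ degree G * (-1) ^ degree G :: 'c) = 1"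
    by (simp flip: power_mult_distrib)
  also have "lead_coeff G * (\<Prod>\<rho> | poly G \<rho> = 0. (x - \<rho>) ^ order \<rho> G) = poly G x"
    by (subst (4) poly_eq_prod_roots[OF G(1)]) (simp add: poly_prod)
  finally show ?thesis
    by simp
qed

lemma hs_linear: "x \<noteq> 0 \<Longrightarrow> hs [:-x, 1:] = hh x"
  by (simp add: hs_def lin_def hh_def coeff_reflect_poly)

lemma resG_cp: "resG (cp r x) = (\<Prod>i<r. poly G (x ^ (Q ^ i)))"
proof (induction r)
  case (Suc r)
  then show ?case
    unfolding cp_Suc by (subst resG_mult) (auto simp: cp_nz resG_linear)
qed (simp add: cp_def resG_def res0_def)

lemma hs_cp: "x \<noteq> 0 \<Longrightarrow> hs (cp r x) = (\<Sum>i<r. hh (x ^ (Q ^ i)))"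
proof (induction r)
  case (Suc r)
  have "coeff (cp r x) 0 \<noteq> 0"
    using Suc.prems by (simp add: cp_def poly_prod flip: poly_0_coeff_0)
  then show ?case
    using Suc unfolding cp_Suc by (subst hs_mult) (auto simp: hs_linear)
qed (simp add: cp_def hs_def lin_def)

lemma geom_Q: "(Q ^ r - 1) div (Q - 1) = (\<Sum>i<r. Q ^ i)"
proof -
  have "Q ^ r - 1 = (Q - 1) * (\<Sum>i<r. Q ^ i)"
  proof (induction r)
    case (Suc r)
    have "Q ^ Suc r - 1 = (Q - 1) * Q ^ r + (Q ^ r - 1)"
      using Q1 by (simp add: diff_mult_distrib)
    then show ?case
      by (simp only: Suc.IH sum.lessThan_Suc distrib_left add.commute)
  qed simp
  then show ?thesis
    using Q1 by simp
qed

text \<open>The product of \<open>G\<close> over the conjugates of \<open>x\<close> is the norm of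
  \<open>G x\<close>, and the relative trace followed by \<open>tr0\<close> is the absolute
  trace.\<close>

lemma Lam_cp:
  assumes x: "r > 0"
  shows "Lam (cp r x) = (if poly G x \<noteq> 0 then
    \<theta> (poly G x ^ ((Q ^ r - 1) div (Q - 1))) * E (\<Sum>i<r * \<kappa>. hh x ^ (p ^ i)) else 0)"
proof (cases "poly G x = 0")
  case False
  then have x0: "x \<noteq> 0"
    using G by auto
  have "resG (cp r x) = poly G x ^ ((Q ^ r - 1) div (Q - 1))"
    unfolding resG_cp poly_G_pow geom_Q by (simp add: power_sum)
  moreover have "tr0 (hs (cp r x)) = (\<Sum>i<r * \<kappa>. hh x ^ (p ^ i))"
  proof -
    have hh: "hh (x ^ (Q ^ l)) = hh x ^ (Q ^ l)" for l
    proof (induction l)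
      case (Suc l)
      have "hh (u ^ Q) = hh u ^ Q" for u
        by (simp add: hh_def Q_add power_mult_distrib power_divide \<beta> \<gamma>)
      then show ?case
        using Suc by (simp add: power_mult mult.commute[of Q])
    qed simp
    have "tr0 (hs (cp r x)) = (\<Sum>i<\<kappa>. (\<Sum>l<r. hh x ^ (Q ^ l)) ^ (p ^ i))"
      by (simp add: tr0_def hs_cp[OF x0] hh)
    also have "\<dots> = (\<Sum>i<\<kappa>. \<Sum>l<r. hh x ^ (p ^ (l * \<kappa> + i)))"
      unfolding pow_sum by (simp add: Qr power_add mult.commute[of \<kappa>] flip: power_mult)
    also have "\<dots> = (\<Sum>l<r. \<Sum>i<\<kappa>. hh x ^ (p ^ (l * \<kappa> + i)))"
      by (rule sum.swap)
    also have "\<dots> = (\<Sum>l<r. \<Sum>i\<in>{l * \<kappa>..<l * \<kappa> + \<kappa>}. hh x ^ (p ^ i))"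
    proof (rule sum.cong[OF refl])
      fix l
      show "(\<Sum>i<\<kappa>. hh x ^ (p ^ (l * \<kappa> + i))) = (\<Sum>i\<in>{l * \<kappa>..<l * \<kappa> + \<kappa>}. hh x ^ (p ^ i))"
        by (rule sum.reindex_bij_witness[of _ "\<lambda>i. i - l * \<kappa>" "\<lambda>i. l * \<kappa> + i"]) auto
    qed
    also have "\<dots> = (\<Sum>i<r * \<kappa>. hh x ^ (p ^ i))"
      by (rule sum.nat_group)
    finally show ?thesis .
  qed
  ultimately show ?thesis
    using False x by (simp add: Lam_def good_cp)
qed (simp add: Lam_def good_cp[OF x])

lemma S_eq: "r > 0 \<Longrightarrow> S r = (\<Sum>x\<in>Fr r. Lam (cp r x))"
  using card_Fr(1)[of r] unfolding S_def
  by (simp add: Lam_cp sum.inter_filter[symmetric] cong: sum.cong)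

definition MP :: "nat \<Rightarrow> 'c poly set" where
  "MP N = {f. rat f \<and> degree f = N \<and> lead_coeff f = 1}"

text \<open>The coefficients of the \<open>L\<close>-function of \<open>Lam\<close>.\<close>

definition AA :: "nat \<Rightarrow> complex" where "AA N = (\<Sum>f\<in>MP N. Lam f)"

lemma finite_MP: "finite (MP N)"
proof (rule finite_subset)
  show "MP N \<subseteq> (\<lambda>c. \<Sum>i\<le>N. monom (c i) i) ` (PiE {..N} (\<lambda>_. Fr 1))"
  proof
    fix f assume f: "f \<in> MP N"
    have "f = (\<Sum>i\<le>N. monom (restrict (coeff f) {..N} i) i)"
      using f poly_as_sum_of_monoms[of f] by (simp add: MP_def)
    moreover have "restrict (coeff f) {..N} \<in> PiE {..N} (\<lambda>_. Fr 1)"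
      using f by (auto simp: MP_def rat_def Fr_def)
    ultimately show "f \<in> (\<lambda>c. \<Sum>i\<le>N. monom (c i) i) ` (PiE {..N} (\<lambda>_. Fr 1))"
      by (rule image_eqI)
  qed
  show "finite ((\<lambda>c. \<Sum>i\<le>N. monom (c i) i) ` (PiE {..N} (\<lambda>_. Fr 1)))"
    using card_Fr(1)[of 1] by (intro finite_imageI finite_PiE) auto
qed

lemma AA_0: "AA 0 = 1"
proof -
  have "MP 0 = {1}"
    by (auto simp: MP_def rat_iff frob_1 elim!: degree_eq_zeroE)
  then show ?thesis
    by (simp add: AA_def Lam_1)
qed

text \<open>Multiplicativity of \<open>Lam\<close> merges a pair \<open>(x, g)\<close> into
  \<open>f = cp r x * g\<close>; conversely \<open>x\<close> and \<open>f\<close> determine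
  \<open>g\<close>, so \<open>f\<close> is hit once for each \<open>x\<close> with
  \<open>cp r x\<close> dividing it.\<close>

lemma S_AA:
  assumes r: "0 < r" "r \<le> N"
  shows "S r * AA (N - r) = (\<Sum>f\<in>MP N. of_nat (card {x \<in> Fr r. cp r x dvd f}) * Lam f)"
proof -
  have bij: "(\<Sum>g\<in>MP (N - r). Lam (cp r x * g)) = (\<Sum>f\<in>{f\<in>MP N. cp r x dvd f}. Lam f)"
    if x: "x \<in> Fr r" for x
  proof (rule sum.reindex_bij_betw)
    show "bij_betw (\<lambda>g. cp r x * g) (MP (N - r)) {f \<in> MP N. cp r x dvd f}"
    proof (rule bij_betw_imageI)
      show "inj_on (\<lambda>g. cp r x * g) (MP (N - r))"
        using cp_nz by (auto simp: inj_on_def)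
      show "(\<lambda>g. cp r x * g) ` MP (N - r) = {f \<in> MP N. cp r x dvd f}"
      proof (intro equalityI subsetI)
        fix f assume "f \<in> (\<lambda>g. cp r x * g) ` MP (N - r)"
        then obtain g where g: "g \<in> MP (N - r)" "f = cp r x * g"
          by blast
        then have "g \<noteq> 0"
          by (auto simp: MP_def)
        then have "degree f = N" "rat f"
          using g r rat_cp[OF x] cp_nz by (auto simp: MP_def rat_mult degree_mult_eq degree_cp)
        moreover have "lead_coeff f = 1"
          using g(1) unfolding g(2) lead_coeff_mult monic_cp by (auto simp: MP_def)
        ultimately show "f \<in> {f \<in> MP N. cp r x dvd f}"
          using g(2) by (simp add: MP_def)
      next
        fix f assume f: "f \<in> {f \<in> MP N. cp r x dvd f}"
        then obtain g where g: "f = cp r x * g"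
          by (auto elim: dvdE)
        have "f \<noteq> 0"
          using f by (auto simp: MP_def)
        then have g0: "g \<noteq> 0"
          using g by auto
        have "rat g"
          using f g rat_cancel[OF _ rat_cp[OF x] cp_nz] by (auto simp: MP_def)
        moreover have "degree g = N - r"
          using f g g0 cp_nz by (auto simp: MP_def degree_mult_eq degree_cp)
        moreover have "lead_coeff g = 1"
          using f unfolding g MP_def by (auto simp: lead_coeff_mult monic_cp)
        ultimately show "f \<in> (\<lambda>g. cp r x * g) ` MP (N - r)"
          using g by (auto simp: MP_def)
      qed
    qed
  qed
  have "S r * AA (N - r) = (\<Sum>x\<in>Fr r. \<Sum>g\<in>MP (N - r). Lam (cp r x) * Lam g)"
    using r by (simp add: S_eq AA_def sum_product)
  also have "\<dots> = (\<Sum>x\<in>Fr r. \<Sum>g\<in>MP (N - r). Lam (cp r x * g))"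
    by (intro sum.cong refl) (simp add: Lam_mult rat_cp MP_def)
  also have "\<dots> = (\<Sum>x\<in>Fr r. \<Sum>f\<in>{f\<in>MP N. cp r x dvd f}. Lam f)"
    by (intro sum.cong refl bij)
  also have "\<dots> = (\<Sum>x\<in>Fr r. \<Sum>f\<in>MP N. if cp r x dvd f then Lam f else 0)"
    using finite_MP by (simp add: sum.inter_filter)
  also have "\<dots> = (\<Sum>f\<in>MP N. \<Sum>x\<in>Fr r. if cp r x dvd f then Lam f else 0)"
    by (rule sum.swap)
  also have "\<dots> = (\<Sum>f\<in>MP N. of_nat (card {x \<in> Fr r. cp r x dvd f}) * Lam f)"
    using card_Fr(1)[OF r(1)] by (simp add: sum.inter_filter[symmetric])
  finally show ?thesis .
qed

lemma dvd_by_orders: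
  fixes f :: "'c poly"
  assumes "f \<noteq> 0" "finite Y" "\<And>y. y \<in> Y \<Longrightarrow> j \<le> order y f"
  shows "(\<Prod>y\<in>Y. [:-y, 1:]) ^ j dvd f"
proof (cases "j = 0")
  case False
  have "Y \<subseteq> {\<rho>. poly f \<rho> = 0}"
    using assms(3) False order_0I by fastforce
  then have "(\<Prod>y\<in>Y. [:-y, 1:] ^ j) dvd (\<Prod>\<rho> | poly f \<rho> = 0. [:-\<rho>, 1:] ^ order \<rho> f)"
    using assms poly_roots_finite[OF assms(1)] by (intro prod_dvd_prod_subset2 le_imp_power_dvd) auto
  also have "\<dots> dvd smult (lead_coeff f) (\<Prod>\<rho> | poly f \<rho> = 0. [:-\<rho>, 1:] ^ order \<rho> f)"
    by (rule dvd_smult) simp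
  also have "\<dots> = f"
    by (rule poly_eq_prod_roots[OF assms(1), symmetric])
  finally show ?thesis
    by (simp add: prod_power_distrib)
qed simp

lemma root_period:
  assumes f: "rat f" "f \<noteq> 0" "poly f x = 0"
  obtains \<delta> where "\<delta> > 0" "x ^ (Q ^ \<delta>) = x"
proof -
  have roots: "poly f (x ^ (Q ^ n)) = 0" for n
  proof (induction n)
    case (Suc n)
    then show ?case
      using rat_poly[OF f(1), of "x ^ (Q ^ n)"] Q1 by (simp add: mult.commute power_0_left flip: power_mult)
  qed (use f in auto)
  have "\<not> inj_on (\<lambda>n. x ^ (Q ^ n)) UNIV"
  proof
    assume "inj_on (\<lambda>n. x ^ (Q ^ n)) UNIV"
    then have "infinite (range (\<lambda>n. x ^ (Q ^ n)))"
      using finite_imageD infinite_UNIV_nat by blast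
    moreover have "range (\<lambda>n. x ^ (Q ^ n)) \<subseteq> {y. poly f y = 0}"
      using roots by auto
    ultimately show False
      using poly_roots_finite[OF f(2)] finite_subset by blast
  qed
  then obtain a b where ab: "a < b" "x ^ (Q ^ a) = x ^ (Q ^ b)"
    by (metis injI linorder_neqE_nat)
  have "x ^ (Q ^ b) = (x ^ (Q ^ (b - a))) ^ (Q ^ a)"
    using ab(1) by (simp flip: power_mult power_add)
  then have "x = x ^ (Q ^ (b - a))"
    using ab(2) unfolding Qr by (metis pow_inject)
  with ab show ?thesis
    by (intro that[of "b - a"]) auto
qed

text \<open>Let \<open>\<delta>\<close> be the period of \<open>x\<close> under Frobenius. Then
  \<open>x\<close> lies in \<open>Fr r\<close> exactly for multiples
  \<open>r = j * \<delta>\<close>, where \<open>cp r x\<close> is the \<open>j\<close>-th power of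
  the minimal polynomial; this power divides \<open>f\<close> exactly for \<open>j\<close> up to the
  order of \<open>x\<close>.\<close>

lemma count_root:
  assumes f: "rat f" "f \<noteq> 0" "poly f x = 0"
  shows "card {r \<in> {1..degree f}. x \<in> Fr r \<and> cp r x dvd f} = order x f"
proof -
  define \<delta> where "\<delta> = (LEAST d. d > 0 \<and> x ^ (Q ^ d) = x)"
  have \<delta>: "\<delta> > 0" "x ^ (Q ^ \<delta>) = x"
    using LeastI_ex[of "\<lambda>d. d > 0 \<and> x ^ (Q ^ d) = x"] root_period[OF f] unfolding \<delta>_def by blast+
  have min: "x ^ (Q ^ d) \<noteq> x" if "0 < d" "d < \<delta>" for d
    using not_less_Least[of d "\<lambda>d. d > 0 \<and> x ^ (Q ^ d) = x"] that unfolding \<delta>_def by blast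
  have mult: "x ^ (Q ^ (j * \<delta>)) = x" for j
    by (induction j) (simp_all add: power_add power_mult \<delta>)
  have Fr_iff: "x \<in> Fr r \<longleftrightarrow> \<delta> dvd r" for r
  proof
    assume "x \<in> Fr r"
    have "x ^ (Q ^ r) = (x ^ (Q ^ (r div \<delta> * \<delta>))) ^ (Q ^ (r mod \<delta>))"
      by (simp flip: power_mult power_add)
    then have "x ^ (Q ^ (r mod \<delta>)) = x"
      using \<open>x \<in> Fr r\<close> mult by (simp add: Fr_def)
    then have "r mod \<delta> = 0"
      using min[of "r mod \<delta>"] \<delta> by auto
    then show "\<delta> dvd r"
      by auto
  qed (auto simp: Fr_def mult mult.commute[of \<delta>] elim!: dvdE)
  have cp_j: "cp (j * \<delta>) x = cp \<delta> x ^ j" for j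
  proof (induction j)
    case (Suc j)
    have "cp (Suc j * \<delta>) x = cp (j * \<delta> + \<delta>) x"
      by (simp add: add.commute)
    also have "\<dots> = cp (j * \<delta>) x * cp \<delta> x"
      by (simp only: cp_add mult)
    finally show ?case
      using Suc by (simp add: mult.commute)
  qed (simp add: cp_def)
  define Y where "Y = (\<lambda>i. x ^ (Q ^ i)) ` {..<\<delta>}"
  have inj: "inj_on (\<lambda>i. x ^ (Q ^ i)) {..<\<delta>}"
  proof (rule linorder_inj_onI')
    fix a b assume ab: "a \<in> {..<\<delta>}" "b \<in> {..<\<delta>}" "a < b"
    show "x ^ (Q ^ a) \<noteq> x ^ (Q ^ b)"
    proof
      assume eq: "x ^ (Q ^ a) = x ^ (Q ^ b)"
      have "x ^ (Q ^ b) = (x ^ (Q ^ (b - a))) ^ (Q ^ a)"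
        using ab(3) by (simp flip: power_mult power_add)
      then have "x = x ^ (Q ^ (b - a))"
        using eq unfolding Qr by (metis pow_inject)
      moreover have "0 < b - a" "b - a < \<delta>"
        using ab by auto
      ultimately show False
        using min[of "b - a"] by simp
    qed
  qed
  have cp_Y: "cp \<delta> x = (\<Prod>y\<in>Y. [:-y, 1:])"
    unfolding Y_def cp_def by (subst prod.reindex[OF inj]) simp
  have ord_orbit: "order (x ^ (Q ^ i)) f = order x f" for i
  proof (induction i)
    case (Suc i)
    have "x ^ (Q ^ Suc i) = (x ^ (Q ^ i)) ^ Q"
      by (simp add: mult.commute flip: power_mult)
    then show ?case
      using Suc rat_roots(2)[OF f(1,2)] by simp
  qed simp
  have dvd_iff: "cp \<delta> x ^ j dvd f \<longleftrightarrow> j \<le> order x f" for j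
  proof
    assume "j \<le> order x f"
    then show "cp \<delta> x ^ j dvd f"
      unfolding cp_Y by (intro dvd_by_orders) (auto simp: f Y_def ord_orbit)
  next
    assume "cp \<delta> x ^ j dvd f"
    moreover have "[:-x, 1:] dvd cp \<delta> x"
      unfolding cp_Y using \<delta> by (intro dvd_prodI) (auto simp: Y_def intro!: image_eqI[of _ _ 0])
    ultimately have "[:-x, 1:] ^ j dvd f"
      using dvd_power_same dvd_trans by blast
    then show "j \<le> order x f"
      using f(2) by (simp add: order_divides)
  qed
  have "{r \<in> {1..degree f}. x \<in> Fr r \<and> cp r x dvd f} = (\<lambda>j. j * \<delta>) ` {1..order x f}"
  proof (intro equalityI subsetI)
    fix r assume r: "r \<in> {r \<in> {1..degree f}. x \<in> Fr r \<and> cp r x dvd f}"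
    then obtain j where j: "r = j * \<delta>"
      using Fr_iff by (auto simp: mult.commute elim!: dvdE)
    with r have "j \<le> order x f" "j \<ge> 1"
      using cp_j dvd_iff by (auto intro: Nat.gr0I simp: Suc_le_eq)
    with j show "r \<in> (\<lambda>j. j * \<delta>) ` {1..order x f}"
      by auto
  next
    fix r assume "r \<in> (\<lambda>j. j * \<delta>) ` {1..order x f}"
    then obtain j where j: "r = j * \<delta>" "j \<in> {1..order x f}"
      by blast
    then have d: "cp r x dvd f"
      using cp_j dvd_iff by auto
    have "r \<le> degree f"
      using dvd_imp_degree_le[OF d f(2)] by (simp add: degree_cp)
    moreover have "r \<ge> 1"
      using j \<delta> by simp
    ultimately show "r \<in> {r \<in> {1..degree f}. x \<in> Fr r \<and> cp r x dvd f}"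
      using d j Fr_iff by simp
  qed
  moreover have "inj_on (\<lambda>j. j * \<delta>) {1..order x f}"
    using \<delta> by (auto simp: inj_on_def)
  ultimately show ?thesis
    by (simp add: card_image)
qed

text \<open>The analogue of summing the von Mangoldt function over the divisors: after exchanging
  the sums, \<open>count_root\<close> leaves the sum of the orders of all roots.\<close>

lemma count_all:
  assumes f: "f \<in> MP N"
  shows "(\<Sum>r\<in>{1..N}. card {x \<in> Fr r. cp r x dvd f}) = N"
proof -
  have f': "rat f" "degree f = N" "f \<noteq> 0"
    using f by (auto simp: MP_def)
  define R where "R = {x. poly f x = 0}"
  have finR: "finite R"
    unfolding R_def using f' by (intro poly_roots_finite)
  have sub: "{x \<in> Fr r. cp r x dvd f} = {x \<in> R. x \<in> Fr r \<and> cp r x dvd f}" if "r \<in> {1..N}" for r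
  proof -
    have "x \<in> R" if "cp r x dvd f" for x
    proof -
      have "poly (cp r x) x = 0"
        using \<open>r \<in> {1..N}\<close> by (auto simp: cp_def poly_prod intro!: bexI[of _ 0])
      then show ?thesis
        using that by (auto simp: R_def elim!: dvdE)
    qed
    then show ?thesis
      by auto
  qed
  have "(\<Sum>r\<in>{1..N}. card {x \<in> Fr r. cp r x dvd f}) =
      (\<Sum>r\<in>{1..N}. \<Sum>x\<in>R. if x \<in> Fr r \<and> cp r x dvd f then 1 else 0)"
    using finR by (intro sum.cong refl) (simp only: sub, simp add: sum.inter_filter[symmetric])
  also have "\<dots> = (\<Sum>x\<in>R. \<Sum>r\<in>{1..N}. if x \<in> Fr r \<and> cp r x dvd f then 1 else 0)"
    by (rule sum.swap)
  also have "\<dots> = (\<Sum>x\<in>R. card {r \<in> {1..N}. x \<in> Fr r \<and> cp r x dvd f})"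
    by (simp add: sum.inter_filter[symmetric])
  also have "\<dots> = (\<Sum>x\<in>R. order x f)"
    using count_root[OF f'(1,3)] f'(2) by (intro sum.cong refl) (simp add: R_def)
  also have "\<dots> = N"
    unfolding R_def using sum_order_eq_degree[OF f'(3)] f'(2) by simp
  finally show ?thesis .
qed

text \<open>This is \<open>T * L'(T) = L(T) * (\<Sum>r. S r * T ^ r)\<close> for the
  \<open>L\<close>-function, coefficient by coefficient; the weight \<open>N\<close> on the left is
  the degree counted in \<open>count_all\<close>.\<close>

theorem newton_identity: "of_nat N * AA N = (\<Sum>r\<in>{1..N}. S r * AA (N - r))"
proof -
  have "(\<Sum>r\<in>{1..N}. S r * AA (N - r)) =
      (\<Sum>r\<in>{1..N}. \<Sum>f\<in>MP N. of_nat (card {x \<in> Fr r. cp r x dvd f}) * Lam f)"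
    by (intro sum.cong refl S_AA) auto
  also have "\<dots> = (\<Sum>f\<in>MP N. \<Sum>r\<in>{1..N}. of_nat (card {x \<in> Fr r. cp r x dvd f}) * Lam f)"
    by (rule sum.swap)
  also have "\<dots> = (\<Sum>f\<in>MP N. of_nat N * Lam f)"
  proof (intro sum.cong refl)
    fix f assume f: "f \<in> MP N"
    have "(\<Sum>r\<in>{1..N}. of_nat (card {x \<in> Fr r. cp r x dvd f}) * Lam f) =
        of_nat (\<Sum>r\<in>{1..N}. card {x \<in> Fr r. cp r x dvd f}) * Lam f"
      by (simp add: sum_distrib_right)
    then show "(\<Sum>r\<in>{1..N}. of_nat (card {x \<in> Fr r. cp r x dvd f}) * Lam f) = of_nat N * Lam f"
      by (simp only: count_all[OF f])
  qed
  finally show ?thesis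
    by (simp add: AA_def sum_distrib_left)
qed

end

section \<open>The Weil bound\<close>

text \<open>Simultaneous approximation gives a large \<open>s\<close> for which all
  \<open>z i ^ s\<close> point nearly in the positive real direction. Without cancellation, the
  power sum is at least half of \<open>norm (z j) ^ s\<close>.\<close>

lemma power_sum_growth:
  fixes z :: "nat \<Rightarrow> complex"
  assumes B: "B > 0" and bound: "\<And>s. s \<ge> m \<Longrightarrow> norm (\<Sum>i<n. z i ^ s) \<le> C * B ^ s"
    and j: "j < n"
  shows "norm (z j) \<le> B"
proof (rule ccontr)
  assume "\<not> norm (z j) \<le> B"
  then have gt: "norm (z j) / B > 1"
    using B by simp
  define \<theta> where "\<theta> = (\<lambda>i. Arg (z i) / (2 * pi))"
  obtain L where L: "2 * C < (norm (z j) / B) ^ L"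
    using real_arch_pow[OF gt] by blast
  \<comment> \<open>The exponent \<open>s\<close> will be a multiple of \<open>L'\<close>, which
    makes it large enough for both \<open>bound\<close> and the contradiction with
    \<open>L\<close>.\<close>
  define L' where "L' = max (max L m) 1"
  \<comment> \<open>An error below \<open>1 / 6\<close> of a full turn is an angle below
    \<open>pi / 3\<close>, where the cosine is at least \<open>1 / 2\<close>.\<close>
  obtain q p where q: "0 < q" and approx: "\<And>i. i < n \<Longrightarrow> \<bar>of_int q * (real L' * \<theta> i) - of_int (p i)\<bar> < 1 / real 6"
    by (rule Dirichlet_approx_simult[where N = 6 and n = n and \<theta> = "\<lambda>i. real L' * \<theta> i"])
      (simp, rule that, assumption, blast)
  define s where "s = nat q * L'"
  have sL: "s \<ge> L'"
    using q unfolding s_def by (cases "nat q") auto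
  have cos: "cos (real s * Arg (z i)) \<ge> 1 / 2" if i: "i < n" for i
  proof -
    define \<epsilon> where "\<epsilon> = of_int q * (real L' * \<theta> i) - of_int (p i)"
    have "real s * Arg (z i) = 2 * pi * \<epsilon> + 2 * pi * of_int (p i)"
      using q by (simp add: s_def \<epsilon>_def \<theta>_def field_simps)
    then have "cos (real s * Arg (z i)) = cos (2 * pi * \<epsilon>)"
      by (simp only: cos_add sin_int_2pin cos_int_2pin mult_zero_right diff_zero mult_1_right)
    also have "\<dots> = cos \<bar>2 * pi * \<epsilon>\<bar>"
      by simp
    also have "\<dots> \<ge> cos (pi / 3)"
    proof (rule cos_monotone_0_pi_le)
      show "\<bar>2 * pi * \<epsilon>\<bar> \<le> pi / 3"
        using approx[OF i] by (simp add: \<epsilon>_def[symmetric] abs_mult)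
    qed auto
    finally show ?thesis
      by (simp add: cos_60)
  qed
  have Re_pow: "Re (z i ^ s) = norm (z i) ^ s * cos (real s * Arg (z i))" for i
  proof -
    have "z i ^ s = rcis (norm (z i) ^ s) (real s * Arg (z i))"
      by (metis rcis_cmod_Arg DeMoivre2)
    then show ?thesis
      by (simp add: Re_rcis)
  qed
  have "norm (z j) ^ s / 2 \<le> Re (z j ^ s)"
    using cos[OF j] mult_left_mono[of "1/2" "cos (real s * Arg (z j))" "norm (z j) ^ s"] by (simp add: Re_pow)
  also have "\<dots> \<le> (\<Sum>i<n. Re (z i ^ s))"
  proof (rule member_le_sum)
    fix i assume "i \<in> {..<n} - {j}"
    then have "cos (real s * Arg (z i)) \<ge> 0"
      using cos[of i] by simp
    then show "0 \<le> Re (z i ^ s)"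
      by (simp add: Re_pow)
  qed (use j in auto)
  also have "\<dots> = Re (\<Sum>i<n. z i ^ s)"
    by simp
  also have "\<dots> \<le> norm (\<Sum>i<n. z i ^ s)"
    by (rule complex_Re_le_cmod)
  also have "\<dots> \<le> C * B ^ s"
    using sL by (intro bound) (simp add: L'_def)
  finally have "(norm (z j) / B) ^ s \<le> 2 * C"
    using B by (simp add: power_divide field_simps)
  moreover have "(norm (z j) / B) ^ L \<le> (norm (z j) / B) ^ s"
    using gt sL by (intro power_increasing) (auto simp: L'_def)
  ultimately show False
    using L by simp
qed

text \<open>Logarithmic derivative: a factor \<open>F = 1 - w X\<close> satisfies
  \<open>X * F' = - F * (w X + w^2 X^2 + ...)\<close>, and such identities add up over
  products.\<close>

lemma power_sums_of_factors:
  fixes w :: "nat \<Rightarrow> complex"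
  shows "of_nat N * coeff (\<Prod>i<n. [:1, - w i:]) N =
    - (\<Sum>r\<in>{1..N}. (\<Sum>i<n. w i ^ r) * coeff (\<Prod>i<n. [:1, - w i:]) (N - r))"
proof -
  define L where "L = (\<lambda>n. fps_of_poly (\<Prod>i<n. [:1, - w i:]))"
  define Ps where "Ps = (\<lambda>n. Abs_fps (\<lambda>r. if r = 0 then 0 else \<Sum>i<n. w i ^ r))"
  have *: "fps_X * fps_deriv (L n) = - (L n * Ps n)"
  proof (induction n)
    case 0
    show ?case
      by (simp add: L_def Ps_def fps_eq_iff)
  next
    case (Suc n)
    define F where "F = fps_of_poly [:1, - w n:]"
    define g where "g = Abs_fps (\<lambda>r. if r = 0 then 0 else w n ^ r)"
    have L: "L (Suc n) = L n * F"
      by (simp add: L_def F_def fps_of_poly_mult)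
    have P: "Ps (Suc n) = Ps n + g"
      by (simp add: Ps_def g_def fps_eq_iff)
    have F: "F = 1 - fps_const (w n) * fps_X"
      by (simp add: F_def fps_of_poly_linear')
    have "F * g = fps_const (w n) * fps_X"
    proof (rule fps_ext)
      fix r
      have "fps_nth (F * g) r = fps_nth g r - w n * (if r = 0 then 0 else fps_nth g (r - 1))"
        by (simp add: F left_diff_distrib mult.assoc)
      then show "fps_nth (F * g) r = fps_nth (fps_const (w n) * fps_X) r"
        by (cases r) (auto simp: g_def)
    qed
    then have Fg: "fps_X * fps_deriv F = - (F * g)"
      by (simp add: F mult.commute)
    have "fps_X * fps_deriv (L (Suc n)) = (fps_X * fps_deriv (L n)) * F + L n * (fps_X * fps_deriv F)"
      by (simp add: L algebra_simps)
    then show ?case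
      unfolding Suc Fg by (simp add: L P algebra_simps)
  qed
  have "fps_nth (fps_X * fps_deriv (L n)) N = of_nat N * coeff (\<Prod>i<n. [:1, - w i:]) N"
    by (cases N) (simp_all add: L_def)
  moreover have "fps_nth (L n * Ps n) N = (\<Sum>r\<in>{1..N}. (\<Sum>i<n. w i ^ r) * coeff (\<Prod>i<n. [:1, - w i:]) (N - r))"
  proof -
    have "fps_nth (L n * Ps n) N = (\<Sum>r=0..N. fps_nth (Ps n) r * fps_nth (L n) (N - r))"
      by (subst mult.commute) (rule fps_mult_nth)
    also have "\<dots> = (\<Sum>r\<in>{1..N}. fps_nth (Ps n) r * fps_nth (L n) (N - r))"
      by (intro sum.mono_neutral_right) (auto simp: Ps_def)
    finally show ?thesis
      by (simp add: Ps_def L_def)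
  qed
  ultimately show ?thesis
    using * by simp
qed

text \<open>The \<open>A N\<close> are the coefficients of a polynomial with constant term 1, and
  the \<open>w i\<close> are the roots of its reflection. Its factorization obeys the same recursion
  with the negative power sums, and \<open>A 0 = 1\<close> makes the recursion determine
  \<open>S\<close>.\<close>

lemma power_sums_from_newton:
  fixes A S :: "nat \<Rightarrow> complex"
  assumes A0: "A 0 = 1" and newton: "\<And>N. of_nat N * A N = (\<Sum>r\<in>{1..N}. S r * A (N - r))"
    and vanish: "\<And>N. N > D \<Longrightarrow> A N = 0"
  obtains n w where "n \<le> D" "\<And>r. r > 0 \<Longrightarrow> S r = - (\<Sum>i<n. w i ^ r)"
proof -
  define L where "L = (\<Sum>i\<le>D. monom (A i) i)"
  have cL: "coeff L i = A i" for i
    using vanish by (auto simp: L_def coeff_sum)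
  define n where "n = degree (reflect_poly L)"
  have c0: "coeff L 0 \<noteq> 0"
    by (simp add: cL A0)
  have degL: "degree L \<le> D"
    using vanish by (intro degree_le) (auto simp: cL)
  then have "n \<le> D"
    unfolding n_def using degree_reflect_poly_le[of L] by simp
  obtain w where w: "smult (lead_coeff (reflect_poly L)) (\<Prod>i<n. [:- w i, 1:]) = reflect_poly L"
    unfolding n_def using complex_poly_decompose' by blast
  have "lead_coeff (reflect_poly L) = coeff L 0"
    using c0 by (simp add: coeff_reflect_poly)
  then have "reflect_poly L = (\<Prod>i<n. [:- w i, 1:])"
    using w A0 cL by simp
  then have "L = reflect_poly (\<Prod>i<n. [:- w i, 1:])"
    using c0 by (metis reflect_poly_reflect_poly)
  also have "\<dots> = (\<Prod>i<n. [:1, - w i:])"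
  proof -
    have "reflect_poly [:- u, 1:] = [:1, - u:]" for u :: complex
      by (rule poly_eqI) (auto simp: coeff_reflect_poly coeff_pCons split: nat.split)
    then show ?thesis
      by (simp add: reflect_poly_prod)
  qed
  finally have L: "L = (\<Prod>i<n. [:1, - w i:])" .
  have "S r = - (\<Sum>i<n. w i ^ r)" if "r > 0" for r
    using that
  proof (induction r rule: less_induct)
    case (less N)
    have eq: "{1..N} = insert N {1..<N}"
      using less.prems by auto
    have "(\<Sum>r\<in>{1..N}. S r * A (N - r)) = (\<Sum>r\<in>{1..N}. - (\<Sum>i<n. w i ^ r) * A (N - r))"
      using power_sums_of_factors[where N = N and n = n and w = w] newton[of N] by (simp add: cL flip: L) (simp add: sum_negf)
    moreover have "(\<Sum>r\<in>{1..<N}. S r * A (N - r)) = (\<Sum>r\<in>{1..<N}. - (\<Sum>i<n. w i ^ r) * A (N - r))"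
      using less.IH by (intro sum.cong refl) simp
    ultimately have "S N * A 0 = - (\<Sum>i<n. w i ^ N) * A 0"
      unfolding eq by simp
    then show ?case
      by (simp add: A0)
  qed
  with \<open>n \<le> D\<close> show ?thesis
    by (rule that)
qed

context weil
begin

section \<open>Degree of the L-function\<close>

definition nroots where "nroots = card {\<rho>. poly G \<rho> = 0}"

definition rad where "rad = (\<Prod>\<rho> | poly G \<rho> = 0. [:-\<rho>, 1:])"

lemma rad: "rat rad" "degree rad = nroots" "lead_coeff rad = 1" "rad \<noteq> 0"
  "\<And>\<rho>. poly rad \<rho> = 0 \<longleftrightarrow> poly G \<rho> = 0"
proof -
  show "rat rad"
    using rat_prod_roots[OF rat_G G(1), of "\<lambda>_. 1"] by (simp add: rad_def)
  show "degree rad = nroots"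
    unfolding rad_def nroots_def by (subst degree_prod_eq_sum_degree) auto
  show "lead_coeff rad = 1"
    unfolding rad_def lead_coeff_prod by simp
  show "rad \<noteq> 0"
    using finite_roots by (simp add: rad_def)
  show "poly rad \<rho> = 0 \<longleftrightarrow> poly G \<rho> = 0" for \<rho>
    using finite_roots by (auto simp: rad_def poly_prod)
qed

text \<open>A fiber of the trace consists of roots of a polynomial of degree
  \<open>p ^ (\<kappa> - 1)\<close>, so the \<open>p ^ \<kappa>\<close> elements have at least
  \<open>p\<close> different traces.\<close>

lemma tr0_surj:
  assumes t: "t ^ p = t"
  obtains v where "v ^ Q = v" "tr0 v = t"
proof -
  define F1 where "F1 = {v :: 'c. v ^ Q = v}"
  have F1: "F1 = Fr 1"
    by (auto simp: F1_def Fr_def)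
  have cardF: "card F1 = Q" "finite F1"
    using card_Fr[of 1] by (simp_all add: F1)
  obtain k where k: "\<kappa> = Suc k"
    using Q by (cases \<kappa>) auto
  define Tp where "Tp = {t :: 'c. t ^ p = t}"
  have Tp: "finite Tp" "card Tp \<le> p"
    using card_pow_eq[OF p1] by (simp_all add: Tp_def)
  have sub: "tr0 ` F1 \<subseteq> Tp"
    using tr0_p by (auto simp: F1_def Tp_def)
  have fiber: "card {v \<in> F1. tr0 v = u} \<le> p ^ k" for u
  proof -
    define f where "f = (\<Sum>i<\<kappa>. monom (1::'c) (p ^ i)) - [:u:]"
    have le: "degree f \<le> p ^ k"
      unfolding f_def using p1 by (intro degree_diff_le degree_sum_le)
        (auto simp: degree_monom_eq k intro!: power_increasing)
    have inj: "p ^ i = p ^ k \<longleftrightarrow> i = k" for i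
      using p1 by simp
    have "coeff f (p ^ k) = (\<Sum>i<\<kappa>. if i = k then 1 else 0)"
      using p1 by (simp add: f_def coeff_sum inj coeff_pCons split: nat.split)
    then have "coeff f (p ^ k) = 1"
      by (simp add: k)
    then have f0: "f \<noteq> 0"
      by auto
    have "{v \<in> F1. tr0 v = u} \<subseteq> {v. poly f v = 0}"
      by (auto simp: f_def poly_sum poly_monom tr0_def)
    then have "card {v \<in> F1. tr0 v = u} \<le> card {v. poly f v = 0}"
      using poly_roots_finite[OF f0] by (intro card_mono)
    also have "\<dots> \<le> p ^ k"
      using card_poly_roots_bound[OF f0] le by simp
    finally show ?thesis .
  qed
  have "card F1 = (\<Sum>u\<in>tr0 ` F1. card {v \<in> F1. tr0 v = u})"
    using sum.group[of F1 "tr0 ` F1" tr0 "\<lambda>_. 1 :: nat"] cardF(2) by simp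
  also have "\<dots> \<le> (\<Sum>u\<in>tr0 ` F1. p ^ k)"
    using fiber by (intro sum_mono)
  finally have "p * p ^ k \<le> card (tr0 ` F1) * p ^ k"
    using cardF(1) by (simp add: Q k)
  then have "p \<le> card (tr0 ` F1)"
    using p1 by simp
  then have "tr0 ` F1 = Tp"
    using Tp sub by (intro card_seteq) auto
  then have "t \<in> tr0 ` F1"
    using t by (simp add: Tp_def)
  then show ?thesis
    using that by (auto simp: F1_def)
qed

text \<open>The added polynomial vanishes on the roots of \<open>G\<close>, which fixes
  \<open>resG\<close>, and to order at least 2 at 0, which fixes the \<open>\<gamma>\<close> part;
  only the coefficient below the leading one changes \<open>hs\<close>. The second zero at 0 needs a
  factor \<open>X\<close> besides \<open>rad\<close>, hence \<open>nroots + 2\<close>.\<close>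

lemma Lam_shift:
  assumes f: "f \<in> MP N" and N: "N \<ge> nroots + 2" and c: "c ^ Q = c"
  defines "f' \<equiv> f + smult c (rad * [:0, 1:] ^ (N - 1 - nroots))"
  shows "f' \<in> MP N" "Lam f' = E (tr0 (- \<beta> * c)) * Lam f"
proof -
  define h where "h = smult c (rad * [:0, 1:] ^ (N - 1 - nroots))"
  have f': "f' = f + h"
    by (simp add: f'_def h_def)
  have degh: "degree h \<le> N - 1"
    using N by (cases "c = 0") (auto simp: h_def degree_mult_eq rad degree_power_eq)
  have deg: "degree f = N" "lead_coeff f = 1" "rat f"
    using f by (auto simp: MP_def)
  have ratX: "rat ([:0, 1:] ^ k)" for k
    using frob_linear[of 0] Q1 by (simp add: rat_iff frob_power power_0_left)
  have "rat (rad * [:0, 1:] ^ (N - 1 - nroots))"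
    using rad ratX by (intro rat_mult)
  then have "rat h"
    using c by (simp add: h_def rat_def power_mult_distrib)
  then have ratf': "rat f'"
    using deg unfolding f' by (simp add: rat_iff frob_add)
  have deg': "degree f' = N" "lead_coeff f' = 1"
    using degh deg N unfolding f' by (simp_all add: degree_add_eq_left coeff_eq_0)
  then show "f' \<in> MP N"
    using ratf' by (simp add: MP_def)
  have root: "poly f' \<rho> = poly f \<rho>" if "poly G \<rho> = 0" for \<rho>
    using that rad(5) by (simp add: f' h_def)
  have good: "good f' \<longleftrightarrow> good f"
    using root by (simp add: good_def)
  have res: "resG f' = resG f"
    using root deg deg' by (simp add: resG_def res0_def)
  have "[:0, 1:] dvd rad"
    using rad(5)[of 0] G(2) poly_eq_0_iff_dvd[of rad 0] by simp
  then obtain rad' where rad': "rad = [:0, 1:] * rad'"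
    by (elim dvdE)
  obtain k where k: "N - 1 - nroots = Suc k"
    using N by (cases "N - 1 - nroots") auto
  have "h = [:0, 1:] * ([:0, 1:] * smult c (rad' * [:0, 1:] ^ k))"
    unfolding h_def k rad' by (simp add: mult_ac)
  then have c01: "coeff h 0 = 0" "coeff h 1 = 0"
    by simp_all
  have lin: "lin f' = lin f"
    using c01 by (simp add: lin_def f')
  have topc: "coeff h (N - 1) = c"
  proof -
    have "degree (rad * [:0, 1:] ^ (N - 1 - nroots)) = N - 1"
      using N by (simp add: degree_mult_eq rad degree_power_eq)
    moreover have "lead_coeff (rad * [:0, 1:] ^ (N - 1 - nroots)) = 1"
      unfolding lead_coeff_mult lead_coeff_power rad(3) by simp
    ultimately show ?thesis
      by (simp add: h_def)
  qed
  have linr: "lin (reflect_poly f') = lin (reflect_poly f) + c"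
    using deg deg' N topc by (simp add: lin_def coeff_reflect_poly f')
  have hs': "hs f' = hs f + (- \<beta> * c)"
    by (simp add: hs_def lin linr algebra_simps)
  have E': "E (tr0 (hs f) + tr0 (- \<beta> * c)) = E (tr0 (hs f)) * E (tr0 (- \<beta> * c))"
    using deg c \<beta> by (intro E_add tr0_p rat_hs) (auto simp: power_mult_distrib Q_minus)
  show "Lam f' = E (tr0 (- \<beta> * c)) * Lam f"
    unfolding Lam_def good res hs' tr0_add E' by simp
qed

lemma sum_zero_if_inj_twist:
  fixes F :: "'b \<Rightarrow> complex"
  assumes "finite A" "inj_on \<phi> A" "\<phi> ` A \<subseteq> A" "\<And>a. a \<in> A \<Longrightarrow> F (\<phi> a) = w * F a" "w \<noteq> 1"
  shows "(\<Sum>a\<in>A. F a) = 0"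
proof -
  have "\<phi> ` A = A"
    using assms(1-3) by (intro endo_inj_surj)
  then have "(\<Sum>a\<in>A. F a) = (\<Sum>a\<in>A. F (\<phi> a))"
    using sum.reindex[OF assms(2), of F] by simp
  also have "\<dots> = w * (\<Sum>a\<in>A. F a)"
    using assms(4) by (simp add: sum_distrib_left)
  finally show ?thesis
    using assms(5) by (simp add: algebra_simps)
qed

lemma AA_vanish_additive:
  assumes \<beta>0: "\<beta> \<noteq> 0" and N: "N \<ge> nroots + 2"
  shows "AA N = 0"
proof -
  obtain t where t: "t ^ p = t" "E t \<noteq> 1"
    using nontrivial \<beta>0 by blast
  obtain v where v: "v ^ Q = v" "tr0 v = t"
    using tr0_surj[OF t(1)] .
  define c where "c = - v / \<beta>"
  have c: "c ^ Q = c" "- \<beta> * c = v"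
    using v \<beta> \<beta>0 by (simp_all add: c_def power_divide Q_minus)
  show ?thesis
    unfolding AA_def
  proof (rule sum_zero_if_inj_twist[OF finite_MP])
    show "inj_on (\<lambda>f. f + smult c (rad * [:0, 1:] ^ (N - 1 - nroots))) (MP N)"
      by (auto simp: inj_on_def)
    show "(\<lambda>f. f + smult c (rad * [:0, 1:] ^ (N - 1 - nroots))) ` MP N \<subseteq> MP N"
      using Lam_shift(1)[OF _ N c(1)] by auto
    show "Lam (f + smult c (rad * [:0, 1:] ^ (N - 1 - nroots))) = E t * Lam f" if "f \<in> MP N" for f
      using Lam_shift(2)[OF that N c(1)] c(2) v(2) by simp
  qed (rule t(2))
qed

text \<open>Frobenius on coefficients carries a division by \<open>h\<close> to another one, and
  division with remainder is unique.\<close>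

lemma rat_mod: "rat f \<Longrightarrow> rat h \<Longrightarrow> h \<noteq> 0 \<Longrightarrow> rat (f mod h)"
proof -
  assume f: "rat f" and h: "rat h" "h \<noteq> 0"
  have "frob f = frob h * frob (f div h) + frob (f mod h)"
    by (simp flip: frob_mult frob_add)
  then have eq: "f = h * frob (f div h) + frob (f mod h)"
    using f h by (simp add: rat_iff)
  have deg: "degree (frob u) = degree u" for u
  proof (intro antisym degree_le allI impI)
    fix i assume "degree (frob u) < i"
    then show "coeff u i = 0"
      using coeff_frob[of u i] coeff_eq_0[of "frob u" i] by simp
  qed (use Q1 in \<open>auto simp: coeff_frob coeff_eq_0 power_0_left\<close>)
  have "frob (f mod h) = 0 \<or> degree (frob (f mod h)) < degree h"
    using degree_mod_less[OF h(2), of f] by (auto simp: deg) (simp add: frob_def)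
  then have "frob (f mod h) mod h = frob (f mod h)"
    by (auto simp: mod_poly_less)
  then have "f mod h = frob (f mod h)"
    by (subst eq) simp
  then show ?thesis
    by (simp add: rat_iff)
qed

lemma dvd_by_roots:
  assumes "\<And>\<rho>. poly G \<rho> = 0 \<Longrightarrow> poly f \<rho> = 0"
  shows "rad dvd f"
proof (cases "f = 0")
  case False
  then show ?thesis
    using dvd_by_orders[OF False finite_roots, of 1] assms order_gt_0_iff[OF False]
    by (simp add: rad_def Suc_le_eq)
qed simp

text \<open>Replacing \<open>f\<close> by a polynomial that is \<open>u * f\<close> modulo
  \<open>rad\<close> permutes \<open>MP N\<close>, because a remainder modulo \<open>rad\<close>
  leaves the leading term alone, and it multiplies \<open>Lam\<close> by
  \<open>\<theta> (res0 u)\<close>. It remains to find a \<open>u\<close> for which this factor is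
  not 1.\<close>

lemma AA_vanish_multiplicative:
  assumes \<beta>\<gamma>: "\<beta> = 0" "\<gamma> = 0" and N: "N \<ge> nroots"
  shows "AA N = 0"
proof -
  have n1: "nroots > 0"
    using G finite_roots by (auto simp: nroots_def card_gt_0_iff)
  have Lam: "Lam f = (if good f then \<theta> (resG f) else 0)" for f
    unfolding Lam_def hs_def by (simp add: \<beta>\<gamma> tr0_0 E_0)
  \<comment> \<open>If all these values were 1, \<open>Lam (cp r x)\<close> would be
    \<open>\<theta> sg ^ r\<close> wherever \<open>G x\<close> is nonzero. Then
    \<open>S (2 * s)\<close> would have absolute value at least
    \<open>Q ^ (2 * s) - degree G\<close>, against the crude bound \<open>C * Q ^ s\<close>.\<close>
  have "\<exists>u. rat u \<and> good u \<and> \<theta> (res0 u) \<noteq> 1"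
  proof (rule ccontr)
    assume contra: "\<not> ?thesis"
    have norm1: "norm (\<theta> sg) = 1"
      using sg norm_\<theta> by blast
    have val: "Lam (cp r x) = (if poly G x \<noteq> 0 then \<theta> sg ^ r else 0)" if x: "x \<in> Fr r" "r > 0" for x r
    proof (cases "poly G x = 0")
      case False
      then have good: "good (cp r x)"
        using x good_cp by simp
      have sgr: "(sg ^ r) ^ Q = sg ^ r"
        using sg(1) by (metis power_mult mult.commute)
      have "\<theta> (resG (cp r x)) = \<theta> (sg ^ r) * \<theta> (res0 (cp r x))"
        unfolding resG_def degree_cp sg_def[symmetric]
        using sg sgr rat_res0[OF rat_cp[OF x(1)]] good_res0[OF good] by (intro \<theta>_mult) auto
      moreover have "\<theta> (res0 (cp r x)) = 1"
        using contra good rat_cp[OF x(1)] by blast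
      ultimately show ?thesis
        using good False by (simp add: Lam \<theta>_power[OF sg])
    qed (use x in \<open>simp add: Lam good_cp\<close>)
    obtain C s0 where C: "\<And>s. s \<ge> s0 \<Longrightarrow> norm (S (2 * s)) \<le> C * real (Q ^ s)"
      using S_even_bound by blast
    have lower: "real (Q ^ s) * real (Q ^ s) - real (degree G) \<le> norm (S (2 * s))" if s: "s > 0" for s
    proof -
      have "S (2 * s) = (\<Sum>x\<in>Fr (2 * s). if poly G x \<noteq> 0 then \<theta> sg ^ (2 * s) else 0)"
        using s val by (simp add: S_eq cong: sum.cong)
      also have "\<dots> = of_nat (card {x \<in> Fr (2 * s). poly G x \<noteq> 0}) * \<theta> sg ^ (2 * s)"
        using card_Fr(1)[of "2 * s"] s by (simp add: sum.inter_filter[symmetric])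
      finally have "norm (S (2 * s)) = real (card {x \<in> Fr (2 * s). poly G x \<noteq> 0})"
        by (simp add: norm_mult norm_power norm1)
      moreover have "Q ^ (2 * s) \<le> card {x \<in> Fr (2 * s). poly G x \<noteq> 0} + degree G"
      proof -
        have "card (Fr (2 * s)) \<le> card ({x \<in> Fr (2 * s). poly G x \<noteq> 0} \<union> {x. poly G x = 0})"
          using card_Fr(1)[of "2 * s"] s finite_roots by (intro card_mono) auto
        also have "\<dots> \<le> card {x \<in> Fr (2 * s). poly G x \<noteq> 0} + card {x. poly G x = 0}"
          by (rule card_Un_le)
        finally show ?thesis
          using card_Fr(2)[of "2 * s"] s card_poly_roots_bound[OF G(1)] by simp
      qed
      then have "real (Q ^ (2 * s)) \<le> real (card {x \<in> Fr (2 * s). poly G x \<noteq> 0}) + real (degree G)"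
        by (metis of_nat_add of_nat_mono)
      ultimately show ?thesis
        by (simp add: mult_2 power_add)
    qed
    obtain s where s: "s > s0" "real s > \<bar>C\<bar> + real (degree G)"
    proof -
      obtain k :: nat where "real k > \<bar>C\<bar> + real (degree G)"
        using reals_Archimedean2 by blast
      then show ?thesis
        by (intro that[of "max k (Suc s0)"]) auto
    qed
    define M where "M = real (Q ^ s)"
    have "s < Q ^ s"
      using less_exp[of s] power_mono[of 2 Q s] Q1 by linarith
    then have "real s < M"
      unfolding M_def by (simp only: of_nat_less_iff)
    then have M: "M > \<bar>C\<bar> + real (degree G)"
      using s by simp
    have M1: "M \<ge> 1"
      using Q1 by (simp add: M_def)
    have "M * M - real (degree G) \<le> C * M"
      using lower[of s] C[of s] s by (simp add: M_def)
    also have "C * M \<le> \<bar>C\<bar> * M"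
      using M1 by (intro mult_right_mono) auto
    finally have "M * (M - \<bar>C\<bar>) \<le> real (degree G)"
      by (simp add: algebra_simps)
    moreover have "1 * (M - \<bar>C\<bar>) \<le> M * (M - \<bar>C\<bar>)"
      using M M1 by (intro mult_right_mono) auto
    ultimately have "1 * (M - \<bar>C\<bar>) \<le> real (degree G)"
      by (rule order_trans[rotated])
    then show False
      using M by simp
  qed
  then obtain u where u: "rat u" "good u" "\<theta> (res0 u) \<noteq> 1"
    by blast
  define \<phi> where "\<phi> = (\<lambda>f. f + ((u - 1) * f) mod rad)"
  have \<phi>_root: "poly (\<phi> f) \<rho> = poly u \<rho> * poly f \<rho>" if "poly G \<rho> = 0" for f \<rho>
  proof -
    have "poly (h mod rad) \<rho> = poly h \<rho>" for h
    proof -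
      have "poly h \<rho> = poly (h div rad * rad + h mod rad) \<rho>"
        by (simp only: div_mult_mod_eq)
      also have "\<dots> = poly (h mod rad) \<rho>"
        unfolding poly_add poly_mult using that rad(5)[of \<rho>] by simp
      finally show ?thesis
        by simp
    qed
    from this[of "(u - 1) * f"] show ?thesis
      by (simp add: \<phi>_def algebra_simps)
  qed
  have deg_mod: "degree (f mod rad) < N" for f
    using degree_mod_less[OF rad(4), of f] rad(2) n1 N by auto
  show ?thesis
    unfolding AA_def
  proof (rule sum_zero_if_inj_twist[OF finite_MP])
    show "inj_on \<phi> (MP N)"
    proof (rule inj_onI)
      fix f f' assume "\<phi> f = \<phi> f'"
      then have "poly f \<rho> = poly f' \<rho>" if "poly G \<rho> = 0" for \<rho>
        using \<phi>_root[OF that, of f] \<phi>_root[OF that, of f'] u(2) that by (auto simp: good_def)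
      then have "rad dvd f - f'"
        by (intro dvd_by_roots) simp
      then have "rad dvd (u - 1) * (f - f')"
        by simp
      then have "((u - 1) * f) mod rad = ((u - 1) * f') mod rad"
        by (simp add: mod_eq_dvd_iff right_diff_distrib)
      with \<open>\<phi> f = \<phi> f'\<close> show "f = f'"
        by (simp add: \<phi>_def)
    qed
    show "\<phi> ` MP N \<subseteq> MP N"
    proof
      fix f' assume "f' \<in> \<phi> ` MP N"
      then obtain f where f: "f \<in> MP N" "f' = \<phi> f"
        by blast
      have "rat (((u - 1) * f) mod rad)"
        using u(1) f(1) rad by (intro rat_mod rat_mult) (auto simp: rat_iff frob_diff frob_1 MP_def)
      then have "rat f'"
        using f by (simp add: \<phi>_def rat_iff frob_add MP_def)
      moreover have "degree f' = N" "lead_coeff f' = 1"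
        using f deg_mod[of "(u - 1) * f"]
        by (auto simp: \<phi>_def MP_def degree_add_eq_left coeff_eq_0)
      ultimately show "f' \<in> MP N"
        by (simp add: MP_def)
    qed
    then have deg_\<phi>: "degree (\<phi> f) = N" if "f \<in> MP N" for f
      using that by (auto simp: MP_def)
    show "Lam (\<phi> f) = \<theta> (res0 u) * Lam f" if f: "f \<in> MP N" for f
    proof -
      have good: "good (\<phi> f) \<longleftrightarrow> good f"
        using \<phi>_root u(2) by (auto simp: good_def)
      have "res0 (\<phi> f) = res0 u * res0 f"
        using \<phi>_root by (simp add: res0_def power_mult_distrib prod.distrib)
      then have "resG (\<phi> f) = res0 u * resG f"
        using f deg_\<phi>[OF f] by (simp add: resG_def MP_def)
      moreover have "\<theta> (res0 u * resG f) = \<theta> (res0 u) * \<theta> (resG f)" if "good f"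
        using u f that by (intro \<theta>_mult rat_res0 rat_resG good_res0 good_resG) (auto simp: MP_def)
      ultimately show ?thesis
        by (simp add: Lam good)
    qed
  qed (rule u(3))
qed

theorem weil_bound: "norm (S 1) \<le> real (nroots + 1) * sqrt (real Q)"
proof -
  have vanish: "AA N = 0" if "N > nroots + 1" for N
    using nontrivial
  proof
    assume "\<beta> \<noteq> 0 \<and> (\<exists>t. t ^ p = t \<and> E t \<noteq> 1)"
    then show ?thesis
      using that by (intro AA_vanish_additive) auto
  next
    assume "\<beta> = 0 \<and> \<gamma> = 0 \<and> (\<exists>\<rho> w. poly G \<rho> = 0 \<and> w ^ Q = w \<and> w \<noteq> 0 \<and> \<theta> (w ^ order \<rho> G) \<noteq> 1)"
    then show ?thesis
      using that by (intro AA_vanish_multiplicative) auto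
  qed
  obtain n w where n: "n \<le> nroots + 1" and w: "\<And>r. r > 0 \<Longrightarrow> S r = - (\<Sum>i<n. w i ^ r)"
    using power_sums_from_newton[of AA S "nroots + 1"] AA_0 newton_identity vanish by blast
  obtain C s0 where C: "\<And>s. s \<ge> s0 \<Longrightarrow> norm (S (2 * s)) \<le> C * real (Q ^ s)"
    using S_even_bound by blast
  have wi: "norm (w i) \<le> sqrt (real Q)" if i: "i < n" for i
  proof -
    \<comment> \<open>Sums over even degrees are power sums of the squares of the
      \<open>w i\<close>, so the growth argument is applied to these squares.\<close>
    have "norm (w i ^ 2) \<le> real Q"
    proof (rule power_sum_growth[where z = "\<lambda>i. w i ^ 2" and n = n and m = "max s0 1" and C = C])
      fix s assume s: "s \<ge> max s0 1"
      have "(\<Sum>i<n. (w i ^ 2) ^ s) = - S (2 * s)"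
        using w[of "2 * s"] s by (simp add: power_mult)
      then show "norm (\<Sum>i<n. (w i ^ 2) ^ s) \<le> C * real Q ^ s"
        using C[of s] s by simp
    qed (use Q1 i in auto)
    then show ?thesis
      by (simp add: norm_power real_le_rsqrt)
  qed
  have "norm (S 1) = norm (\<Sum>i<n. w i)"
    using w[of 1] by simp
  also have "\<dots> \<le> (\<Sum>i<n. sqrt (real Q))"
    by (rule sum_norm_le) (use wi in auto)
  also have "\<dots> = real n * sqrt (real Q)"
    by simp
  also have "\<dots> \<le> real (nroots + 1) * sqrt (real Q)"
    using n by (intro mult_right_mono) auto
  finally show ?thesis .
qed

end

context weil
begin

text \<open>The zero at 0 is split off because an exceptional function may contain any power of
  \<open>x\<close>. Orders are invariant under Frobenius, so the \<open>k\<close>-th root of the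
  remaining part is defined over the base field.\<close>

lemma power_descent:
  assumes f: "rat f" "f \<noteq> 0" and k: "\<And>\<rho>. \<rho> \<noteq> 0 \<Longrightarrow> k dvd order \<rho> f"
  obtains h where "rat h" "f = smult (lead_coeff f) ([:0, 1:] ^ order 0 f * h ^ k)"
proof
  define e where "e = (\<lambda>\<rho>. if \<rho> = 0 then 0 else order \<rho> f div k)"
  define h where "h = (\<Prod>\<rho> | poly f \<rho> = 0. [:-\<rho>, 1:] ^ e \<rho>)"
  show "rat h"
    unfolding h_def using rat_roots(2)[OF f] Q1 by (intro rat_prod_roots f) (simp add: e_def)
  have fin: "finite {\<rho>. poly f \<rho> = 0}"
    using f by (intro poly_roots_finite)
  have "[:0, 1:] ^ order 0 f * h ^ k = (\<Prod>\<rho> | poly f \<rho> = 0. [:-\<rho>, 1:] ^ order \<rho> f)"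
  proof -
    have "(\<Prod>\<rho> | poly f \<rho> = 0. [:-\<rho>, 1:] ^ order \<rho> f) =
        (\<Prod>\<rho> | poly f \<rho> = 0. (if \<rho> = 0 then [:0, 1:] ^ order 0 f else 1) * ([:-\<rho>, 1:] ^ e \<rho>) ^ k)"
      using k by (intro prod.cong refl) (auto simp: e_def simp flip: power_mult)
    also have "\<dots> = (\<Prod>\<rho> | poly f \<rho> = 0. if \<rho> = 0 then [:0, 1:] ^ order 0 f else 1) * h ^ k"
      by (simp add: prod.distrib h_def prod_power_distrib)
    also have "(\<Prod>\<rho> | poly f \<rho> = 0. if \<rho> = 0 then [:0, 1:] ^ order 0 f else 1) = [:0, 1:] ^ order 0 f"
      using fin by (cases "poly f 0 = 0") (auto simp: order_0I)
    finally show ?thesis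
      by simp
  qed
  then show "f = smult (lead_coeff f) ([:0, 1:] ^ order 0 f * h ^ k)"
    using poly_eq_prod_roots[OF f(2)] by simp
qed

end

section \<open>Characters of a finite field\<close>

lemma finite_field_power_card_minus_1:
  fixes x :: "'a::{field,finite}"
  assumes "x \<noteq> 0"
  shows "x ^ (CARD('a) - 1) = 1"
proof -
  have "(\<Prod>y\<in>UNIV - {0}. y) = (\<Prod>y\<in>UNIV - {0}. x * y)"
    using assms by (intro prod.reindex_bij_witness[of _ "\<lambda>y. x * y" "\<lambda>y. y / x"]) auto
  also have "\<dots> = x ^ (CARD('a) - 1) * (\<Prod>y\<in>UNIV - {0}. y)"
    by (simp add: prod.distrib card_Diff_singleton)
  finally show ?thesis
    by simp
qed

lemma finite_field_power_card:
  fixes x :: "'a::{field,finite}"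
  shows "x ^ CARD('a) = x"
proof (cases "x = 0")
  case False
  have "x ^ CARD('a) = x * x ^ (CARD('a) - 1)"
    by (simp flip: power_Suc)
  with finite_field_power_card_minus_1[OF False] show ?thesis
    by simp
qed simp

lemma finite_field_generator:
  obtains w :: "'a::{field,finite}" where "w \<noteq> 0" "\<And>x. x \<noteq> 0 \<Longrightarrow> \<exists>i::nat. x = w ^ i"
proof -
  define R where "R = (ring_of_type_algebra :: 'a ring)"
  interpret R: field R
    unfolding R_def by (rule field_from_type_algebra)
  have carrier: "carrier R = UNIV" and zero: "\<zero>\<^bsub>R\<^esub> = 0"
    by (simp_all add: R_def ring_of_type_algebra_def)
  have pow: "w [^]\<^bsub>R\<^esub> i = w ^ i" for w and i :: nat
  proof (induction i)
    case 0
    show ?case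
      by (simp add: R_def ring_of_type_algebra_def)
  next
    case (Suc i)
    then show ?case
      by (simp add: R_def ring_of_type_algebra_def mult.commute)
  qed
  have "finite (carrier R)"
    by (simp add: carrier)
  then obtain w where w: "w \<in> carrier (mult_of R)"
      "carrier (mult_of R) = {w [^]\<^bsub>R\<^esub> i | i::nat. i \<in> UNIV}"
    using R.finite_field_mult_group_has_gen by (auto simp: nat_pow_mult_of)
  show ?thesis
  proof
    show "w \<noteq> 0"
      using w(1) by (simp add: carrier zero)
    fix x :: 'a assume "x \<noteq> 0"
    then have "x \<in> carrier (mult_of R)"
      by (simp add: carrier zero)
    then show "\<exists>i::nat. x = w ^ i"
      unfolding w(2) pow by blast
  qed
qed

lemma cis_2pi_eq_1:
  assumes "cis (2 * pi * t) = 1"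
  obtains k :: int where "t = of_int k"
proof -
  have "cos (2 * pi * t) = 1"
    using assms by (simp add: complex_eq_iff)
  then obtain k :: int where "2 * pi * t = of_int k * 2 * pi"
    unfolding cos_one_2pi_int by blast
  then show ?thesis
    by (intro that[of k]) simp
qed

lemma poly_bezout:
  fixes f g :: "'a::field poly"
  assumes "coprime f g"
  obtains u v where "u * f + v * g = 1"
proof -
  define I where "I = {u * f + v * g | u v. True}"
  have "f \<noteq> 0 \<or> g \<noteq> 0"
    using assms by auto
  moreover have f: "f \<in> I"
    unfolding I_def by (intro CollectI exI[of _ 1] exI[of _ 0]) simp
  moreover have g: "g \<in> I"
    unfolding I_def by (rule CollectI, rule exI[of _ 0], rule exI[of _ 1]) simp
  ultimately have "\<exists>h. h \<in> I \<and> h \<noteq> 0"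
    by blast
  then obtain h where h: "h \<in> I" "h \<noteq> 0" and min: "\<And>h'. h' \<in> I \<Longrightarrow> h' \<noteq> 0 \<Longrightarrow> degree h \<le> degree h'"
    using ex_has_least_nat[of "\<lambda>h. h \<in> I \<and> h \<noteq> 0" _ degree] by blast
  have dvd: "h dvd k" if k: "k \<in> I" for k
  proof (rule ccontr)
    assume "\<not> h dvd k"
    then have nz: "k mod h \<noteq> 0"
      by (simp add: dvd_eq_mod_eq_0)
    obtain u v u' v' where uv: "h = u * f + v * g" "k = u' * f + v' * g"
      using h(1) k by (auto simp: I_def)
    have *: "(u' * f + v' * g) - q * (u * f + v * g) = (u' - q * u) * f + (v' - q * v) * g" for q
      by (simp add: algebra_simps)
    have "k mod h = k - (k div h) * h"
      by (simp add: minus_div_mult_eq_mod)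
    also have "\<dots> = (u' - (k div h) * u) * f + (v' - (k div h) * v) * g"
      by (rule *[of "k div h", folded uv])
    finally have "k mod h \<in> I"
      unfolding I_def by blast
    with min[OF this nz] degree_mod_less[OF h(2), of k] nz show False
      by auto
  qed
  have "h dvd 1"
    using coprime_common_divisor[OF assms dvd[OF f] dvd[OF g]] .
  then obtain k where k: "1 = h * k"
    by (elim dvdE)
  obtain u v where uv: "h = u * f + v * g"
    using h(1) by (auto simp: I_def)
  have "(k * u) * f + (k * v) * g = (u * f + v * g) * k"
    by (simp add: algebra_simps)
  then have "(k * u) * f + (k * v) * g = 1"
    by (simp only: uv[symmetric] k[symmetric])
  then show ?thesis
    by (rule that)
qed

locale finfield =
  fixes \<kappa> :: nat and w :: "'a::{field,finite}"
  assumes card: "CARD('a) = CHAR('a) ^ \<kappa>" "\<kappa> > 0"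
    and w: "w \<noteq> 0" "\<And>x. x \<noteq> 0 \<Longrightarrow> \<exists>i::nat. x = w ^ i"
begin

definition "p = CHAR('a)"
definition "Q = CARD('a)"
definition "n = Q - 1"

lemma p: "prime p"
proof -
  have "CHAR('a) > 0"
    by (rule finite_imp_CHAR_pos) simp
  then show ?thesis
    using prime_CHAR_semidom unfolding p_def by blast
qed

lemma Q: "Q = p ^ \<kappa>"
  by (simp add: Q_def p_def card)

lemma p1: "p > 1"
  using p prime_gt_1_nat by blast

lemma Q1: "Q > 1"
  unfolding Q using card(2) p1 one_less_power by blast

lemma n: "n > 0" "Q = Suc n"
  using Q1 by (simp_all add: n_def)

lemma pow_Q: "(x :: 'a) ^ Q = x"
  unfolding Q_def by (rule finite_field_power_card)

lemma pow_n: "(x :: 'a) \<noteq> 0 \<Longrightarrow> x ^ n = 1"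
  unfolding n_def Q_def by (rule finite_field_power_card_minus_1)

lemma w_mod: "w ^ i = w ^ (i mod n)"
proof -
  have "w ^ i = w ^ (n * (i div n) + i mod n)"
    by simp
  then show ?thesis
    by (simp only: power_add power_mult pow_n[OF w(1)]) simp
qed

lemma w_pow_1: "w ^ i = 1 \<longleftrightarrow> n dvd i"
proof
  assume 1: "w ^ i = 1"
  define r where "r = i mod n"
  have r: "w ^ r = 1"
    using 1 w_mod[of i] by (simp add: r_def)
  show "n dvd i"
  proof (rule ccontr)
    assume "\<not> n dvd i"
    then have r0: "r > 0"
      by (simp add: r_def mod_greater_zero_iff_not_dvd)
    have "UNIV - {0} \<subseteq> (\<lambda>j. w ^ j) ` {..<r}"
    proof
      fix x :: 'a assume "x \<in> UNIV - {0}"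
      then obtain j where j: "x = w ^ j"
        using w(2) by blast
      have "w ^ j = w ^ (r * (j div r) + j mod r)"
        by simp
      also have "\<dots> = w ^ (j mod r)"
        by (simp only: power_add power_mult r) simp
      finally show "x \<in> (\<lambda>j. w ^ j) ` {..<r}"
        using j r0 by auto
    qed
    then have "card (UNIV - {0 :: 'a}) \<le> card ((\<lambda>j. w ^ j) ` {..<r})"
      by (intro card_mono) auto
    also have "\<dots> \<le> r"
      using card_image_le[of "{..<r}"] by simp
    finally have "n \<le> r"
      by (simp add: card_Diff_singleton n_def Q_def)
    then show False
      using mod_less_divisor[OF n(1), of i] unfolding r_def by linarith
  qed
qed (auto simp: power_mult pow_n[OF w(1)] elim!: dvdE)

lemma w_pow_inject: "w ^ i = w ^ j \<longleftrightarrow> [i = j] (mod n)"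
proof -
  have "w ^ i = w ^ j \<longleftrightarrow> i mod n = j mod n" if "i \<le> j" for i j
  proof -
    have "w ^ i = w ^ j \<longleftrightarrow> w ^ (j - i) = 1"
      using w(1) that by (subst le_add_diff_inverse[OF that, symmetric], subst power_add) auto
    also have "\<dots> \<longleftrightarrow> i mod n = j mod n"
      using mod_eq_dvd_iff_nat[OF that, of n] by (auto simp: w_pow_1)
    finally show ?thesis .
  qed
  then show ?thesis
    unfolding unique_euclidean_semiring_class.cong_def by (metis linorder_linear)
qed

text \<open>A generator of the group of multiplicative characters; the others occur as its
  powers.\<close>

definition ch :: "'a \<Rightarrow> complex" where
  "ch x = cis (2 * pi * real (SOME i. x = w ^ i) / real n)"

lemma cis_cong: "[i = j] (mod n) \<Longrightarrow> cis (2 * pi * real i / real n) = cis (2 * pi * real j / real n)"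
proof -
  have "cis (2 * pi * real k / real n) = cis (2 * pi * real (k mod n) / real n)" for k
  proof -
    have "real k = real n * real (k div n) + real (k mod n)"
      by (metis mult_div_mod_eq of_nat_add of_nat_mult)
    then have "2 * pi * real k / real n = 2 * pi * real (k div n) + 2 * pi * real (k mod n) / real n"
      using n(1) by (simp add: field_simps)
    then show ?thesis
      by (simp add: cis_mult[symmetric] cis_multiple_2pi)
  qed
  then show "[i = j] (mod n) \<Longrightarrow> ?thesis"
    unfolding unique_euclidean_semiring_class.cong_def by metis
qed

lemma ch_w: "ch (w ^ i) = cis (2 * pi * real i / real n)"
proof -
  have "w ^ i = w ^ (SOME j. w ^ i = w ^ j)"
    by (rule someI[of _ i]) simp
  then show ?thesis
    unfolding ch_def by (intro cis_cong) (simp add: w_pow_inject cong_sym_eq)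
qed

lemma ch_mult: "x \<noteq> 0 \<Longrightarrow> y \<noteq> 0 \<Longrightarrow> ch (x * y) = ch x * ch y"
proof -
  assume "x \<noteq> 0" "y \<noteq> 0"
  then obtain i j where "x = w ^ i" "y = w ^ j"
    using w(2) by metis
  then show ?thesis
    by (simp add: ch_w cis_mult add_divide_distrib distrib_left flip: power_add)
qed

lemma norm_ch: "norm (ch x) = 1"
  by (simp add: ch_def)

lemma ch_1: "ch 1 = 1"
  using ch_w[of 0] by simp

lemma ch_power: "x \<noteq> 0 \<Longrightarrow> ch (x ^ i) = ch x ^ i"
  by (induction i) (simp_all add: ch_1 ch_mult)

lemma ch_eq_1_iff: "x \<noteq> 0 \<Longrightarrow> ch x = 1 \<longleftrightarrow> x = 1"
proof -
  assume "x \<noteq> 0"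
  then obtain i where i: "x = w ^ i"
    using w(2) by metis
  have eq: "x = w ^ (i mod n)"
    using i w_mod by simp
  show ?thesis
  proof
    assume "ch x = 1"
    then have "cis (2 * pi * (real (i mod n) / real n)) = 1"
      unfolding eq ch_w by simp
    then obtain k :: int where "real (i mod n) / real n = of_int k"
      by (rule cis_2pi_eq_1)
    moreover have "0 \<le> real (i mod n) / real n" "real (i mod n) / real n < 1"
      using n(1) by simp_all
    ultimately have "real (i mod n) / real n = 0"
      by force
    then show "x = 1"
      using n(1) by (simp add: eq)
  qed (simp add: ch_1)
qed

lemma ch_pow_n: "x \<noteq> 0 \<Longrightarrow> ch x ^ n = 1"
  using ch_power[of x n] by (simp add: pow_n ch_1)

definition Ep :: "'a \<Rightarrow> complex" where
  "Ep t = cis (2 * pi * real (SOME j. t = of_nat j) / real p)"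

lemma Ep_of_nat: "Ep (of_nat j) = cis (2 * pi * real j / real p)"
proof -
  define k where "k = (SOME k. (of_nat j :: 'a) = of_nat k)"
  have "(of_nat j :: 'a) = of_nat k"
    unfolding k_def by (rule someI[of _ j]) simp
  then have jk: "j mod p = k mod p"
    by (simp add: of_nat_eq_iff_cong_CHAR unique_euclidean_semiring_class.cong_def p_def)
  have "cis (2 * pi * real k / real p) = cis (2 * pi * real (k mod p) / real p)" for k
  proof -
    have "real k = real p * real (k div p) + real (k mod p)"
      by (metis mult_div_mod_eq of_nat_add of_nat_mult)
    then have "2 * pi * real k / real p = 2 * pi * real (k div p) + 2 * pi * real (k mod p) / real p"
      using p1 by (simp add: field_simps)
    then show ?thesis
      by (simp add: cis_mult[symmetric] cis_multiple_2pi)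
  qed
  then show ?thesis
    using jk unfolding Ep_def k_def[symmetric] by metis
qed

lemma Ep_nontrivial: "Ep 1 \<noteq> 1"
proof
  assume "Ep 1 = 1"
  then have "cis (2 * pi * (1 / real p)) = 1"
    using Ep_of_nat[of 1] by simp
  then obtain k :: int where "1 / real p = of_int k"
    by (rule cis_2pi_eq_1)
  moreover have "0 < 1 / real p" "1 / real p < 1"
    using p1 by simp_all
  ultimately show False
    by force
qed

lemma norm_Ep: "norm (Ep t) = 1"
  by (simp add: Ep_def)

definition tr :: "'a \<Rightarrow> 'a" where "tr v = (\<Sum>i<\<kappa>. v ^ (p ^ i))"

text \<open>The canonical additive character; the others are \<open>\<psi> (c * x)\<close> for
  constants \<open>c\<close>.\<close>

definition \<psi> :: "'a \<Rightarrow> complex" where "\<psi> v = Ep (tr v)"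

lemma prime_char_a: "prime CHAR('a)" "CHAR('a) = p"
  using p by (simp_all add: p_def)

lemma pow_p_add: "((u :: 'a) + v) ^ (p ^ i) = u ^ (p ^ i) + v ^ (p ^ i)"
  using char_power_add[OF prime_char_a(1), of u v i] by (simp add: p_def)

lemma pow_p_sum: "(\<Sum>i\<in>A. f i :: 'a) ^ (p ^ j) = (\<Sum>i\<in>A. f i ^ (p ^ j))"
  using char_power_sum[OF prime_char_a(1), of f A j] by (simp add: p_def)

lemma tr_add: "tr (u + v) = tr u + tr v"
  by (simp add: tr_def pow_p_add sum.distrib)

lemma pow_p_tr: "tr v ^ p = tr v"
proof -
  have "tr v ^ p = (\<Sum>i<\<kappa>. v ^ (p ^ Suc i))"
    unfolding tr_def using pow_p_sum[of "\<lambda>i. v ^ (p ^ i)" "{..<\<kappa>}" 1]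
    by (simp add: mult.commute flip: power_mult)
  moreover have "(\<Sum>i<\<kappa>. v ^ (p ^ Suc i) - v ^ (p ^ i)) = v ^ (p ^ \<kappa>) - v ^ (p ^ 0)"
    by (rule sum_lessThan_telescope)
  ultimately show ?thesis
    using pow_Q[of v] by (simp add: Q[symmetric] sum_subtractf tr_def)
qed

lemma prime_field: 
  assumes "(t :: 'a) ^ p = t"
  obtains j where "t = of_nat j"
proof -
  define f :: "'a poly" where "f = monom 1 p - monom 1 1"
  have deg: "degree f = p"
    unfolding f_def diff_conv_add_uminus using p1
    by (subst degree_add_eq_left) (auto simp: degree_monom_eq)
  have f0: "f \<noteq> 0"
    using deg p1 by auto
  have roots: "{x. poly f x = 0} = {t. t ^ p = t}"
    by (auto simp: f_def poly_monom)
  have inj: "inj_on (of_nat :: nat \<Rightarrow> 'a) {..<p}"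
    by (auto simp: inj_on_def of_nat_eq_iff_cong_CHAR unique_euclidean_semiring_class.cong_def p_def)
  have "(of_nat j :: 'a) ^ p = of_nat j" for j
  proof (induction j)
    case (Suc j)
    then show ?case
      using pow_p_add[of 1 "of_nat j" 1] by simp
  qed (use p1 in simp)
  then have "of_nat ` {..<p} = {t :: 'a. t ^ p = t}"
    using card_poly_roots_bound[OF f0] roots deg card_image[OF inj] by (intro card_seteq) auto
  with assms that show ?thesis
    by blast
qed

lemma Ep_add: "t ^ p = t \<Longrightarrow> u ^ p = u \<Longrightarrow> Ep (t + u) = Ep t * Ep u"
proof -
  assume "t ^ p = t" "u ^ p = u"
  then obtain i j where ij: "t = of_nat i" "u = of_nat j"
    using prime_field by metis
  show ?thesis
    unfolding ij of_nat_add[symmetric] Ep_of_nat by (simp add: cis_mult add_divide_distrib distrib_left)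
qed

lemma \<psi>_add: "\<psi> (u + v) = \<psi> u * \<psi> v"
  by (simp add: \<psi>_def tr_add Ep_add pow_p_tr)

lemma norm_\<psi>: "norm (\<psi> v) = 1"
  by (simp add: \<psi>_def norm_Ep)

lemma \<psi>_0: "\<psi> 0 = 1"
proof -
  have "\<psi> 0 = \<psi> 0 * \<psi> 0" "\<psi> 0 \<noteq> 0"
    using \<psi>_add[of 0 0] norm_\<psi>[of 0] by auto
  then show ?thesis
    by simp
qed

section \<open>Transfer of the Weil bound to the finite field\<close>

lemma to_ac_range: "range (to_ac :: 'a \<Rightarrow> _) = {x. x ^ Q = x}"
proof (rule card_seteq)
  have "prime CHAR('a alg_closure)"
    using p by (simp add: p_def)
  have "Q > 1"
    by (rule Q1)
  define f :: "'a alg_closure poly" where "f = monom 1 Q - monom 1 1"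
  have deg: "degree f = Q"
    unfolding f_def diff_conv_add_uminus using Q1
    by (subst degree_add_eq_left) (auto simp: degree_monom_eq)
  have f0: "f \<noteq> 0"
    using deg Q1 by auto
  have roots: "{x. poly f x = 0} = {x. x ^ Q = x}"
    by (auto simp: f_def poly_monom)
  show "finite {x :: 'a alg_closure. x ^ Q = x}"
    using poly_roots_finite[OF f0] roots by simp
  show "card {x :: 'a alg_closure. x ^ Q = x} \<le> card (range (to_ac :: 'a \<Rightarrow> _))"
    using card_poly_roots_bound[OF f0] roots deg by (simp add: card_image inj_to_ac Q_def)
  show "range (to_ac :: 'a \<Rightarrow> _) \<subseteq> {x. x ^ Q = x}"
    by (auto simp: pow_Q simp flip: to_ac_power)
qed

text \<open>The characters are carried to the closure by \<open>of_ac\<close>. The locale constrains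
  them only on fixed points of Frobenius, where \<open>of_ac\<close> inverts \<open>to_ac\<close>.
  In the multiplicative case the generator \<open>w\<close> is the witness, as \<open>ch\<close> is
  faithful.\<close>

lemma weil_instance:
  assumes "G \<noteq> 0" "poly G 0 = 0"
    and "\<beta> \<noteq> 0 \<or> \<beta> = 0 \<and> \<gamma> = 0 \<and> (\<exists>\<rho>. \<not> n dvd order \<rho> (map_poly to_ac G))"
  shows "weil p Q \<kappa> (map_poly to_ac G) (to_ac \<beta>) (to_ac \<gamma>) (\<lambda>x. ch (of_ac x)) (\<lambda>x. Ep (of_ac x))"
proof
  have lift: "\<exists>y. x = to_ac y" if "x ^ Q = x" for x :: "'a alg_closure"
    using that to_ac_range by blast
  have lift_p: "\<exists>y. x = to_ac y \<and> y ^ p = y" if x: "x ^ p = x" for x :: "'a alg_closure"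
  proof -
    have "x ^ (p ^ k) = x" for k
      by (induction k) (simp_all add: x power_mult)
    then obtain y where y: "x = to_ac y"
      using lift Q by metis
    with x have "y ^ p = y"
      by (simp flip: to_ac_power)
    with y show ?thesis
      by blast
  qed
  show "map_poly to_ac G \<noteq> 0"
    using assms(1) by (simp add: map_poly_eq_0_iff)
  show "poly (map_poly to_ac G) 0 = 0"
    using assms(2) by (simp add: poly_0_coeff_0 coeff_map_poly)
  show "coeff (map_poly to_ac G) i ^ Q = coeff (map_poly to_ac G) i" for i
    by (simp add: coeff_map_poly pow_Q flip: to_ac_power)
  show "ch (of_ac (u * v)) = ch (of_ac u) * ch (of_ac v)"
    if uv: "u ^ Q = u" "v ^ Q = v" "u \<noteq> 0" "v \<noteq> 0" for u v :: "'a alg_closure"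
  proof -
    obtain u' v' where "u = to_ac u'" "v = to_ac v'"
      using lift uv by metis
    with uv show ?thesis
      by (simp add: ch_mult flip: to_ac_mult)
  qed
  show "Ep (of_ac (u + v)) = Ep (of_ac u) * Ep (of_ac v)"
    if uv: "u ^ p = u" "v ^ p = v" for u v :: "'a alg_closure"
  proof -
    obtain u' v' where "u = to_ac u'" "v = to_ac v'" "u' ^ p = u'" "v' ^ p = v'"
      using lift_p uv by metis
    then show ?thesis
      by (simp add: Ep_add flip: to_ac_add)
  qed
  show "to_ac \<beta> \<noteq> 0 \<and> (\<exists>t :: 'a alg_closure. t ^ p = t \<and> Ep (of_ac t) \<noteq> 1) \<or>
    to_ac \<beta> = 0 \<and> to_ac \<gamma> = 0 \<and> (\<exists>\<rho> x. poly (map_poly to_ac G) \<rho> = 0 \<and> x ^ Q = x \<and> x \<noteq> 0 \<and>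
      ch (of_ac (x ^ order \<rho> (map_poly to_ac G))) \<noteq> 1)"
  proof (cases "\<beta> = 0")
    case False
    then show ?thesis
      using Ep_nontrivial by (intro disjI1 conjI exI[of _ 1]) auto
  next
    case True
    then obtain \<rho> where \<rho>: "\<gamma> = 0" "\<not> n dvd order \<rho> (map_poly to_ac G)"
      using assms(3) by blast
    then have "poly (map_poly to_ac G) \<rho> = 0"
      by (metis dvd_0_right order_0I)
    moreover have "ch (w ^ order \<rho> (map_poly to_ac G)) \<noteq> 1"
      using \<rho> w by (simp add: ch_eq_1_iff w_pow_1)
    ultimately show ?thesis
      using True \<rho>(1) w(1) by (intro disjI2 conjI exI[of _ \<rho>] exI[of _ "to_ac w"])
        (auto simp: pow_Q simp flip: to_ac_power)
  qed
  show "to_ac \<beta> ^ Q = to_ac \<beta>" "to_ac \<gamma> ^ Q = to_ac \<gamma>"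
    by (simp_all add: pow_Q flip: to_ac_power)
  show "p = CHAR('a alg_closure)"
    by (simp add: p_def)
qed (use p Q card in \<open>simp_all add: norm_ch norm_Ep\<close>)

lemma poly_map_to_ac: "poly (map_poly to_ac f) (to_ac x) = to_ac (poly f x)"
  by (induction f) (auto simp: map_poly_pCons)

lemma char_sum_bound_additive:
  assumes "G \<noteq> 0" "poly G 0 = 0"
    and "\<beta> \<noteq> 0 \<or> \<beta> = 0 \<and> \<gamma> = 0 \<and> (\<exists>\<rho>. \<not> n dvd order \<rho> (map_poly to_ac G))"
  shows "norm (\<Sum>x | poly G x \<noteq> 0. ch (poly G x) * \<psi> (\<beta> * x + \<gamma> / x)) \<le>
    real (card {\<rho>. poly (map_poly to_ac G) \<rho> = 0} + 1) * sqrt (real Q)"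
proof -
  interpret W: weil p Q \<kappa> "map_poly to_ac G" "to_ac \<beta>" "to_ac \<gamma>" "\<lambda>x. ch (of_ac x)" "\<lambda>x. Ep (of_ac x)"
    by (rule weil_instance[OF assms])
  have "W.S 1 = (\<Sum>x\<in>to_ac ` {x. poly G x \<noteq> 0}.
      ch (of_ac (poly (map_poly to_ac G) x)) * Ep (of_ac (\<Sum>i<\<kappa>. W.hh x ^ (p ^ i))))"
  proof -
    have "{x. x \<in> W.Fr 1 \<and> poly (map_poly to_ac G) x \<noteq> 0} = to_ac ` {x. poly G x \<noteq> 0}"
    proof -
      have "W.Fr 1 = range to_ac"
        by (simp add: to_ac_range W.Fr_def)
      then show ?thesis
        by (auto simp: poly_map_to_ac)
    qed
    then show ?thesis
      using Q1 by (simp add: W.S_def)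
  qed
  also have "\<dots> = (\<Sum>x | poly G x \<noteq> 0. ch (poly G x) * \<psi> (\<beta> * x + \<gamma> / x))"
  proof (subst sum.reindex)
    show "inj_on to_ac {x. poly G x \<noteq> 0}"
      using inj_to_ac by (rule inj_on_subset) auto
    have "(\<Sum>i<\<kappa>. W.hh (to_ac x) ^ (p ^ i)) = to_ac (tr (\<beta> * x + \<gamma> / x))" for x
      by (simp add: W.hh_def tr_def to_ac_sum)
    then show "sum ((\<lambda>x. ch (of_ac (poly (map_poly to_ac G) x)) * Ep (of_ac (\<Sum>i<\<kappa>. W.hh x ^ (p ^ i)))) \<circ> to_ac)
        {x. poly G x \<noteq> 0} = (\<Sum>x | poly G x \<noteq> 0. ch (poly G x) * \<psi> (\<beta> * x + \<gamma> / x))"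
      by (simp add: poly_map_to_ac \<psi>_def)
  qed
  finally show ?thesis
    using W.weil_bound by (simp add: W.nroots_def)
qed

lemma map_to_ac_mult: "map_poly to_ac (f * g) = map_poly to_ac f * map_poly to_ac g"
  by (rule poly_eqI) (simp add: coeff_map_poly coeff_mult to_ac_sum)

lemma map_to_ac_power: "map_poly to_ac (f ^ k) = map_poly to_ac f ^ k"
  by (induction k) (simp_all add: map_to_ac_mult)

lemma map_to_ac_add: "map_poly to_ac (f + g) = map_poly to_ac f + map_poly to_ac g"
  by (rule poly_eqI) (simp add: coeff_map_poly)

lemma map_to_ac_inject: "map_poly to_ac f = map_poly to_ac g \<longleftrightarrow> f = g"
  by (auto simp: poly_eq_iff coeff_map_poly)

lemma map_to_ac_0: "map_poly to_ac f = 0 \<longleftrightarrow> f = 0"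
  by (simp add: map_poly_eq_0_iff)

lemma degree_map_to_ac: "degree (map_poly to_ac f) = degree f"
  by (simp add: degree_map_poly)

lemma map_to_ac_X: "map_poly to_ac [:0, 1:] = [:0, 1:]"
  by (simp add: map_poly_pCons)

text \<open>The new case has a pole at 0 only; the substitution of \<open>1 / x\<close> turns it
  into a pole at infinity.\<close>

theorem char_sum_bound:
  assumes G: "G \<noteq> 0" "poly G 0 = 0"
    and nontriv: "\<beta> \<noteq> 0 \<or> \<gamma> \<noteq> 0 \<or> (\<exists>\<rho>. \<not> n dvd order \<rho> (map_poly to_ac G))"
  shows "norm (\<Sum>x | poly G x \<noteq> 0. ch (poly G x) * \<psi> (\<beta> * x + \<gamma> / x)) \<le>
    real (card {\<rho>. poly (map_poly to_ac G) \<rho> = 0} + 1) * sqrt (real Q)"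
proof (cases "\<beta> = 0 \<and> \<gamma> \<noteq> 0")
  case False
  then show ?thesis
    using nontriv by (intro char_sum_bound_additive G) auto
next
  case True
  \<comment> \<open>The reflection contributes \<open>x ^ degree G\<close>, so the total power of
    \<open>x\<close> is \<open>n * (degree G + 1)\<close> and \<open>H x = G (1 / x)\<close> for
    nonzero \<open>x\<close>. The summand \<open>n\<close> in the exponent makes \<open>H\<close>
    vanish at 0.\<close>
  define H where "H = [:0, 1:] ^ ((n - 1) * degree G + n) * reflect_poly G"
  have H: "H \<noteq> 0" "poly H 0 = 0"
    using G n(1) by (simp_all add: H_def)
  have poly_H: "poly H x = poly G (inverse x)" if x: "x \<noteq> 0" for x
  proof -
    obtain m where "n = Suc m"
      using n(1) gr0_implies_Suc by blast
    then have "(n - 1) * degree G + n + degree G = n * (degree G + 1)"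
      by simp
    then have "x ^ ((n - 1) * degree G + n) * x ^ degree G = 1"
      using pow_n[OF x] by (simp only: power_add[symmetric] power_mult) simp
    then show ?thesis
      using x by (simp add: H_def poly_reflect_poly_nz mult.assoc[symmetric])
  qed
  have nz: "x \<noteq> 0" if "poly G x \<noteq> 0 \<or> poly H x \<noteq> 0" for x
    using that G H by auto
  have "(\<Sum>x | poly G x \<noteq> 0. ch (poly G x) * \<psi> (\<beta> * x + \<gamma> / x)) =
      (\<Sum>x | poly H x \<noteq> 0. ch (poly H x) * \<psi> (\<gamma> * x + 0 / x))"
  proof (rule sum.reindex_bij_witness[of _ inverse inverse])
    fix x assume x: "x \<in> {x. poly G x \<noteq> 0}"
    then have "x \<noteq> 0"
      using nz[of x] by simp
    then show "inverse x \<in> {x. poly H x \<noteq> 0}"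
      "ch (poly H (inverse x)) * \<psi> (\<gamma> * inverse x + 0 / inverse x) = ch (poly G x) * \<psi> (\<beta> * x + \<gamma> / x)"
      using x True poly_H[of "inverse x"] by (simp_all add: divide_inverse)
  next
    fix x assume x: "x \<in> {x. poly H x \<noteq> 0}"
    then have "x \<noteq> 0"
      using nz[of x] by simp
    then show "inverse x \<in> {x. poly G x \<noteq> 0}"
      using x poly_H[of x] by simp
  qed auto
  also have "norm \<dots> \<le> real (card {\<rho>. poly (map_poly to_ac H) \<rho> = 0} + 1) * sqrt (real Q)"
    using True by (intro char_sum_bound_additive H) auto
  also have "\<dots> \<le> real (card {\<rho>. poly (map_poly to_ac G) \<rho> = 0} + 1) * sqrt (real Q)"
  proof -
    have refl: "map_poly to_ac (reflect_poly G) = reflect_poly (map_poly to_ac G)"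
      by (rule poly_eqI) (simp add: coeff_map_poly coeff_reflect_poly degree_map_to_ac)
    have "inverse ` {\<rho>. poly (map_poly to_ac H) \<rho> = 0} \<subseteq> {\<rho>. poly (map_poly to_ac G) \<rho> = 0}"
    proof (clarify)
      fix \<rho> assume "poly (map_poly to_ac H) \<rho> = 0"
      then show "poly (map_poly to_ac G) (inverse \<rho>) = 0"
      proof (cases "\<rho> = 0")
        case True
        then show ?thesis
          using G(2) poly_map_to_ac[of G 0] by simp
      next
        case False
        with \<open>poly (map_poly to_ac H) \<rho> = 0\<close> show ?thesis
          by (simp add: H_def map_to_ac_mult map_to_ac_power map_to_ac_X refl poly_reflect_poly_nz)
      qed
    qed
    moreover have "finite {\<rho>. poly (map_poly to_ac G) \<rho> = 0}"
      using G by (intro poly_roots_finite) (simp add: map_to_ac_0)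
    ultimately have "card {\<rho>. poly (map_poly to_ac H) \<rho> = 0} \<le> card {\<rho>. poly (map_poly to_ac G) \<rho> = 0}"
      by (intro card_inj_on_le[of inverse]) (auto simp: inj_on_def)
    then show ?thesis
      by (intro mult_right_mono) auto
  qed
  finally show ?thesis .
qed

section \<open>Character sums of rational functions\<close>

lemma power_descent_a:
  fixes f :: "'a poly"
  assumes f: "f \<noteq> 0" and k: "\<And>\<rho>. \<rho> \<noteq> 0 \<Longrightarrow> k dvd order \<rho> (map_poly to_ac f)"
  obtains c j h where "f = smult c ([:0, 1:] ^ j * h ^ k)"
proof -
  \<comment> \<open>The sum for \<open>G = X\<close> and \<open>\<beta> = 1\<close> is an arbitrary
    admissible instance; \<open>W.rat\<close> and \<open>W.power_descent\<close> concern only the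
    Frobenius action.\<close>
  interpret W: weil p Q \<kappa> "map_poly to_ac [:0, 1:]" "to_ac 1" "to_ac 0" "\<lambda>x. ch (of_ac x)" "\<lambda>x. Ep (of_ac x)"
    by (rule weil_instance) auto
  have "W.rat (map_poly to_ac f)"
    by (simp add: W.rat_def coeff_map_poly pow_Q flip: to_ac_power)
  then obtain h where h: "W.rat h"
      "map_poly to_ac f = smult (lead_coeff (map_poly to_ac f)) ([:0, 1:] ^ order 0 (map_poly to_ac f) * h ^ k)"
    using W.power_descent[of "map_poly to_ac f" k] f k by (auto simp: map_to_ac_0)
  have "coeff h i \<in> range to_ac" for i
    using h(1) by (simp add: W.rat_def to_ac_range)
  then have "h = map_poly to_ac (map_poly of_ac h)"
    by (intro poly_eqI) (simp add: coeff_map_poly to_ac_of_ac)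
  then have "map_poly to_ac f = map_poly to_ac (smult (lead_coeff f)
      ([:0, 1:] ^ order 0 (map_poly to_ac f) * map_poly of_ac h ^ k))"
    by (subst h(2)) (simp add: map_to_ac_mult map_to_ac_power map_to_ac_X degree_map_to_ac
      coeff_map_poly map_poly_smult)
  then show ?thesis
    unfolding map_to_ac_inject by (rule that)
qed

lemma exceptionalI:
  fixes f1 f2 :: "'a poly"
  assumes f: "f1 = smult c1 ([:0, 1:] ^ j1 * h1 ^ k)" "f2 = smult c2 ([:0, 1:] ^ j2 * h2 ^ k)"
    and nz: "f1 \<noteq> 0" "f2 \<noteq> 0" and k: "k > 1" "k dvd n"
  shows "exceptional (Fract f1 f2)"
proof -
  have nz': "c1 \<noteq> 0" "c2 \<noteq> 0" "h1 \<noteq> 0" "h2 \<noteq> 0"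
    using f nz k by (auto simp: power_0_left)
  have powX: "rf_X ^ j = Fract ([:0, 1:] ^ j) 1" for j
    by (induction j) (simp_all add: rf_X_def One_fract_def)
  have powF: "Fract h1 h2 ^ k = Fract (h1 ^ k) (h2 ^ k)"
    by (induction k) (simp_all add: One_fract_def)
  have X0: "(rf_X :: 'a poly fract) \<noteq> 0"
    by (simp add: rf_X_def Zero_fract_def eq_fract)
  have "rf_const (c1 / c2) * rf_X powi (int j1 - int j2) * Fract h1 h2 ^ k =
      Fract [:c1 / c2:] 1 * (Fract ([:0, 1:] ^ j1) 1 / Fract ([:0, 1:] ^ j2) 1) * Fract (h1 ^ k) (h2 ^ k)"
    using X0 by (simp add: power_int_diff powX powF rf_const_def)
  also have "\<dots> = Fract f1 f2"
    using nz' by (simp add: f eq_fract mult_ac)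
  finally have "Fract f1 f2 = rf_const (c1 / c2) * rf_X powi (int j1 - int j2) * Fract h1 h2 ^ k" ..
  with k show ?thesis
    unfolding exceptional_def n_def Q_def by blast
qed

text \<open>All multiplicative characters are absorbed into one polynomial \<open>G\<close>, with at
  most \<open>degree f1 + degree f2 + 1\<close> distinct roots. If its orders were all divisible by
  \<open>n\<close> with \<open>b\<close> nonzero, then \<open>f1\<close> and \<open>f2\<close> would
  be, up to constants and powers of \<open>x\<close>, perfect powers for a common exponent, and
  their quotient exceptional.\<close>

theorem rational_char_sum_bound:
  assumes f: "f1 \<noteq> 0" "f2 \<noteq> 0" "coprime f1 f2" and exc: "\<not> exceptional (Fract f1 f2)"
    and ab: "a < n" "b < n" and nontriv: "a \<noteq> 0 \<or> b \<noteq> 0 \<or> \<beta> \<noteq> 0 \<or> \<gamma> \<noteq> 0"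
  shows "norm (\<Sum>x | x \<noteq> 0 \<and> poly f1 x \<noteq> 0 \<and> poly f2 x \<noteq> 0.
      ch x ^ a * ch (poly f1 x / poly f2 x) ^ b * \<psi> (\<beta> * x + \<gamma> / x))
    \<le> real (degree f1 + degree f2 + 2) * sqrt (real Q)"
proof -
  \<comment> \<open>Adding \<open>n\<close> to an exponent does not change the character but makes
    the exponent positive, so that \<open>G\<close> vanishes exactly outside the range of summation;
    \<open>n - b\<close> stands for \<open>- b\<close>.\<close>
  define G where "G = [:0, 1:] ^ (a + n) * f1 ^ (b + n) * f2 ^ ((n - b) + n)"
  have G: "G \<noteq> 0" "poly G 0 = 0"
    using f n(1) by (simp_all add: G_def)
  define F1 F2 where "F1 = map_poly to_ac f1" and "F2 = map_poly to_ac f2"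
  have F: "F1 \<noteq> 0" "F2 \<noteq> 0"
    using f by (simp_all add: F1_def F2_def map_to_ac_0)
  have mapG: "map_poly to_ac G = [:0, 1:] ^ (a + n) * F1 ^ (b + n) * F2 ^ ((n - b) + n)"
    by (simp add: G_def F1_def F2_def map_to_ac_mult map_to_ac_power map_to_ac_X)
  have G_iff: "poly G x \<noteq> 0 \<longleftrightarrow> x \<noteq> 0 \<and> poly f1 x \<noteq> 0 \<and> poly f2 x \<noteq> 0" for x
    using n(1) by (simp add: G_def)
  have chG: "ch (poly G x) = ch x ^ a * ch (poly f1 x / poly f2 x) ^ b" if "poly G x \<noteq> 0" for x
  proof -
    have nz: "x \<noteq> 0" "poly f1 x \<noteq> 0" "poly f2 x \<noteq> 0"
      using that G_iff by auto
    have "ch (poly f1 x / poly f2 x) * ch (poly f2 x) = ch (poly f1 x)"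
      using nz ch_mult[of "poly f1 x / poly f2 x" "poly f2 x"] by simp
    moreover have c0: "ch (poly f2 x) \<noteq> 0"
      using norm_ch[of "poly f2 x"] by auto
    ultimately have q: "ch (poly f1 x / poly f2 x) = ch (poly f1 x) / ch (poly f2 x)"
      by (simp add: field_simps)
    have "ch (poly f2 x) ^ (n - b) * ch (poly f2 x) ^ b = 1"
      using ab ch_pow_n[OF nz(3)] by (simp flip: power_add)
    then have "ch (poly f2 x) ^ (n - b) = 1 / ch (poly f2 x) ^ b"
      using c0 by (simp add: field_simps)
    then show ?thesis
      using nz by (simp add: G_def ch_mult ch_power power_add ch_pow_n q power_divide)
  qed
  have ord: "order \<rho> (map_poly to_ac G) = (if \<rho> = 0 then a + n else 0) + (b + n) * order \<rho> F1 + (n - b + n) * order \<rho> F2" for \<rho>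
  proof -
    have "order \<rho> ([:0, 1:] :: 'a alg_closure poly) = (if \<rho> = 0 then 1 else 0)"
      using order_power_n_n[of "0 :: 'a alg_closure" 1] by (auto simp: order_0I)
    then show ?thesis
      unfolding mapG using F by (simp add: order_mult order_power)
  qed
  have coprime: "order \<rho> F1 = 0 \<or> order \<rho> F2 = 0" for \<rho>
  proof -
    obtain u v where uv: "u * f1 + v * f2 = 1"
      using poly_bezout[OF f(3)] .
    have "map_poly to_ac u * F1 + map_poly to_ac v * F2 = 1"
      unfolding F1_def F2_def by (simp flip: map_to_ac_mult map_to_ac_add add: uv)
    then have "poly (map_poly to_ac u) \<rho> * poly F1 \<rho> + poly (map_poly to_ac v) \<rho> * poly F2 \<rho> = 1"
      by (metis poly_1 poly_add poly_mult)
    then have "poly F1 \<rho> \<noteq> 0 \<or> poly F2 \<rho> \<noteq> 0"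
      by auto
    then show ?thesis
      using order_0I[of F1 \<rho>] order_0I[of F2 \<rho>] by argo
  qed
  have nontriv': "\<beta> \<noteq> 0 \<or> \<gamma> \<noteq> 0 \<or> (\<exists>\<rho>. \<not> n dvd order \<rho> (map_poly to_ac G))"
  proof (rule ccontr)
    assume contra: "\<not> ?thesis"
    then have all: "n dvd order \<rho> (map_poly to_ac G)" for \<rho>
      by blast
    show False
    proof (cases "b = 0")
      case True
      have "order 0 (map_poly to_ac G) = a + n * (1 + order 0 F1 + 2 * order 0 F2)"
        using ord[of 0] by (simp add: True algebra_simps)
      then have "n dvd a"
        using all[of 0] by (simp add: dvd_add_left_iff)
      then show False
        using ab contra nontriv True by (auto dest: dvd_imp_le)
    next
      case False
      have dvd1: "n dvd b * order \<rho> F1" "n dvd b * order \<rho> F2" if "\<rho> \<noteq> 0" for \<rho>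
      proof -
        have "(n - b + n) * order \<rho> F2 + b * order \<rho> F2 = n * (2 * order \<rho> F2)"
          using ab by (simp flip: distrib_right)
        then have "n dvd (n - b + n) * order \<rho> F2 \<longleftrightarrow> n dvd b * order \<rho> F2"
          using dvd_add_right_iff[of n "(n - b + n) * order \<rho> F2" "b * order \<rho> F2"]
            dvd_add_left_iff[of n "b * order \<rho> F2" "(n - b + n) * order \<rho> F2"] by auto
        moreover have "n dvd (b + n) * order \<rho> F1 \<longleftrightarrow> n dvd b * order \<rho> F1"
          by (simp add: distrib_right dvd_add_left_iff)
        ultimately show "n dvd b * order \<rho> F1" "n dvd b * order \<rho> F2"
          using all[of \<rho>] that coprime[of \<rho>] by (auto simp: ord)
      qed
      \<comment> \<open>The order of the character \<open>ch ^ b\<close>; it exceeds 1 because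
        \<open>0 < b < n\<close>.\<close>
      define k where "k = n div gcd n b"
      have gk: "n = gcd n b * k"
        by (simp add: k_def)
      have cop: "coprime k (b div gcd n b)"
        unfolding k_def using n(1) by (intro div_gcd_coprime) auto
      have k_dvd: "k dvd m" if "n dvd b * m" for m
      proof -
        have "gcd n b * k dvd gcd n b * ((b div gcd n b) * m)"
          using that gk by (metis dvd_mult_div_cancel gcd_dvd2 mult.assoc)
        then have "k dvd (b div gcd n b) * m"
          using n(1) by simp
        then show ?thesis
          using cop by (simp add: coprime_dvd_mult_right_iff)
      qed
      have k: "k > 1" "k dvd n"
      proof -
        have "gcd n b \<le> b"
          using False by (intro gcd_le2_nat) auto
        then have "gcd n b < n"
          using ab by simp
        then show "k > 1"
          using gk n(1) by (cases k rule: nat.exhaust) (auto, metis One_nat_def gk less_irrefl mult.right_neutral neq0_conv)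
        show "k dvd n"
          using gk by (metis dvd_triv_right)
      qed
      obtain c1 j1 h1 where 1: "f1 = smult c1 ([:0, 1:] ^ j1 * h1 ^ k)"
        using power_descent_a[OF f(1), of k] dvd1(1) k_dvd unfolding F1_def by metis
      obtain c2 j2 h2 where 2: "f2 = smult c2 ([:0, 1:] ^ j2 * h2 ^ k)"
        using power_descent_a[OF f(2), of k] dvd1(2) k_dvd unfolding F2_def by metis
      show False
        using exceptionalI[OF 1 2 f(1,2) k] exc by simp
    qed
  qed
  have "(\<Sum>x | x \<noteq> 0 \<and> poly f1 x \<noteq> 0 \<and> poly f2 x \<noteq> 0.
      ch x ^ a * ch (poly f1 x / poly f2 x) ^ b * \<psi> (\<beta> * x + \<gamma> / x)) =
      (\<Sum>x | poly G x \<noteq> 0. ch (poly G x) * \<psi> (\<beta> * x + \<gamma> / x))"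
    by (intro sum.cong) (auto simp: G_iff chG)
  also have "norm \<dots> \<le> real (card {\<rho>. poly (map_poly to_ac G) \<rho> = 0} + 1) * sqrt (real Q)"
    by (rule char_sum_bound[OF G nontriv'])
  also have "\<dots> \<le> real (degree f1 + degree f2 + 2) * sqrt (real Q)"
  proof -
    have "{\<rho>. poly (map_poly to_ac G) \<rho> = 0} \<subseteq> insert 0 ({\<rho>. poly F1 \<rho> = 0} \<union> {\<rho>. poly F2 \<rho> = 0})"
      unfolding mapG by auto
    then have "card {\<rho>. poly (map_poly to_ac G) \<rho> = 0} \<le> card (insert 0 ({\<rho>. poly F1 \<rho> = 0} \<union> {\<rho>. poly F2 \<rho> = 0}))"
      using F by (intro card_mono) (auto intro: poly_roots_finite)
    also have "\<dots> \<le> Suc (card ({\<rho>. poly F1 \<rho> = 0} \<union> {\<rho>. poly F2 \<rho> = 0}))"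
      by (rule card_insert_le_m1) auto
    also have "card ({\<rho>. poly F1 \<rho> = 0} \<union> {\<rho>. poly F2 \<rho> = 0}) \<le> card {\<rho>. poly F1 \<rho> = 0} + card {\<rho>. poly F2 \<rho> = 0}"
      by (rule card_Un_le)
    also have "\<dots> \<le> degree f1 + degree f2"
      using card_poly_roots_bound[OF F(1)] card_poly_roots_bound[OF F(2)]
      by (simp add: F1_def F2_def degree_map_to_ac)
    finally have "card {\<rho>. poly (map_poly to_ac G) \<rho> = 0} + 1 \<le> degree f1 + degree f2 + 2"
      by simp
    then show ?thesis
      by (intro mult_right_mono) (auto simp only: of_nat_le_iff real_sqrt_ge_zero of_nat_0_le_iff)
  qed
  finally show ?thesis .
qed

end

section \<open>The sieve\<close>

lemma irreducible_poly_factor_exists: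
  fixes f :: "'a::field poly"
  assumes "degree f > 0"
  obtains g where "irreducible g" "lead_coeff g = 1" "g dvd f"
proof -
  obtain g where g: "g dvd f" "degree g > 0"
      and min: "\<And>h. h dvd f \<Longrightarrow> degree h > 0 \<Longrightarrow> degree g \<le> degree h"
    using ex_has_least_nat[of "\<lambda>g. g dvd f \<and> degree g > 0" f degree] assms by auto
  have g0: "g \<noteq> 0"
    using g by auto
  have unit: "u dvd 1 \<longleftrightarrow> degree u = 0" if "u \<noteq> 0" for u :: "'a poly"
    using that by (auto simp: is_unit_iff_degree)
  have irr: "irreducible g"
  proof (rule irreducibleI)
    show "\<not> g dvd 1"
      using unit[OF g0] g by simp
    fix a b assume ab: "g = a * b"
    have nz: "a \<noteq> 0" "b \<noteq> 0"
      using ab g0 by auto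
    show "a dvd 1 \<or> b dvd 1"
    proof (rule ccontr)
      assume "\<not> ?thesis"
      then have pos: "degree a > 0" "degree b > 0"
        using unit nz by auto
      have "a dvd f"
        using g ab by (auto intro: dvd_trans)
      from min[OF this pos(1)] show False
        using ab nz pos by (simp add: degree_mult_eq)
    qed
  qed (rule g0)
  define h where "h = smult (inverse (lead_coeff g)) g"
  have "irreducible h"
    unfolding h_def using irr g0 by (simp add: irreducible_altdef smult_dvd_iff dvd_smult_iff is_unit_smult_iff)
  moreover have "lead_coeff h = 1"
    using g0 by (simp add: h_def)
  moreover have "h dvd f"
    using g g0 by (simp add: h_def smult_dvd_iff)
  ultimately show ?thesis
    by (rule that)
qed

lemma prime_elem_dvd_prod:
  assumes "prime_elem p" "p dvd prod f A"
  shows "\<exists>x\<in>A. p dvd f x"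
  using assms(2)
proof (induction A rule: infinite_finite_induct)
  case (insert x A)
  then show ?case
    using prime_elem_dvd_mult_iff[OF assms(1)] by auto
qed (use assms(1) in \<open>simp_all add: prime_elem_def\<close>)

text \<open>Expanding the product gives \<open>2 ^ card I\<close> terms, each an average over
  choices \<open>\<tau>\<close> of sums bounded by \<open>B\<close>. The weight \<open>W\<close> is
  arbitrary so that the induction can absorb a character into it.\<close>

lemma sieve_upper_bound:
  fixes \<theta> :: "'i \<Rightarrow> 'd \<Rightarrow> 'x \<Rightarrow> complex"
  assumes "finite I" "\<And>i. i \<in> I \<Longrightarrow> finite (C i) \<and> C i \<noteq> {}"
    and "\<And>T \<tau>. T \<subseteq> I \<Longrightarrow> (\<And>i. i \<in> T \<Longrightarrow> \<tau> i \<in> C i) \<Longrightarrow> norm (\<Sum>x\<in>\<Omega>. W x * (\<Prod>i\<in>T. \<theta> i (\<tau> i) x)) \<le> B"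
  shows "norm (\<Sum>x\<in>\<Omega>. W x * (\<Prod>i\<in>I. 1 - (\<Sum>d\<in>C i. \<theta> i d x) / of_nat (card (C i)))) \<le> 2 ^ card I * B"
  using assms
proof (induction I arbitrary: W rule: finite_induct)
  case empty
  then show ?case
    using empty.prems(2)[of "{}"] by simp
next
  case (insert i I)
  define F where "F = (\<lambda>x. \<Prod>i\<in>I. 1 - (\<Sum>d\<in>C i. \<theta> i d x) / of_nat (card (C i)))"
  have C: "finite (C i)" "card (C i) > 0"
    using insert.prems(1)[of i] by (auto simp: card_gt_0_iff)
  have 1: "norm (\<Sum>x\<in>\<Omega>. W x * F x) \<le> 2 ^ card I * B"
    unfolding F_def using insert.prems by (intro insert.IH) auto
  have 2: "norm (\<Sum>x\<in>\<Omega>. W x * \<theta> i d x * F x) \<le> 2 ^ card I * B" if d: "d \<in> C i" for d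
    unfolding F_def
  proof (rule insert.IH)
    fix T \<tau> assume T: "T \<subseteq> I" "\<And>i. i \<in> T \<Longrightarrow> \<tau> i \<in> C i"
    have fT: "finite T" "i \<notin> T"
      using T insert.hyps by (auto intro: finite_subset)
    have "norm (\<Sum>x\<in>\<Omega>. W x * (\<Prod>k\<in>insert i T. \<theta> k ((\<tau>(i := d)) k) x)) \<le> B"
      using T d by (intro insert.prems(2)) auto
    also have "(\<Sum>x\<in>\<Omega>. W x * (\<Prod>k\<in>insert i T. \<theta> k ((\<tau>(i := d)) k) x)) =
        (\<Sum>x\<in>\<Omega>. W x * \<theta> i d x * (\<Prod>k\<in>T. \<theta> k (\<tau> k) x))"
    proof (rule sum.cong)
      fix x
      have "(\<Prod>k\<in>T. \<theta> k ((\<tau>(i := d)) k) x) = (\<Prod>k\<in>T. \<theta> k (\<tau> k) x)"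
        using fT by (intro prod.cong) auto
      then show "W x * (\<Prod>k\<in>insert i T. \<theta> k ((\<tau>(i := d)) k) x) = W x * \<theta> i d x * (\<Prod>k\<in>T. \<theta> k (\<tau> k) x)"
        using fT by simp
    qed simp
    finally show "norm (\<Sum>x\<in>\<Omega>. W x * \<theta> i d x * (\<Prod>k\<in>T. \<theta> k (\<tau> k) x)) \<le> B" .
  qed (use insert.prems in auto)
  have "(\<Sum>x\<in>\<Omega>. W x * (\<Prod>i\<in>insert i I. 1 - (\<Sum>d\<in>C i. \<theta> i d x) / of_nat (card (C i)))) =
      (\<Sum>x\<in>\<Omega>. W x * F x - (\<Sum>d\<in>C i. W x * \<theta> i d x * F x) / of_nat (card (C i)))"
    using insert.hyps by (intro sum.cong refl) (simp add: F_def algebra_simps sum_distrib_left sum_distrib_right)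
  also have "\<dots> = (\<Sum>x\<in>\<Omega>. W x * F x) - (\<Sum>d\<in>C i. \<Sum>x\<in>\<Omega>. W x * \<theta> i d x * F x) / of_nat (card (C i))"
    by (simp add: sum_subtractf sum_divide_distrib[symmetric] sum.swap[of _ \<Omega>])
  also have "norm \<dots> \<le> 2 ^ card I * B + 2 ^ card I * B"
  proof (rule order_trans[OF norm_triangle_ineq4 add_mono[OF 1]])
    have "norm (\<Sum>d\<in>C i. \<Sum>x\<in>\<Omega>. W x * \<theta> i d x * F x) \<le> (\<Sum>d\<in>C i. 2 ^ card I * B)"
      by (rule sum_norm_le) (rule 2)
    then show "norm ((\<Sum>d\<in>C i. \<Sum>x\<in>\<Omega>. W x * \<theta> i d x * F x) / of_nat (card (C i))) \<le> 2 ^ card I * B"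
      using C by (simp add: norm_divide field_simps)
  qed
  also have "2 ^ card I * B + 2 ^ card I * B = 2 ^ card (insert i I) * B"
    using insert.hyps by simp
  finally show ?case .
qed

text \<open>The empty choice contributes exactly \<open>card \<Omega>\<close>, which leaves
  \<open>2 ^ card I - 1\<close> averages to be bounded.\<close>

lemma sieve_main_term:
  fixes \<theta> :: "'i \<Rightarrow> 'd \<Rightarrow> 'x \<Rightarrow> complex"
  assumes "finite I" "\<And>i. i \<in> I \<Longrightarrow> finite (C i) \<and> C i \<noteq> {}"
    and "\<And>T \<tau>. T \<subseteq> I \<Longrightarrow> T \<noteq> {} \<Longrightarrow> (\<And>i. i \<in> T \<Longrightarrow> \<tau> i \<in> C i) \<Longrightarrow>
      norm (\<Sum>x\<in>\<Omega>. \<Prod>i\<in>T. \<theta> i (\<tau> i) x) \<le> B"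
  shows "norm ((\<Sum>x\<in>\<Omega>. \<Prod>i\<in>I. 1 - (\<Sum>d\<in>C i. \<theta> i d x) / of_nat (card (C i))) - of_nat (card \<Omega>)) \<le> (2 ^ card I - 1) * B"
  using assms
proof (induction I rule: finite_induct)
  case (insert i I)
  define F where "F = (\<lambda>x. \<Prod>i\<in>I. 1 - (\<Sum>d\<in>C i. \<theta> i d x) / of_nat (card (C i)))"
  have C: "finite (C i)" "card (C i) > 0"
    using insert.prems(1)[of i] by (auto simp: card_gt_0_iff)
  have 1: "norm ((\<Sum>x\<in>\<Omega>. F x) - of_nat (card \<Omega>)) \<le> (2 ^ card I - 1) * B"
    unfolding F_def using insert.prems by (intro insert.IH) auto
  have 2: "norm (\<Sum>x\<in>\<Omega>. \<theta> i d x * F x) \<le> 2 ^ card I * B" if d: "d \<in> C i" for d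
    unfolding F_def
  proof (rule sieve_upper_bound)
    fix T \<tau> assume T: "T \<subseteq> I" "\<And>i. i \<in> T \<Longrightarrow> \<tau> i \<in> C i"
    have fT: "finite T" "i \<notin> T"
      using T insert.hyps by (auto intro: finite_subset)
    have "norm (\<Sum>x\<in>\<Omega>. \<Prod>k\<in>insert i T. \<theta> k ((\<tau>(i := d)) k) x) \<le> B"
      using T d by (intro insert.prems(2)) auto
    also have "(\<Sum>x\<in>\<Omega>. \<Prod>k\<in>insert i T. \<theta> k ((\<tau>(i := d)) k) x) =
        (\<Sum>x\<in>\<Omega>. \<theta> i d x * (\<Prod>k\<in>T. \<theta> k (\<tau> k) x))"
    proof (rule sum.cong)
      fix x
      have "(\<Prod>k\<in>T. \<theta> k ((\<tau>(i := d)) k) x) = (\<Prod>k\<in>T. \<theta> k (\<tau> k) x)"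
        using fT by (intro prod.cong) auto
      then show "(\<Prod>k\<in>insert i T. \<theta> k ((\<tau>(i := d)) k) x) = \<theta> i d x * (\<Prod>k\<in>T. \<theta> k (\<tau> k) x)"
        using fT by simp
    qed simp
    finally show "norm (\<Sum>x\<in>\<Omega>. \<theta> i d x * (\<Prod>k\<in>T. \<theta> k (\<tau> k) x)) \<le> B" .
  qed (use insert in auto)
  have "(\<Sum>x\<in>\<Omega>. \<Prod>i\<in>insert i I. 1 - (\<Sum>d\<in>C i. \<theta> i d x) / of_nat (card (C i))) =
      (\<Sum>x\<in>\<Omega>. F x - (\<Sum>d\<in>C i. \<theta> i d x * F x) / of_nat (card (C i)))"
    using insert.hyps by (intro sum.cong refl) (simp add: F_def algebra_simps sum_distrib_left sum_distrib_right)
  also have "\<dots> = (\<Sum>x\<in>\<Omega>. F x) - (\<Sum>d\<in>C i. \<Sum>x\<in>\<Omega>. \<theta> i d x * F x) / of_nat (card (C i))"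
    by (simp add: sum_subtractf sum_divide_distrib[symmetric] sum.swap[of _ \<Omega>])
  finally have eq: "(\<Sum>x\<in>\<Omega>. \<Prod>i\<in>insert i I. 1 - (\<Sum>d\<in>C i. \<theta> i d x) / of_nat (card (C i))) - of_nat (card \<Omega>) =
      ((\<Sum>x\<in>\<Omega>. F x) - of_nat (card \<Omega>)) - (\<Sum>d\<in>C i. \<Sum>x\<in>\<Omega>. \<theta> i d x * F x) / of_nat (card (C i))"
    by simp
  have "norm \<dots> \<le> (2 ^ card I - 1) * B + 2 ^ card I * B"
  proof (rule order_trans[OF norm_triangle_ineq4 add_mono[OF 1]])
    have "norm (\<Sum>d\<in>C i. \<Sum>x\<in>\<Omega>. \<theta> i d x * F x) \<le> (\<Sum>d\<in>C i. 2 ^ card I * B)"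
      by (rule sum_norm_le) (rule 2)
    then show "norm ((\<Sum>d\<in>C i. \<Sum>x\<in>\<Omega>. \<theta> i d x * F x) / of_nat (card (C i))) \<le> 2 ^ card I * B"
      using C by (simp add: norm_divide field_simps)
  qed
  then show ?case
    unfolding eq using insert.hyps by (simp add: algebra_simps)
qed simp

section \<open>Detection of primitive elements and nonvanishing of traces\<close>

context finfield
begin

lemma primitiveI:
  assumes x: "x \<noteq> 0" and l: "\<And>l. prime l \<Longrightarrow> l dvd n \<Longrightarrow> ch x ^ (n div l) \<noteq> 1"
  shows "primitive x"
proof -
  obtain t where t: "x = w ^ t"
    using w(2) x by blast
  have cop: "coprime t n"
  proof (rule ccontr)
    assume "\<not> coprime t n"
    then have "gcd t n \<noteq> 1"
      by (simp add: coprime_iff_gcd_eq_1)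
    then obtain l where l': "prime l" "l dvd gcd t n"
      using prime_factor_nat by blast
    then obtain t' n' where eq: "t = l * t'" "n = l * n'"
      by (auto elim!: dvdE)
    have "l > 0"
      using l' prime_gt_0_nat by blast
    then have "x ^ (n div l) = (w ^ n) ^ t'"
      unfolding t eq(1) power_mult[symmetric] by (simp add: eq(2) mult_ac)
    then have "ch x ^ (n div l) = 1"
      using ch_power[OF x, of "n div l"] by (simp add: pow_n[OF w(1)] ch_1)
    with l[OF l'(1)] l' show False
      by simp
  qed
  have "y \<in> range (\<lambda>k::int. x powi k)" if y: "y \<noteq> 0" for y
  proof -
    obtain i where i: "y = w ^ i"
      using w(2) y by blast
    obtain u where u: "[t * u = Suc 0] (mod n)"
      using cong_solve_coprime_nat[OF cop] by blast
    have "[t * u * i = Suc 0 * i] (mod n)"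
      using u by (rule cong_scalar_right)
    then have "w ^ (t * u * i) = w ^ i"
      by (simp add: w_pow_inject)
    then have "y = x ^ (u * i)"
      unfolding i t by (simp add: mult.assoc flip: power_mult)
    then have "y = x powi int (u * i)"
      by (simp only: power_int_of_nat)
    then show ?thesis
      by blast
  qed
  moreover have "x powi k \<noteq> 0" for k :: int
    using x by simp
  ultimately show ?thesis
    unfolding primitive_def by auto
qed

text \<open>A product of nontrivial characters of distinct prime orders is nontrivial. Multiplying
  by the other primes in \<open>T\<close> makes their terms divisible by \<open>n\<close>, and the
  remaining one would force \<open>l0\<close> to divide \<open>j l0\<close> or another
  prime.\<close>

lemma sum_prime_parts:
  assumes T: "finite T" "\<And>l. l \<in> T \<Longrightarrow> prime l \<and> l dvd n" "T \<noteq> {}"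
    and j: "\<And>l. l \<in> T \<Longrightarrow> 0 < j l \<and> j l < l"
  shows "\<not> n dvd (\<Sum>l\<in>T. j l * (n div l))"
proof
  assume dvd: "n dvd (\<Sum>l\<in>T. j l * (n div l))"
  obtain l0 where l0: "l0 \<in> T"
    using T by blast
  define r where "r = (\<Prod>l\<in>T - {l0}. l)"
  have others: "n dvd r * (\<Sum>l\<in>T - {l0}. j l * (n div l))"
    unfolding sum_distrib_left
  proof (rule dvd_sum)
    fix l assume l: "l \<in> T - {l0}"
    then obtain k where k: "r = l * k"
      using T(1) dvd_prodI[of "T - {l0}" l "\<lambda>l. l"] unfolding r_def by (auto elim!: dvdE)
    have "l * (n div l) = n"
      using T(2) l by simp
    then have "r * (j l * (n div l)) = n * (k * j l)"
      unfolding k by (metis mult.assoc mult.commute)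
    then show "n dvd r * (j l * (n div l))"
      by (rule dvdI)
  qed
  have "(\<Sum>l\<in>T. j l * (n div l)) = j l0 * (n div l0) + (\<Sum>l\<in>T - {l0}. j l * (n div l))"
    using T(1) l0 by (rule sum.remove)
  then have "n dvd r * (j l0 * (n div l0)) + r * (\<Sum>l\<in>T - {l0}. j l * (n div l))"
    using dvd by (metis distrib_left dvd_mult)
  then have "n dvd r * (j l0 * (n div l0))"
    using others by (simp add: dvd_add_left_iff)
  moreover have nl: "n = l0 * (n div l0)"
    using T(2) l0 by simp
  ultimately have "l0 * (n div l0) dvd (r * j l0) * (n div l0)"
    by (simp add: mult.assoc)
  moreover have "n div l0 > 0"
    using nl n(1) by (cases "n div l0") auto
  ultimately have "l0 dvd r * j l0"
    by simp
  then have "l0 dvd r \<or> l0 dvd j l0"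
    using T(2) l0 by (simp add: prime_dvd_mult_iff)
  then show False
  proof
    assume "l0 dvd r"
    then obtain l where l: "l \<in> T - {l0}" "l0 dvd l"
      unfolding r_def using T l0 by (subst (asm) prime_dvd_prod_iff) auto
    then have "l0 = l"
      using T(2) l0 by (intro primes_dvd_imp_eq) auto
    with l show False
      by simp
  next
    assume "l0 dvd j l0"
    with j[OF l0] show False
      by (auto dest: dvd_imp_le)
  qed
qed

lemma Ep_eq_1_iff: "t ^ p = t \<Longrightarrow> Ep t = 1 \<longleftrightarrow> t = 0"
proof -
  assume "t ^ p = t"
  then obtain i where "t = of_nat i"
    by (rule prime_field)
  moreover have "(of_nat i :: 'a) = of_nat (i mod p)"
    by (simp add: of_nat_eq_iff_cong_CHAR unique_euclidean_semiring_class.cong_def p_def)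
  ultimately have t: "t = of_nat (i mod p)"
    by simp
  show ?thesis
  proof
    assume "Ep t = 1"
    then have "cis (2 * pi * (real (i mod p) / real p)) = 1"
      unfolding t Ep_of_nat by simp
    then obtain k :: int where "real (i mod p) / real p = of_int k"
      by (rule cis_2pi_eq_1)
    moreover have "0 \<le> real (i mod p) / real p" "real (i mod p) / real p < 1"
      using p1 by simp_all
    ultimately have "real (i mod p) / real p = 0"
      by force
    then have "i mod p = 0"
      using p1 by simp
    then show "t = 0"
      unfolding t by simp
  qed (use Ep_of_nat[of 0] in simp)
qed

text \<open>A root count that serves for the traces to the prime field and to the base field as well
  as for the Frobenius operators \<open>act\<close>.\<close>

lemma additive_poly_nonzero:
  assumes r: "r > 1" and S: "finite S" "r ^ k < card S" and c: "c k \<noteq> (0 :: 'a)"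
  obtains y where "y \<in> S" "(\<Sum>i\<le>k. c i * y ^ (r ^ i)) \<noteq> 0"
proof -
  define f where "f = (\<Sum>i\<le>k. monom (c i) (r ^ i))"
  have inj: "r ^ i = r ^ k \<longleftrightarrow> i = k" for i
    using r by simp
  have "coeff f (r ^ k) = (\<Sum>i\<le>k. if i = k then c k else 0)"
    unfolding f_def coeff_sum by (intro sum.cong) (auto simp: inj)
  then have f0: "f \<noteq> 0"
    using c by auto
  have "degree f \<le> r ^ k"
    unfolding f_def using r by (intro degree_sum_le) (auto intro!: order_trans[OF degree_monom_le] power_increasing)
  then have "card {y. poly f y = 0} < card S"
    using card_poly_roots_bound[OF f0] S by simp
  then obtain y where y: "y \<in> S" "poly f y \<noteq> 0"
    using S card_mono[OF poly_roots_finite[OF f0], of S] by fastforce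
  then show ?thesis
    by (intro that[of y]) (simp_all add: f_def poly_sum poly_monom)
qed

lemma \<psi>_nontrivial:
  assumes "v \<noteq> 0"
  obtains u where "\<psi> (u * v) \<noteq> 1"
proof -
  obtain k where k: "\<kappa> = Suc k"
    using card(2) by (cases \<kappa>) auto
  have "p ^ k < card (UNIV :: 'a set)"
    using p1 Q unfolding Q_def k by simp
  then obtain y where "(\<Sum>i\<le>k. 1 * y ^ (p ^ i)) \<noteq> (0::'a)"
    using additive_poly_nonzero[OF p1 _ _, of UNIV k "\<lambda>_. 1"] by auto
  then have "tr y \<noteq> 0"
    unfolding tr_def unfolding k lessThan_Suc_atMost by simp
  then have "\<psi> y \<noteq> 1"
    by (simp add: \<psi>_def Ep_eq_1_iff pow_p_tr)
  with assms show ?thesis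
    by (intro that[of "y / v"]) simp
qed

lemma tr_pow_p: "tr (v ^ (p ^ i)) = tr v"
proof (induction i)
  case (Suc i)
  have "tr (u ^ p) = tr u ^ p" for u
    unfolding tr_def using pow_p_sum[of "\<lambda>i. u ^ (p ^ i)" "{..<\<kappa>}" 1]
    by (simp add: mult.commute flip: power_mult)
  then have "tr ((v ^ (p ^ i)) ^ p) = tr v"
    by (simp add: pow_p_tr Suc)
  then show ?case
    by (simp add: mult.commute flip: power_mult)
qed simp

end

section \<open>The extension as a module over polynomials in Frobenius\<close>

locale ext = finfield \<kappa> w for \<kappa> and w :: "'a::{field,finite}" +
  fixes \<iota> :: "'k::{field,finite} \<Rightarrow> 'a" and q m \<kappa>0 :: nat
  assumes q: "q = p ^ \<kappa>0" "\<kappa>0 > 0" and m: "m \<ge> 1" "\<kappa> = \<kappa>0 * m" and cardk: "CARD('k) = q"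
    and \<iota>: "\<iota> 1 = 1" "\<And>x y. \<iota> (x + y) = \<iota> x + \<iota> y" "\<And>x y. \<iota> (x * y) = \<iota> x * \<iota> y"
begin

lemma q1: "q > 1"
  using q p1 one_less_power by blast

lemma Qq: "Q = q ^ m"
  by (simp add: Q q m power_mult)

lemma \<iota>_0: "\<iota> 0 = 0"
  using \<iota>(2)[of 0 0] add_left_cancel[of "\<iota> 0" "\<iota> 0" 0] by simp

lemma \<iota>_minus: "\<iota> (- x) = - \<iota> x"
  using \<iota>(2)[of x "- x"] \<iota>_0 by (simp add: eq_neg_iff_add_eq_0 add.commute)

lemma \<iota>_diff: "\<iota> (x - y) = \<iota> x - \<iota> y"
  using \<iota>(2)[of x "- y"] by (simp add: \<iota>_minus)

lemma \<iota>_eq_0: "\<iota> x = 0 \<longleftrightarrow> x = 0"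
proof
  assume "\<iota> x = 0"
  show "x = 0"
  proof (rule ccontr)
    assume "x \<noteq> 0"
    then have "\<iota> 1 = \<iota> x * \<iota> (inverse x)"
      by (simp flip: \<iota>(3))
    with \<open>\<iota> x = 0\<close> \<iota>(1) show False
      by simp
  qed
qed (simp add: \<iota>_0)

lemma inj_\<iota>: "inj \<iota>"
  using \<iota>_diff \<iota>_eq_0 by (metis injI eq_iff_diff_eq_0)

lemma \<iota>_pow: "\<iota> (x ^ i) = \<iota> x ^ i"
  by (induction i) (simp_all add: \<iota>)

lemma \<iota>_q: "\<iota> x ^ q = \<iota> x"
  using finite_field_power_card[of x] by (simp add: cardk flip: \<iota>_pow)

lemma \<iota>_q_pow: "\<iota> x ^ (q ^ i) = \<iota> x"
  by (induction i) (simp_all add: power_mult \<iota>_q)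

lemma range_\<iota>: "range \<iota> = {x. x ^ q = x}"
proof (rule card_seteq)
  define f :: "'a poly" where "f = monom 1 q - monom 1 1"
  have deg: "degree f = q"
    unfolding f_def diff_conv_add_uminus using q1
    by (subst degree_add_eq_left) (auto simp: degree_monom_eq)
  have f0: "f \<noteq> 0"
    using deg q1 by auto
  have "{x. poly f x = 0} = {x. x ^ q = x}"
    by (auto simp: f_def poly_monom)
  then show "card {x :: 'a. x ^ q = x} \<le> card (range \<iota>)"
    using card_poly_roots_bound[OF f0] deg card_image[OF inj_\<iota>] cardk by simp
qed (auto simp: \<iota>_q)

lemma pow_q_add: "((u :: 'a) + v) ^ (q ^ i) = u ^ (q ^ i) + v ^ (q ^ i)"
  by (simp add: q pow_p_add flip: power_mult)

lemma pow_q_sum: "(\<Sum>i\<in>A. f i :: 'a) ^ (q ^ j) = (\<Sum>i\<in>A. f i ^ (q ^ j))"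
  by (simp add: q pow_p_sum flip: power_mult)

text \<open>With \<open>\<sigma>\<close> the \<open>q\<close>-Frobenius, \<open>act s g\<close> is \<open>g(\<sigma> ^ s)\<close>; as \<open>\<sigma> ^ (m - 1)\<close> inverts \<open>\<sigma>\<close>, \<open>act (m - 1) g\<close> is the
  adjoint of \<open>act 1 g\<close> for the trace form.\<close>

definition act :: "nat \<Rightarrow> 'k poly \<Rightarrow> 'a \<Rightarrow> 'a" where
  "act s g x = (\<Sum>i\<le>degree g. \<iota> (coeff g i) * x ^ (q ^ (s * i)))"

lemma act_bound: "degree g \<le> N \<Longrightarrow> act s g x = (\<Sum>i\<le>N. \<iota> (coeff g i) * x ^ (q ^ (s * i)))"
  unfolding act_def by (intro sum.mono_neutral_left) (auto simp: coeff_eq_0 \<iota>_0)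

lemma act_0: "act s 0 x = 0"
  by (simp add: act_def \<iota>_0)

lemma act_1: "act s 1 x = x"
  by (simp add: act_def \<iota>)

lemma act_add: "act s (g + h) x = act s g x + act s h x"
  using act_bound[of "g + h" "max (degree g) (degree h)" s x] act_bound[of g "max (degree g) (degree h)" s x]
    act_bound[of h "max (degree g) (degree h)" s x] degree_add_le_max[of g h]
  by (simp add: \<iota> distrib_right sum.distrib)

lemma act_minus: "act s (g - h) x = act s g x - act s h x"
  using act_add[of s "g - h" h x] by simp

lemma act_monom: "act s (monom c i) x = \<iota> c * x ^ (q ^ (s * i))"
proof -
  have "act s (monom c i) x = (\<Sum>k\<le>i. if k = i then \<iota> c * x ^ (q ^ (s * i)) else 0)"
    using act_bound[OF degree_monom_le, of s c i x] by (simp only:) (rule sum.cong, auto simp: \<iota>_0)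
  then show ?thesis
    by simp
qed

lemma act_smult: "act s (smult c g) x = \<iota> c * act s g x"
  using act_bound[of "smult c g" "degree g" s x] degree_smult_le[of c g]
  by (simp add: act_def \<iota> sum_distrib_left mult.assoc)

lemma act_pCons_0: "act s (pCons 0 g) x = act s g (x ^ (q ^ s))"
proof -
  have "act s (pCons 0 g) x = (\<Sum>i\<le>Suc (degree g). \<iota> (coeff (pCons 0 g) i) * x ^ (q ^ (s * i)))"
    using degree_pCons_le[of 0 g] by (rule act_bound)
  also have "\<dots> = (\<Sum>i\<le>degree g. \<iota> (coeff g i) * x ^ (q ^ (s * Suc i)))"
    by (subst sum.atMost_Suc_shift) (simp add: \<iota>_0)
  finally show ?thesis
    by (simp add: act_def power_add flip: power_mult)
qed

lemma act_frob: "act s g (x ^ (q ^ e)) = act s g x ^ (q ^ e)"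
  unfolding act_def pow_q_sum
  by (intro sum.cong refl) (simp add: power_mult_distrib \<iota>_q_pow mult.commute flip: power_mult)

lemma act_mult: "act s (g * h) x = act s g (act s h x)"
proof (induction g)
  case (pCons a g)
  have "act s (pCons a g * h) x = \<iota> a * act s h x + act s (g * h) (x ^ (q ^ s))"
    by (simp add: act_add act_smult act_pCons_0)
  also have "act s (g * h) (x ^ (q ^ s)) = act s g (act s h x ^ (q ^ s))"
    by (simp only: act_frob pCons.IH)
  also have "\<iota> a * act s h x + act s g (act s h x ^ (q ^ s)) = act s (pCons a 0 + pCons 0 g) (act s h x)"
    unfolding act_add act_pCons_0 using act_monom[of s a 0 "act s h x"] by (simp add: monom_0)
  finally show ?case
    by simp
qed (simp add: act_0)

lemma act_sum_arg: "act s g (\<Sum>i\<in>A. f i) = (\<Sum>i\<in>A. act s g (f i))"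
  by (simp add: act_def pow_q_sum sum_distrib_left sum.swap[of _ A])

lemma act_arg_0: "act s g 0 = 0"
  using q1 by (simp add: act_def power_0_left)

lemma act_Xm: "act s (monom 1 m - 1) x = 0"
proof -
  have "x ^ (q ^ (s * m)) = x"
  proof (induction s)
    case (Suc s)
    have "x ^ (q ^ (Suc s * m)) = (x ^ Q) ^ (q ^ (s * m))"
      by (simp add: Qq power_add flip: power_mult)
    then show ?case
      by (simp add: pow_Q Suc)
  qed simp
  then show ?thesis
    by (simp add: act_minus act_monom act_1 \<iota>)
qed

lemma \<psi>_q: "\<psi> (v ^ (q ^ i)) = \<psi> v"
  by (simp add: \<psi>_def q tr_pow_p flip: power_mult)

lemma \<psi>_sum: "\<psi> (\<Sum>i\<in>A. f i) = (\<Prod>i\<in>A. \<psi> (f i))"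
  by (induction A rule: infinite_finite_induct) (simp_all add: \<psi>_0 \<psi>_add)

text \<open>\<open>\<psi>\<close> is invariant under Frobenius. Applying its power
  \<open>(m - 1) * i\<close> to the term of index \<open>i\<close> moves Frobenius from
  \<open>x\<close> to \<open>\<delta>\<close>, because the \<open>m\<close>-th power of Frobenius is
  the identity.\<close>

lemma \<psi>_adjoint: "\<psi> (\<delta> * act 1 g x) = \<psi> (act (m - 1) g \<delta> * x)"
proof -
  have "\<psi> (\<delta> * (\<iota> c * x ^ (q ^ i))) = \<psi> (\<iota> c * \<delta> ^ (q ^ ((m - 1) * i)) * x)" for c i
  proof -
    have "(x ^ (q ^ i)) ^ (q ^ ((m - 1) * i)) = x ^ (q ^ (m * i))"
    proof -
      have "i + (m - 1) * i = m * i"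
        using m(1) by (simp add: diff_mult_distrib)
      then show ?thesis
        by (simp flip: power_mult power_add)
    qed
    moreover have "x ^ (q ^ (m * i)) = x"
      by (induction i) (simp_all add: power_add power_mult pow_Q[unfolded Qq])
    ultimately have "(\<delta> * (\<iota> c * x ^ (q ^ i))) ^ (q ^ ((m - 1) * i)) = \<iota> c * \<delta> ^ (q ^ ((m - 1) * i)) * x"
      by (simp add: power_mult_distrib \<iota>_q_pow mult_ac)
    then show ?thesis
      by (metis \<psi>_q)
  qed
  then show ?thesis
    by (simp add: act_def sum_distrib_left sum_distrib_right \<psi>_sum)
qed

lemma act_nonzero:
  assumes g: "g \<noteq> 0" "degree g < m"
  obtains x where "act 1 g x \<noteq> 0"
proof -
  have "q ^ degree g < card (UNIV :: 'a set)"
    using g(2) q1 Qq by (simp add: Q_def)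
  then show ?thesis
    using additive_poly_nonzero[OF q1 _ _, of UNIV "degree g" "\<lambda>i. \<iota> (coeff g i)"] g that
    by (auto simp: act_def \<iota>_eq_0)
qed

definition Pset :: "'k poly set" where
  "Pset = {g. lead_coeff g = 1 \<and> irreducible g \<and> g dvd monom 1 m - 1}"

definition cof :: "'k poly \<Rightarrow> 'k poly" where "cof g = (monom 1 m - 1) div g"

lemma Xm: "monom 1 m - 1 \<noteq> (0 :: 'k poly)" "degree (monom 1 m - 1 :: 'k poly) = m"
proof -
  show "degree (monom 1 m - 1 :: 'k poly) = m"
    unfolding diff_conv_add_uminus using m(1) by (subst degree_add_eq_left) (auto simp: degree_monom_eq)
  then show "monom 1 m - 1 \<noteq> (0 :: 'k poly)"
    using m(1) by auto
qed

lemma cof: "g \<in> Pset \<Longrightarrow> monom 1 m - 1 = g * cof g" "g \<in> Pset \<Longrightarrow> cof g \<noteq> 0" "g \<in> Pset \<Longrightarrow> degree (cof g) < m"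
proof -
  assume g: "g \<in> Pset"
  then show eq: "monom 1 m - 1 = g * cof g"
    by (simp add: Pset_def cof_def)
  then show nz: "cof g \<noteq> 0"
    using Xm(1) by auto
  have "g \<noteq> 0" "degree g > 0"
    using g by (auto simp: Pset_def irreducible_def is_unit_iff_degree)
  then show "degree (cof g) < m"
    using Xm(2) nz unfolding eq by (simp add: degree_mult_eq)
qed

text \<open>The operator of a nonzero polynomial of degree below \<open>m\<close> is not zero; as
  \<open>\<psi>\<close> gives a nondegenerate pairing, neither is its adjoint.\<close>

lemma Pset_nonempty_adjoint: "g \<in> Pset \<Longrightarrow> \<exists>\<delta>. act (m - 1) (cof g) \<delta> \<noteq> 0"
proof (rule ccontr)
  assume g: "g \<in> Pset" and no: "\<nexists>\<delta>. act (m - 1) (cof g) \<delta> \<noteq> 0"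
  obtain x where x: "act 1 (cof g) x \<noteq> 0"
    using act_nonzero[OF cof(2,3)[OF g]] .
  obtain u where "\<psi> (u * act 1 (cof g) x) \<noteq> 1"
    using \<psi>_nontrivial[OF x] .
  then show False
    using no unfolding \<psi>_adjoint by (simp add: \<psi>_0)
qed

text \<open>The additive counterpart of \<open>sum_prime_parts\<close>. The product \<open>h\<close>
  of the other polynomials kills all summands except that of \<open>g0\<close>, which
  \<open>g0\<close> kills too; since \<open>g0\<close> and \<open>h\<close> are coprime, that
  summand would be zero.\<close>

lemma Pset_sum_nonzero:
  assumes T: "finite T" "T \<subseteq> Pset" "T \<noteq> {}" and \<delta>: "\<And>g. g \<in> T \<Longrightarrow> act (m - 1) (cof g) (\<delta> g) \<noteq> 0"
  shows "(\<Sum>g\<in>T. act (m - 1) (cof g) (\<delta> g)) \<noteq> 0"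
proof
  assume sum0: "(\<Sum>g\<in>T. act (m - 1) (cof g) (\<delta> g)) = 0"
  obtain g0 where g0: "g0 \<in> T"
    using T by blast
  define h where "h = (\<Prod>g\<in>T - {g0}. g)"
  define b where "b = act (m - 1) (cof g0) (\<delta> g0)"
  have kill: "act (m - 1) h (act (m - 1) (cof g) (\<delta> g)) = 0" if g: "g \<in> T - {g0}" for g
  proof -
    obtain k where k: "h = g * k"
      using T(1) g dvd_prodI[of "T - {g0}" g "\<lambda>g. g"] unfolding h_def by (auto elim!: dvdE)
    have "h * cof g = k * (monom 1 m - 1)"
      using cof(1)[of g] g T(2) k by (auto simp: mult_ac)
    then show ?thesis
      by (metis act_mult act_Xm act_arg_0)
  qed
  have "0 = act (m - 1) h (\<Sum>g\<in>T. act (m - 1) (cof g) (\<delta> g))"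
    by (simp only: sum0 act_arg_0)
  also have "\<dots> = act (m - 1) h b + (\<Sum>g\<in>T - {g0}. act (m - 1) h (act (m - 1) (cof g) (\<delta> g)))"
    unfolding act_sum_arg b_def using T(1) g0 by (rule sum.remove)
  finally have hb: "act (m - 1) h b = 0"
    using kill by simp
  have gb: "act (m - 1) g0 b = 0"
    unfolding b_def act_mult[symmetric] using cof(1)[of g0] g0 T(2) by (auto simp: act_Xm simp flip: cof(1))
  have irr: "irreducible g0" "lead_coeff g0 = 1"
    using g0 T(2) by (auto simp: Pset_def)
  have "\<not> g0 dvd h"
  proof
    assume "g0 dvd h"
    then obtain g where g: "g \<in> T - {g0}" "g0 dvd g"
      using prime_elem_dvd_prod[OF field_poly_irreducible_imp_prime[OF irr(1)]] unfolding h_def by blast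
    have irr': "irreducible g" "lead_coeff g = 1"
      using g(1) T(2) by (auto simp: Pset_def)
    then obtain k where k: "g = g0 * k" "k dvd 1"
      using g(2) irreducibleD[of g g0] irreducible_not_unit[OF irr(1)] by (auto elim!: dvdE)
    then obtain c where c: "k = [:c:]"
      by (metis is_unit_polyE)
    then have "g = smult c g0"
      using k by simp
    then have "c = 1"
      using irr(2) irr'(2) by (simp only: lead_coeff_smult mult_1_right)
    then have "g = g0"
      using \<open>g = smult c g0\<close> by simp
    with g show False
      by simp
  qed
  then have "coprime g0 h"
  proof (intro coprimeI)
    fix c assume c: "c dvd g0" "c dvd h"
    then have "g0 dvd c \<or> is_unit c"
      using irreducibleD'[OF irr(1)] by blast
    with c \<open>\<not> g0 dvd h\<close> show "is_unit c"
      by (auto dest: dvd_trans)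
  qed
  then obtain u v where uv: "u * g0 + v * h = 1"
    by (rule poly_bezout)
  have "b = act (m - 1) (u * g0 + v * h) b"
    by (simp add: uv act_1)
  also have "\<dots> = 0"
    by (simp only: act_add act_mult gb hb act_arg_0 add_0)
  finally show False
    using \<delta>[OF g0] by (simp add: b_def)
qed

text \<open>A nonzero annihilator of \<open>x\<close> of least degree divides
  \<open>X ^ m - 1\<close>. If its degree were below \<open>m\<close>, it would divide some
  \<open>cof g\<close>, which then annihilates \<open>x\<close> as well. So the conjugates are
  independent, and counting combinations shows that they span.\<close>

lemma normal_overI:
  assumes x: "\<And>g. g \<in> Pset \<Longrightarrow> act 1 (cof g) x \<noteq> 0"
  shows "normal_over \<iota> q m x"
proof -
  have ann: "act 1 g x \<noteq> 0" if g: "g \<noteq> 0" "degree g < m" for g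
  proof
    assume "act 1 g x = 0"
    then obtain D where D: "D \<noteq> 0" "act 1 D x = 0"
        and min: "\<And>h. h \<noteq> 0 \<Longrightarrow> act 1 h x = 0 \<Longrightarrow> degree D \<le> degree h"
      using ex_has_least_nat[of "\<lambda>h. h \<noteq> 0 \<and> act 1 h x = 0" g degree] g by auto
    have degD: "degree D < m"
      using min[OF g(1) \<open>act 1 g x = 0\<close>] g(2) by simp
    have "D dvd monom 1 m - 1"
    proof (rule ccontr)
      assume "\<not> ?thesis"
      then have nz: "(monom 1 m - 1) mod D \<noteq> 0"
        by (simp add: dvd_eq_mod_eq_0)
      have "(monom 1 m - 1) mod D = (monom 1 m - 1) - ((monom 1 m - 1) div D) * D"
        by (simp add: minus_div_mult_eq_mod)
      then have "act 1 ((monom 1 m - 1) mod D) x = 0"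
        by (simp only: act_minus[of 1 "monom 1 m - 1" "_ * D"] act_Xm act_mult D act_arg_0 diff_0_right)
      from min[OF nz this] degree_mod_less[OF D(1)] nz show False
        by (metis not_le)
    qed
    then obtain K where K: "monom 1 m - 1 = D * K"
      by (elim dvdE)
    have "K \<noteq> 0"
      using K Xm by auto
    then have "degree K > 0"
      using K Xm(2) degD D(1) by (metis degree_mult_eq add.right_neutral neq0_conv less_irrefl)
    then obtain g where g: "irreducible g" "lead_coeff g = 1" "g dvd K"
      by (rule irreducible_poly_factor_exists)
    have gP: "g \<in> Pset"
      using g K by (auto simp: Pset_def)
    obtain K' where K': "K = g * K'"
      using g(3) by (elim dvdE)
    have g0: "g \<noteq> 0"
      using g(2) by auto
    have "g * cof g = g * (K' * D)"
      using cof(1)[OF gP] K K' by (simp only: mult_ac)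
    then have "cof g = K' * D"
      using g0 mult_left_cancel by blast
    then have "act 1 (cof g) x = 0"
      by (simp only: act_mult D act_arg_0)
    with x[OF gP] show False
      by simp
  qed
  interpret V: vector_space "\<lambda>c y. \<iota> c * y"
    by unfold_locales (simp_all add: \<iota> algebra_simps)
  define B where "B = (\<lambda>i. x ^ (q ^ i)) ` {..<m}"
  have poly_of: "act 1 (\<Sum>i<m. monom (c i) i) x = (\<Sum>i<m. \<iota> (c i) * x ^ (q ^ i))"
    "degree (\<Sum>i<m. monom (c i) i) < m" "(\<Sum>i<m. monom (c i) i) = 0 \<Longrightarrow> i < m \<Longrightarrow> c i = 0" for c i
  proof -
    have co: "coeff (\<Sum>i<m. monom (c i) i) k = (if k < m then c k else 0)" for k
      by (simp add: coeff_sum)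
    have "degree (\<Sum>i<m. monom (c i) i) \<le> m - 1"
      by (intro degree_le) (auto simp: co)
    then show "degree (\<Sum>i<m. monom (c i) i) < m"
      using m(1) by simp
    have "act 1 (\<Sum>i<m. monom (c i) i) x = (\<Sum>i\<le>m - 1. \<iota> (if i < m then c i else 0) * x ^ (q ^ (1 * i)))"
      using act_bound[OF \<open>degree (\<Sum>i<m. monom (c i) i) \<le> m - 1\<close>, of 1 x] by (simp only: co)
    also have "\<dots> = (\<Sum>i<m. \<iota> (c i) * x ^ (q ^ i))"
      using m(1) by (intro sum.cong) auto
    finally show "act 1 (\<Sum>i<m. monom (c i) i) x = (\<Sum>i<m. \<iota> (c i) * x ^ (q ^ i))" .
    show "c i = 0" if "(\<Sum>i<m. monom (c i) i) = 0" "i < m"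
      using co[of i] that by simp
  qed
  have indep: "c i = 0" if "(\<Sum>i<m. \<iota> (c i) * x ^ (q ^ i)) = 0" "i < m" for c i
    using ann[of "\<Sum>i<m. monom (c i) i"] poly_of[of c] that by auto
  have inj: "inj_on (\<lambda>i. x ^ (q ^ i)) {..<m}"
  proof (rule inj_onI, rule ccontr)
    fix i j assume ij: "i \<in> {..<m}" "j \<in> {..<m}" "x ^ (q ^ i) = x ^ (q ^ j)" "i \<noteq> j"
    have "(\<Sum>k<m. \<iota> (if k = i then 1 else if k = j then -1 else 0) * x ^ (q ^ k)) =
        (\<Sum>k\<in>{i, j}. \<iota> (if k = i then 1 else if k = j then -1 else 0) * x ^ (q ^ k))"
      using ij by (intro sum.mono_neutral_right) (auto simp: \<iota>_0)
    also have "\<dots> = 0"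
      using ij by (simp add: \<iota> \<iota>_minus)
    finally show False
      using indep[of "\<lambda>k. if k = i then 1 else if k = j then -1 else 0" i] ij by simp
  qed
  have "\<not> V.dependent B"
  proof
    assume "V.dependent B"
    then obtain u where u: "\<exists>v\<in>B. u v \<noteq> 0" "(\<Sum>v\<in>B. \<iota> (u v) * v) = 0"
      using V.dependent_finite[of B] by (auto simp: B_def)
    then have "(\<Sum>i<m. \<iota> (u (x ^ (q ^ i))) * x ^ (q ^ i)) = 0"
      unfolding B_def by (simp add: sum.reindex[OF inj])
    then have "u (x ^ (q ^ i)) = 0" if "i < m" for i
      using indep[of "\<lambda>i. u (x ^ (q ^ i))" i] that by simp
    with u(1) show False
      by (auto simp: B_def)
  qed
  moreover have "V.span B = UNIV"
  proof -
    define F where "F = (\<lambda>c. \<Sum>i<m. \<iota> (c i) * x ^ (q ^ i))"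
    have "inj_on F (PiE {..<m} (\<lambda>_. UNIV))"
    proof (rule inj_onI)
      fix c c' :: "nat \<Rightarrow> 'k" assume c: "c \<in> PiE {..<m} (\<lambda>_. UNIV)" "c' \<in> PiE {..<m} (\<lambda>_. UNIV)" "F c = F c'"
      have "(\<Sum>i<m. \<iota> (c i - c' i) * x ^ (q ^ i)) = 0"
        using c(3) by (simp add: F_def \<iota>_diff left_diff_distrib sum_subtractf)
      then have "c i = c' i" if "i < m" for i
        using indep[of "\<lambda>i. c i - c' i" i] that by simp
      with c(1,2) show "c = c'"
        by (intro PiE_ext) auto
    qed
    then have "card (F ` PiE {..<m} (\<lambda>_. UNIV)) = card (PiE {..<m} (\<lambda>_. UNIV :: 'k set))"
      by (rule card_image)
    also have "\<dots> = card (UNIV :: 'a set)"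
      by (simp add: card_PiE cardk Qq[symmetric]) (simp add: Q_def)
    finally have "F ` PiE {..<m} (\<lambda>_. UNIV) = UNIV"
      by (intro card_subset_eq) auto
    then have onto: "\<exists>c. y = F c" for y
      by (metis UNIV_I imageE)
    have F: "F c \<in> V.span B" for c
      unfolding F_def by (intro V.span_sum V.span_scale V.span_base) (auto simp: B_def)
    show ?thesis
    proof (rule UNIV_eq_I[symmetric])
      fix y show "y \<in> V.span B"
        using onto[of y] F by (elim exE) (simp only:)
    qed
  qed
  ultimately show ?thesis
    unfolding normal_over_def Let_def B_def by (rule conjI)
qed

section \<open>The trace to the base field\<close>

lemma field_trace_add: "field_trace q m ((u :: 'a) + v) = field_trace q m u + field_trace q m v"
  unfolding field_trace_def sum.distrib[symmetric] by (intro sum.cong refl pow_q_add)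

lemma field_trace_scale: "field_trace q m (\<iota> c * v) = \<iota> c * field_trace q m v"
  by (simp add: field_trace_def power_mult_distrib \<iota>_q_pow sum_distrib_left)

lemma tr_field_trace: "tr v = (\<Sum>i<\<kappa>0. field_trace q m v ^ (p ^ i))"
proof -
  have "(\<Sum>i<\<kappa>0. field_trace q m v ^ (p ^ i)) = (\<Sum>i<\<kappa>0. \<Sum>l<m. v ^ (p ^ (l * \<kappa>0 + i)))"
    unfolding field_trace_def pow_p_sum by (simp add: q power_add mult.commute flip: power_mult)
  also have "\<dots> = (\<Sum>l<m. \<Sum>i<\<kappa>0. v ^ (p ^ (l * \<kappa>0 + i)))"
    by (rule sum.swap)
  also have "\<dots> = (\<Sum>l<m. \<Sum>i\<in>{l * \<kappa>0..<l * \<kappa>0 + \<kappa>0}. v ^ (p ^ i))"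
  proof (rule sum.cong[OF refl])
    fix l
    show "(\<Sum>i<\<kappa>0. v ^ (p ^ (l * \<kappa>0 + i))) = (\<Sum>i\<in>{l * \<kappa>0..<l * \<kappa>0 + \<kappa>0}. v ^ (p ^ i))"
      by (rule sum.reindex_bij_witness[of _ "\<lambda>i. i - l * \<kappa>0" "\<lambda>i. l * \<kappa>0 + i"]) auto
  qed
  also have "\<dots> = (\<Sum>i<m * \<kappa>0. v ^ (p ^ i))"
    by (rule sum.nat_group)
  finally show ?thesis
    unfolding tr_def unfolding m(2) by (simp add: mult.commute)
qed

lemma field_trace_surj:
  obtains v where "field_trace q m v = \<iota> a"
proof -
  obtain k where k: "m = Suc k"
    using m(1) by (cases m) auto
  have "q ^ k < card (UNIV :: 'a set)"
    using q1 Qq unfolding Q_def k by simp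
  then obtain u where "(\<Sum>i\<le>k. 1 * u ^ (q ^ i)) \<noteq> (0::'a)"
    using additive_poly_nonzero[OF q1 _ _, of UNIV k "\<lambda>_. 1"] by auto
  then have u: "field_trace q m u \<noteq> 0"
    by (simp add: field_trace_def k lessThan_Suc_atMost)
  have "field_trace q m u ^ q = field_trace q m u"
  proof -
    have "field_trace q m u ^ q = (\<Sum>i<m. u ^ (q ^ Suc i))"
      unfolding field_trace_def using pow_q_sum[of "\<lambda>i. u ^ (q ^ i)" "{..<m}" 1]
      by (simp add: mult.commute flip: power_mult)
    moreover have "(\<Sum>i<m. u ^ (q ^ Suc i) - u ^ (q ^ i)) = u ^ (q ^ m) - u ^ (q ^ 0)"
      by (rule sum_lessThan_telescope)
    ultimately show ?thesis
      using pow_Q[of u] by (simp add: Qq sum_subtractf field_trace_def)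
  qed
  then obtain b where b: "field_trace q m u = \<iota> b"
    using range_\<iota> by blast
  then have "b \<noteq> 0"
    using u \<iota>_0 by auto
  then have "field_trace q m (\<iota> (a / b) * u) = \<iota> a"
    unfolding field_trace_scale b by (simp flip: \<iota>(3))
  then show ?thesis
    by (rule that)
qed

text \<open>By transitivity of the trace, \<open>tr (\<iota> c * u)\<close> is an additive
  polynomial in \<open>\<iota> c\<close> of degree \<open>p ^ (\<kappa>0 - 1)\<close>, less than
  \<open>q\<close>; so the character is nontrivial on the base field and its values sum to
  zero.\<close>

lemma sum_\<psi>_base:
  assumes "field_trace q m u \<noteq> 0"
  shows "(\<Sum>c\<in>UNIV. \<psi> (\<iota> c * u)) = 0"
proof -
  obtain k where k: "\<kappa>0 = Suc k"
    using q(2) by (cases \<kappa>0) auto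
  have "p ^ k < card (range \<iota>)"
    using p1 q(1) unfolding k by (simp add: card_image inj_\<iota> cardk)
  then obtain y where y: "y \<in> range \<iota>" "(\<Sum>i\<le>k. field_trace q m u ^ (p ^ i) * y ^ (p ^ i)) \<noteq> 0"
    using additive_poly_nonzero[OF p1, of "range \<iota>" k "\<lambda>i. field_trace q m u ^ (p ^ i)"] assms by auto
  then obtain c0 where c0: "y = \<iota> c0"
    by blast
  have "tr (\<iota> c0 * u) \<noteq> 0"
    using y(2) unfolding tr_field_trace field_trace_scale c0 k lessThan_Suc_atMost
    by (simp add: power_mult_distrib mult.commute)
  then have ne: "\<psi> (\<iota> c0 * u) \<noteq> 1"
    by (simp add: \<psi>_def Ep_eq_1_iff pow_p_tr)
  have "(\<Sum>c\<in>UNIV. \<psi> (\<iota> c * u)) = (\<Sum>c\<in>UNIV. \<psi> (\<iota> (c0 + c) * u))"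
    by (rule sum.reindex_bij_witness[of _ "\<lambda>c. c0 + c" "\<lambda>c. c - c0"]) auto
  also have "\<dots> = \<psi> (\<iota> c0 * u) * (\<Sum>c\<in>UNIV. \<psi> (\<iota> c * u))"
    by (simp add: \<iota> distrib_right \<psi>_add sum_distrib_left)
  finally show ?thesis
    using ne by (simp add: algebra_simps)
qed

end

lemma prod_sum_type:
  fixes h :: "'a + 'b \<Rightarrow> 'c::comm_monoid_mult"
  assumes "finite T"
  shows "(\<Prod>i\<in>T. h i) = (\<Prod>l\<in>Inl -` T. h (Inl l)) * (\<Prod>r\<in>Inr -` T. h (Inr r))"
proof -
  have T: "T = Inl ` (Inl -` T) \<union> Inr ` (Inr -` T)"
  proof (rule Set.set_eqI)
    fix i show "i \<in> T \<longleftrightarrow> i \<in> Inl ` (Inl -` T) \<union> Inr ` (Inr -` T)"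
      by (cases i) blast+
  qed
  have fin: "finite (Inl -` T)" "finite (Inr -` T)"
    using assms by (simp_all add: finite_vimageI)
  have "(\<Prod>i\<in>T. h i) = (\<Prod>i\<in>Inl ` (Inl -` T) \<union> Inr ` (Inr -` T). h i)"
    using T by (rule arg_cong)
  also have "\<dots> = (\<Prod>i\<in>Inl ` (Inl -` T). h i) * (\<Prod>i\<in>Inr ` (Inr -` T). h i)"
    using fin by (intro prod.union_disjoint finite_imageI) auto
  also have "\<dots> = (\<Prod>l\<in>Inl -` T. h (Inl l)) * (\<Prod>r\<in>Inr -` T. h (Inr r))"
    by (simp only: prod.reindex inj_Inl inj_Inr o_def)
  finally show ?thesis .
qed

context ext
begin

definition PR :: "nat set" where "PR = {l. prime l \<and> l dvd n}"

lemma finite_PR: "finite PR"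
proof (rule finite_subset)
  show "PR \<subseteq> {..n}"
  proof
    fix l assume "l \<in> PR"
    then show "l \<in> {..n}"
      using dvd_imp_le[OF _ n(1), of l] unfolding PR_def atMost_iff by blast
  qed
qed simp

lemma finite_Pset: "finite Pset"
proof (rule finite_subset)
  show "Pset \<subseteq> Poly ` {xs. set xs \<subseteq> UNIV \<and> length xs \<le> Suc m}"
  proof
    fix g assume "g \<in> Pset"
    then have g: "lead_coeff g = 1" "g dvd monom 1 m - 1"
      unfolding Pset_def mem_Collect_eq by - (elim conjE, assumption)+
    have "degree g \<le> m"
      using dvd_imp_degree_le[OF g(2) Xm(1)] unfolding Xm(2) .
    moreover have "g \<noteq> 0"
      using g(1) by auto
    ultimately have "length (coeffs g) \<le> Suc m"
      using length_coeffs_degree[of g] by simp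
    then show "g \<in> Poly ` {xs. set xs \<subseteq> UNIV \<and> length xs \<le> Suc m}"
      by (intro image_eqI[of _ _ "coeffs g"]) (simp_all only: Poly_coeffs mem_Collect_eq subset_UNIV simp_thms)
  qed
qed (rule finite_imageI, rule finite_lists_length_le, rule finite)

lemma ch_pow_mod: "x \<noteq> 0 \<Longrightarrow> ch x ^ (s mod n) = ch x ^ s"
proof -
  assume x: "x \<noteq> 0"
  have "ch x ^ s = ch x ^ (n * (s div n) + s mod n)"
    by simp
  also have "\<dots> = ch x ^ (s mod n)"
    unfolding power_add power_mult using ch_pow_n[OF x] by simp
  finally show ?thesis ..
qed

end

section \<open>Counting the admissible elements\<close>

locale sieve_setting = ext \<kappa> w \<iota> q m \<kappa>0
  for \<kappa> and w :: "'a::{field,finite}" and \<iota> :: "'k::{field,finite} \<Rightarrow> 'a" and q m \<kappa>0 +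
  fixes f1 f2 :: "'a poly"
  assumes f: "f1 \<noteq> 0" "f2 \<noteq> 0" "coprime f1 f2" and exc: "\<not> exceptional (Fract f1 f2)"
begin

definition \<Omega> :: "'a set" where
  "\<Omega> = {x. x \<noteq> 0 \<and> poly f1 x \<noteq> 0 \<and> poly f2 x \<noteq> 0}"

definition Bd :: real where
  "Bd = real (degree f1 + degree f2 + 2) * sqrt (real Q)"

text \<open>The three kinds of indices are the prime divisors of \<open>Q - 1\<close> (once for \<open>x\<close> and once for
  \<open>f x\<close>) and the irreducible divisors of \<open>x ^ m - 1\<close>. The characters that belong to an index
  are those whose average is \<open>1\<close> at the elements excluded by that index.\<close>

definition idx :: "(nat + nat + 'k poly) set" where
  "idx = Inl ` PR \<union> Inr ` (Inl ` PR \<union> Inr ` Pset)"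

text \<open>The exponents of the \<open>l - 1\<close> characters of order \<open>l\<close>. The
  second component 0 gives them the same type as the additive characters, which are labelled by
  \<open>\<delta>\<close>.\<close>

definition mult_chars :: "nat \<Rightarrow> (nat \<times> 'a) set" where
  "mult_chars l = (\<lambda>j. (j * (n div l), 0)) ` {0<..<l}"

definition chars :: "nat + nat + 'k poly \<Rightarrow> (nat \<times> 'a) set" where
  "chars = case_sum mult_chars (case_sum mult_chars
    (\<lambda>g. Pair 0 ` {\<delta>. act (m - 1) (cof g) \<delta> \<noteq> 0}))"

definition char_val :: "nat + nat + 'k poly \<Rightarrow> nat \<times> 'a \<Rightarrow> 'a \<Rightarrow> complex" where
  "char_val = case_sum (\<lambda>_ d x. ch x ^ fst d) (case_sum (\<lambda>_ d x. ch (poly f1 x / poly f2 x) ^ fst d)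
    (\<lambda>g d x. \<psi> (act (m - 1) (cof g) (snd d) * x)))"

lemma chars_simps:
  "chars (Inl l) = mult_chars l" "chars (Inr (Inl l)) = mult_chars l"
  "chars (Inr (Inr g)) = Pair 0 ` {\<delta>. act (m - 1) (cof g) \<delta> \<noteq> 0}"
  by (simp_all add: chars_def)

lemma char_val_simps:
  "char_val (Inl l) d x = ch x ^ fst d" "char_val (Inr (Inl l)) d x = ch (poly f1 x / poly f2 x) ^ fst d"
  "char_val (Inr (Inr g)) d x = \<psi> (act (m - 1) (cof g) (snd d) * x)"
  by (simp_all add: char_val_def)

text \<open>On \<open>\<Omega>\<close> this is a constant multiple of the indicator of the elements
  not excluded by \<open>i\<close>; for a prime \<open>l\<close> the constant is
  \<open>l / (l - 1)\<close>.\<close>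

definition factor :: "nat + nat + 'k poly \<Rightarrow> 'a \<Rightarrow> complex" where
  "factor i x = 1 - (\<Sum>d\<in>chars i. char_val i d x) / of_nat (card (chars i))"

lemma finite_idx: "finite idx"
  by (simp add: idx_def finite_PR finite_Pset)

lemma card_idx: "card idx = 2 * card PR + card Pset"
proof -
  have "card (Inl ` PR \<union> Inr ` Pset :: (nat + 'k poly) set) = card PR + card Pset"
    using finite_PR finite_Pset by (subst card_Un_disjoint) (auto simp: card_image)
  moreover have "card idx = card PR + card (Inl ` PR \<union> Inr ` Pset :: (nat + 'k poly) set)"
    unfolding idx_def using finite_PR finite_Pset
    by (subst card_Un_disjoint) (auto simp: card_image simp del: image_Un)
  ultimately show ?thesis
    by simp
qed

lemma mult_chars: "l \<in> PR \<Longrightarrow> finite (mult_chars l) \<and> mult_chars l \<noteq> {}"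
  unfolding mult_chars_def PR_def using prime_gt_1_nat[of l]
  by (auto simp: image_iff intro!: exI[of _ 1])

lemma chars: "i \<in> idx \<Longrightarrow> finite (chars i) \<and> chars i \<noteq> {}"
proof -
  assume "i \<in> idx"
  then consider l where "i = Inl l" "l \<in> PR" | l where "i = Inr (Inl l)" "l \<in> PR" | g where "i = Inr (Inr g)" "g \<in> Pset"
    unfolding idx_def by blast
  then show ?thesis
  proof cases
    case (3 g)
    show ?thesis
      unfolding 3(1) chars_simps using Pset_nonempty_adjoint[OF 3(2)] by simp
  qed (use mult_chars in \<open>simp_all add: chars_simps\<close>)
qed

lemma mult_charsE:
  assumes "d \<in> mult_chars l"
  obtains j where "0 < j" "j < l" "fst d = j * (n div l)"
  using assms by (auto simp: mult_chars_def)

lemma char_sum_exponent: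
  assumes A: "finite A" "A \<subseteq> PR" and d: "\<And>l. l \<in> A \<Longrightarrow> d l \<in> mult_chars l"
  shows "A \<noteq> {} \<Longrightarrow> (\<Sum>l\<in>A. fst (d l)) mod n \<noteq> 0"
    and "y \<noteq> 0 \<Longrightarrow> (\<Prod>l\<in>A. ch y ^ fst (d l)) = ch y ^ ((\<Sum>l\<in>A. fst (d l)) mod n)"
proof -
  have "\<exists>j. \<forall>l\<in>A. 0 < j l \<and> j l < l \<and> fst (d l) = j l * (n div l)"
    using d by (intro bchoice) (metis mult_charsE)
  then obtain j where j: "\<And>l. l \<in> A \<Longrightarrow> 0 < j l \<and> j l < l" "\<And>l. l \<in> A \<Longrightarrow> fst (d l) = j l * (n div l)"
    by blast
  show "(\<Sum>l\<in>A. fst (d l)) mod n \<noteq> 0" if "A \<noteq> {}"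
  proof -
    have "\<not> n dvd (\<Sum>l\<in>A. j l * (n div l))"
      using A j(1) that by (intro sum_prime_parts) (auto simp: PR_def)
    moreover have "(\<Sum>l\<in>A. fst (d l)) = (\<Sum>l\<in>A. j l * (n div l))"
      by (rule sum.cong) (simp_all add: j(2))
    ultimately show ?thesis
      by (simp only: dvd_eq_mod_eq_0 not_False_eq_True)
  qed
  show "(\<Prod>l\<in>A. ch y ^ fst (d l)) = ch y ^ ((\<Sum>l\<in>A. fst (d l)) mod n)" if "y \<noteq> 0"
    by (simp only: ch_pow_mod[OF that] power_sum)
qed

text \<open>The chosen characters collapse to two exponents of \<open>ch\<close> and one additive
  parameter \<open>\<beta>\<close>. Characters from different indices of one kind cannot cancel, by
  \<open>sum_prime_parts\<close> and \<open>Pset_sum_nonzero\<close>, so a nonempty choice stays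
  nontrivial.\<close>

lemma char_prod_bound:
  assumes T: "T \<subseteq> idx" and \<tau>: "\<And>i. i \<in> T \<Longrightarrow> \<tau> i \<in> chars i" and nontriv: "T \<noteq> {} \<or> \<gamma> \<noteq> 0"
  shows "norm (\<Sum>x\<in>\<Omega>. \<psi> (\<gamma> / x) * (\<Prod>i\<in>T. char_val i (\<tau> i) x)) \<le> Bd"
proof -
  define A where "A = Inl -` T"
  define B where "B = Inl -` (Inr -` T)"
  define D where "D = Inr -` (Inr -` T)"
  have fT: "finite T"
    using T finite_idx finite_subset by blast
  then have fR: "finite (Inr -` T)"
    by (rule finite_vimageI) simp
  with fT have fin: "finite A" "finite B" "finite D"
    by (simp_all add: A_def B_def D_def finite_vimageI)
  have sub: "A \<subseteq> PR" "B \<subseteq> PR" "D \<subseteq> Pset"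
    using T by (auto simp: A_def B_def D_def idx_def)
  have \<tau>A: "\<tau> (Inl l) \<in> mult_chars l" if "l \<in> A" for l
    using \<tau>[of "Inl l"] that by (simp add: A_def chars_simps)
  have \<tau>B: "\<tau> (Inr (Inl l)) \<in> mult_chars l" if "l \<in> B" for l
    using \<tau>[of "Inr (Inl l)"] that by (simp add: B_def chars_simps)
  have \<tau>D: "act (m - 1) (cof g) (snd (\<tau> (Inr (Inr g)))) \<noteq> 0" if "g \<in> D" for g
    using \<tau>[of "Inr (Inr g)"] that by (auto simp: D_def chars_simps)
  define a where "a = (\<Sum>l\<in>A. fst (\<tau> (Inl l))) mod n"
  define b where "b = (\<Sum>l\<in>B. fst (\<tau> (Inr (Inl l)))) mod n"
  define \<beta> where "\<beta> = (\<Sum>g\<in>D. act (m - 1) (cof g) (snd (\<tau> (Inr (Inr g)))))"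
  have ne: "a \<noteq> 0 \<or> b \<noteq> 0 \<or> \<beta> \<noteq> 0 \<or> \<gamma> \<noteq> 0"
  proof (cases "\<gamma> = 0")
    case True
    then obtain i where "i \<in> T"
      using nontriv by blast
    then have "A \<noteq> {} \<or> B \<noteq> {} \<or> D \<noteq> {}"
      unfolding A_def B_def D_def by (cases i rule: sum.exhaust, blast) (metis empty_iff sum.exhaust vimageI)
    moreover have "a \<noteq> 0" if "A \<noteq> {}"
      unfolding a_def using char_sum_exponent(1)[OF fin(1) sub(1) \<tau>A] that by blast
    moreover have "b \<noteq> 0" if "B \<noteq> {}"
      unfolding b_def using char_sum_exponent(1)[OF fin(2) sub(2) \<tau>B] that by blast
    moreover have "\<beta> \<noteq> 0" if "D \<noteq> {}"
      unfolding \<beta>_def using Pset_sum_nonzero[OF fin(3) sub(3) that \<tau>D] by blast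
    ultimately show ?thesis
      by blast
  qed simp
  have "(\<Sum>x\<in>\<Omega>. \<psi> (\<gamma> / x) * (\<Prod>i\<in>T. char_val i (\<tau> i) x)) =
      (\<Sum>x | x \<noteq> 0 \<and> poly f1 x \<noteq> 0 \<and> poly f2 x \<noteq> 0.
        ch x ^ a * ch (poly f1 x / poly f2 x) ^ b * \<psi> (\<beta> * x + \<gamma> / x))"
    unfolding \<Omega>_def
  proof (rule sum.cong[OF refl])
    fix x assume "x \<in> {x. x \<noteq> 0 \<and> poly f1 x \<noteq> 0 \<and> poly f2 x \<noteq> 0}"
    then have x: "x \<noteq> 0" "poly f1 x / poly f2 x \<noteq> 0"
      by auto
    have "(\<Prod>i\<in>T. char_val i (\<tau> i) x) = (\<Prod>l\<in>A. ch x ^ fst (\<tau> (Inl l))) *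
        ((\<Prod>l\<in>B. ch (poly f1 x / poly f2 x) ^ fst (\<tau> (Inr (Inl l)))) *
         (\<Prod>g\<in>D. \<psi> (act (m - 1) (cof g) (snd (\<tau> (Inr (Inr g)))) * x)))"
      unfolding prod_sum_type[OF fT] prod_sum_type[OF fR] A_def B_def D_def by (simp only: char_val_simps)
    also have "\<dots> = ch x ^ a * (ch (poly f1 x / poly f2 x) ^ b * \<psi> (\<beta> * x))"
      unfolding a_def b_def \<beta>_def sum_distrib_right \<psi>_sum
      by (simp only: char_sum_exponent(2)[OF fin(1) sub(1) \<tau>A x(1)] char_sum_exponent(2)[OF fin(2) sub(2) \<tau>B x(2)])
    finally show "\<psi> (\<gamma> / x) * (\<Prod>i\<in>T. char_val i (\<tau> i) x) =
        ch x ^ a * ch (poly f1 x / poly f2 x) ^ b * \<psi> (\<beta> * x + \<gamma> / x)"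
      by (simp only: \<psi>_add mult_ac)
  qed
  also have "norm \<dots> \<le> Bd"
    unfolding Bd_def by (rule rational_char_sum_bound[OF f exc _ _ ne]) (simp_all add: a_def b_def n)
  finally show ?thesis .
qed

lemma factor_eq_0:
  assumes i: "i \<in> idx" and "\<And>d. d \<in> chars i \<Longrightarrow> char_val i d x = 1"
  shows "factor i x = 0"
  using chars[OF i] assms(2) by (simp add: factor_def)

lemma mult_char_trivial:
  assumes "l \<in> PR" "ch y ^ (n div l) = 1" "d \<in> mult_chars l"
  shows "ch y ^ fst d = 1"
  using mult_charsE[OF assms(3)] assms(2) by (metis mult.commute power_mult power_one)

lemma card_\<Omega>: "real Q - 1 - real (degree f1 + degree f2) \<le> real (card \<Omega>)"
proof -
  have "Q \<le> card (\<Omega> \<union> ({0} \<union> ({x. poly f1 x = 0} \<union> {x. poly f2 x = 0})))"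
    unfolding Q_def by (rule card_mono) (auto simp: \<Omega>_def)
  also have "\<dots> \<le> card \<Omega> + (card {0::'a} + (card {x. poly f1 x = 0} + card {x. poly f2 x = 0}))"
    by (intro order_trans[OF card_Un_le] add_left_mono) (rule order_refl)
  also have "\<dots> \<le> card \<Omega> + (1 + (degree f1 + degree f2))"
    using card_poly_roots_bound[OF f(1)] card_poly_roots_bound[OF f(2)] by simp
  finally show ?thesis
    by linarith
qed

text \<open>If no element qualified, the sum of all \<open>S c\<close> would be zero, as each of its
  terms violates the trace condition or has a vanishing factor. But \<open>S 0\<close> is
  \<open>card \<Omega>\<close> up to \<open>2 ^ card idx - 1\<close> errors, and the other
  \<open>q - 1\<close> sums have \<open>2 ^ card idx\<close> errors each.\<close>

theorem exists_normal_primitive_trace: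
  assumes big: "real q * 2 ^ card idx * Bd < real Q"
  obtains x where "x \<in> \<Omega>" "primitive x" "primitive (poly f1 x / poly f2 x)" "normal_over \<iota> q m x"
    "field_trace q m (inverse x) = \<iota> a"
proof -
  have "\<exists>x\<in>\<Omega>. field_trace q m (inverse x) = \<iota> a \<and> (\<forall>i\<in>idx. factor i x \<noteq> 0)"
  proof (rule ccontr)
    assume neg: "\<not> ?thesis"
    obtain v where v: "field_trace q m v = \<iota> a"
      by (rule field_trace_surj)
    define S where "S = (\<lambda>c. \<Sum>x\<in>\<Omega>. \<psi> (\<iota> c * (inverse x - v)) * (\<Prod>i\<in>idx. factor i x))"
    have "(\<Sum>c\<in>UNIV. S c) = (\<Sum>x\<in>\<Omega>. (\<Sum>c\<in>UNIV. \<psi> (\<iota> c * (inverse x - v))) * (\<Prod>i\<in>idx. factor i x))"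
      unfolding S_def by (subst sum.swap) (simp add: sum_distrib_right)
    also have "\<dots> = 0"
    proof (rule sum.neutral, intro ballI)
      fix x assume "x \<in> \<Omega>"
      then consider "field_trace q m (inverse x) \<noteq> \<iota> a" | i where "i \<in> idx" "factor i x = 0"
        using neg by blast
      then show "(\<Sum>c\<in>UNIV. \<psi> (\<iota> c * (inverse x - v))) * (\<Prod>i\<in>idx. factor i x) = 0"
      proof cases
        case 1
        have "field_trace q m (inverse x - v) \<noteq> 0"
          using 1 v field_trace_add[of "inverse x - v" v] by auto
        from sum_\<psi>_base[OF this] show ?thesis
          by simp
      next
        case 2
        then show ?thesis
          using finite_idx by (auto simp: prod_zero_iff)
      qed
    qed
    finally have zero: "(\<Sum>c\<in>UNIV. S c) = 0" .
    have "S 0 = (\<Sum>x\<in>\<Omega>. \<Prod>i\<in>idx. factor i x)"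
      by (simp add: S_def \<iota>_0 \<psi>_0)
    also have "norm (\<dots> - of_nat (card \<Omega>)) \<le> (2 ^ card idx - 1) * Bd"
      unfolding factor_def
    proof (rule sieve_main_term[OF finite_idx chars])
      fix T \<tau> assume "T \<subseteq> idx" "T \<noteq> {}" "\<And>i. i \<in> T \<Longrightarrow> \<tau> i \<in> chars i"
      then show "norm (\<Sum>x\<in>\<Omega>. \<Prod>i\<in>T. char_val i (\<tau> i) x) \<le> Bd"
        using char_prod_bound[of T \<tau> 0] by (simp add: \<psi>_0)
    qed
    finally have S0: "norm (S 0 - of_nat (card \<Omega>)) \<le> (2 ^ card idx - 1) * Bd" .
    have Sc: "norm (S c) \<le> 2 ^ card idx * Bd" if c: "c \<noteq> 0" for c
    proof -
      have "S c = \<psi> (- (\<iota> c * v)) * (\<Sum>x\<in>\<Omega>. \<psi> (\<iota> c / x) * (\<Prod>i\<in>idx. factor i x))"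
        unfolding S_def sum_distrib_left
      proof (rule sum.cong[OF refl])
        fix x
        have "\<iota> c * (inverse x - v) = - (\<iota> c * v) + \<iota> c / x"
          by (simp add: algebra_simps divide_inverse)
        then show "\<psi> (\<iota> c * (inverse x - v)) * (\<Prod>i\<in>idx. factor i x) =
            \<psi> (- (\<iota> c * v)) * (\<psi> (\<iota> c / x) * (\<Prod>i\<in>idx. factor i x))"
          by (simp only: \<psi>_add mult.assoc)
      qed
      also have "norm \<dots> = norm (\<Sum>x\<in>\<Omega>. \<psi> (\<iota> c / x) * (\<Prod>i\<in>idx. factor i x))"
        by (simp add: norm_mult norm_\<psi>)
      also have "\<dots> \<le> 2 ^ card idx * Bd"
        unfolding factor_def
      proof (rule sieve_upper_bound[OF finite_idx chars])
        fix T \<tau> assume "T \<subseteq> idx" "\<And>i. i \<in> T \<Longrightarrow> \<tau> i \<in> chars i"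
        then show "norm (\<Sum>x\<in>\<Omega>. \<psi> (\<iota> c / x) * (\<Prod>i\<in>T. char_val i (\<tau> i) x)) \<le> Bd"
          using c by (intro char_prod_bound) (auto simp: \<iota>_eq_0)
      qed
      finally show ?thesis .
    qed
    have "(\<Sum>c\<in>UNIV. S c) = S 0 + (\<Sum>c\<in>UNIV - {0}. S c)"
      by (rule sum.remove) auto
    then have "S 0 + (\<Sum>c\<in>UNIV - {0}. S c) = 0"
      using zero by (simp only:)
    moreover have "of_nat (card \<Omega>) =
        - (S 0 - of_nat (card \<Omega>)) - (\<Sum>c\<in>UNIV - {0}. S c) + (S 0 + (\<Sum>c\<in>UNIV - {0}. S c))"
      by simp
    ultimately have "of_nat (card \<Omega>) = - (S 0 - of_nat (card \<Omega>)) - (\<Sum>c\<in>UNIV - {0}. S c)"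
      by (simp only: add_0_right)
    then have "real (card \<Omega>) = norm (- (S 0 - of_nat (card \<Omega>)) - (\<Sum>c\<in>UNIV - {0}. S c))"
      using norm_of_nat[of "card \<Omega>", where 'a = complex] by (simp only:)
    also have "\<dots> \<le> norm (S 0 - of_nat (card \<Omega>)) + norm (\<Sum>c\<in>UNIV - {0}. S c)"
      using norm_triangle_ineq4[of "- (S 0 - of_nat (card \<Omega>))" "\<Sum>c\<in>UNIV - {0}. S c"]
      by (simp only: norm_minus_cancel)
    also have "\<dots> \<le> (2 ^ card idx - 1) * Bd + (\<Sum>c\<in>UNIV - {0 :: 'k}. 2 ^ card idx * Bd)"
      by (intro add_mono S0 sum_norm_le) (auto intro: Sc)
    also have "\<dots> = real q * 2 ^ card idx * Bd - Bd"
      using q1 by (simp add: card_Diff_singleton cardk of_nat_diff algebra_simps)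
    finally have "real (card \<Omega>) \<le> real q * 2 ^ card idx * Bd - Bd" .
    \<comment> \<open>The one \<open>Bd\<close> saved by separating the main term outweighs the at
      most \<open>degree f1 + degree f2 + 1\<close> elements outside
      \<open>\<Omega>\<close>.\<close>
    moreover have "real (degree f1 + degree f2 + 2) * 1 \<le> Bd"
      unfolding Bd_def using n by (intro mult_left_mono) auto
    ultimately show False
      using big card_\<Omega> by simp
  qed
  then obtain x where x: "x \<in> \<Omega>" "field_trace q m (inverse x) = \<iota> a" "\<And>i. i \<in> idx \<Longrightarrow> factor i x \<noteq> 0"
    by blast
  have 1: "primitive x"
  proof (rule primitiveI)
    fix l assume l: "prime l" "l dvd n"
    then have PR: "l \<in> PR"
      by (simp add: PR_def)
    then have i: "Inl l \<in> idx"
      by (simp add: idx_def)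
    show "ch x ^ (n div l) \<noteq> 1"
      using x(3)[OF i] factor_eq_0[OF i, of x] mult_char_trivial[OF PR, of x]
      by (auto simp: chars_simps char_val_simps)
  qed (use x(1) in \<open>simp add: \<Omega>_def\<close>)
  have 2: "primitive (poly f1 x / poly f2 x)"
  proof (rule primitiveI)
    fix l assume l: "prime l" "l dvd n"
    then have PR: "l \<in> PR"
      by (simp add: PR_def)
    then have i: "Inr (Inl l) \<in> idx"
      by (simp add: idx_def)
    show "ch (poly f1 x / poly f2 x) ^ (n div l) \<noteq> 1"
      using x(3)[OF i] factor_eq_0[OF i, of x] mult_char_trivial[OF PR, of "poly f1 x / poly f2 x"]
      by (auto simp: chars_simps char_val_simps)
  qed (use x(1) in \<open>simp add: \<Omega>_def\<close>)
  have 3: "normal_over \<iota> q m x"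
  proof (rule normal_overI)
    fix g assume g: "g \<in> Pset"
    then have i: "Inr (Inr g) \<in> idx"
      by (simp add: idx_def)
    show "act 1 (cof g) x \<noteq> 0"
    proof
      assume z: "act 1 (cof g) x = 0"
      have "\<psi> (act (m - 1) (cof g) \<delta> * x) = 1" for \<delta>
        unfolding \<psi>_adjoint[symmetric] z by (simp add: \<psi>_0)
      then show False
        using x(3)[OF i] factor_eq_0[OF i, of x] by (auto simp: char_val_simps)
    qed
  qed
  show ?thesis
    by (rule that[OF x(1) 1 2 3 x(2)])
qed

end

theorem theorem3p1:
  fixes \<iota> :: "'k::{field,finite} \<Rightarrow> 'a::{field,finite}"
    and q m n :: nat
  assumes "primepow q"
    and "m \<ge> 3"
    and "finite_field_ext \<iota> q m"
    and "real q powr (real m / 2 - 1) >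
           real (n + 2) * real (W_nat (q ^ m - 1)) ^ 2 * real (W_poly (monom 1 m - 1 :: 'k poly))"
  shows "(q, m) \<in> T_set \<iota> n"
proof -
  have cardinality: "CARD('k) = q" "CARD('a) = q ^ m"
    and hom: "\<iota> 1 = 1" "\<And>x y. \<iota> (x + y) = \<iota> x + \<iota> y" "\<And>x y. \<iota> (x * y) = \<iota> x * \<iota> y"
    using assms(3) by (auto simp: finite_field_ext_def)
  obtain r \<kappa> where r: "prime r" "\<kappa> > 0" "q = r ^ \<kappa>"
    using assms(1) by (auto simp: primepow_def)
  have "prime CHAR('a)"
    using finite_imp_CHAR_pos[where 'a = 'a, OF finite] by (rule prime_CHAR_semidom)
  moreover have "CHAR('a) dvd r ^ (\<kappa> * m)"
    using CHAR_dvd_CARD[where 'a = 'a] cardinality r by (simp add: power_mult)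
  ultimately have char: "CHAR('a) = r"
    using r(1) by (metis prime_dvd_power primes_dvd_imp_eq)
  obtain w :: 'a where w: "w \<noteq> 0" "\<And>x. x \<noteq> 0 \<Longrightarrow> \<exists>i::nat. x = w ^ i"
    using finite_field_generator[where 'a = 'a] by blast
  interpret finfield "\<kappa> * m" w
    using cardinality r char w assms(2) by unfold_locales (auto simp: power_mult)
  interpret ext "\<kappa> * m" w \<iota> q m \<kappa>
    using cardinality r char hom assms(2) by unfold_locales (auto simp: p_def)
  have main: "\<exists>\<alpha>. normal_over \<iota> q m \<alpha> \<and> primitive_pair f \<alpha> \<and> field_trace q m (inverse \<alpha>) = \<iota> a"
    if n12: "n1 + n2 = n" and f: "f \<in> S_set n1 n2" for n1 n2 f a
  proof -
    obtain f1 f2 where red: "reduced_form f f1 f2" and deg: "degree f1 \<le> n1" "degree f2 \<le> n2"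
      and exc: "\<not> exceptional f"
      using f unfolding S_set_def by blast
    have F: "f = Fract f1 f2" "coprime f1 f2" "f1 \<noteq> 0" "lead_coeff f2 = 1" 
      using red unfolding reduced_form_def by blast+
    interpret sieve_setting "\<kappa> * m" w \<iota> q m \<kappa> f1 f2
      using F exc by unfold_locales auto
    have W: "real (W_nat (q ^ m - 1)) ^ 2 * real (W_poly (monom 1 m - 1 :: 'k poly)) = 2 ^ card idx"
      unfolding card_idx W_nat_def W_poly_def PR_def Pset_def n_def Q_def cardinality(2)
      by (simp add: power_add mult_2 power2_eq_square)
    \<comment> \<open>The hypothesis is multiplied by \<open>q * sqrt Q\<close>, which is
      \<open>q\<close> to the power \<open>m / 2 + 1\<close>; this turns its left side into
      \<open>Q\<close>.\<close>
    have "real q * 2 ^ card idx * Bd \<le> real q * 2 ^ card idx * (real (n + 2) * sqrt (real Q))"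
      unfolding Bd_def using deg n12 by (intro mult_left_mono mult_right_mono) auto
    also have "\<dots> = (real q * sqrt (real Q)) * (real (n + 2) * 2 ^ card idx)"
      by (simp only: mult_ac)
    also have "\<dots> < (real q * sqrt (real Q)) * (real q powr (real m / 2 - 1))"
      using assms(4) q1 n unfolding mult.assoc W by (intro mult_strict_left_mono) auto
    also have "\<dots> = real Q"
    proof -
      have "sqrt (real Q) = real q powr (real m / 2)"
        using q1 by (simp add: Qq powr_half_sqrt[symmetric] powr_powr flip: powr_realpow)
      then have "real q * sqrt (real Q) * real q powr (real m / 2 - 1) = real q powr (1 + real m / 2 + (real m / 2 - 1))"
        using q1 by (simp only: powr_add powr_one)
      also have "\<dots> = real Q"
        using q1 by (simp add: Qq powr_realpow)
      finally show ?thesis .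
    qed
    finally obtain \<alpha> where \<alpha>: "\<alpha> \<in> \<Omega>" "primitive \<alpha>" "primitive (poly f1 \<alpha> / poly f2 \<alpha>)"
        "normal_over \<iota> q m \<alpha>" "field_trace q m (inverse \<alpha>) = \<iota> a"
      by (rule exists_normal_primitive_trace)
    then show ?thesis
      using red unfolding primitive_pair_def \<Omega>_def by blast
  qed
  show ?thesis
    unfolding T_set_def T_pair_def using assms(1,3) main by blast
qed

end
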